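(* Let $\mathfrak{g}=\mathfrak{sp}(n,\mathbb{C})$ and let $\mathfrak{p}$ be a standard parabolic subalgebra of type $(n_1,n_2,\dots,n_k)$. Let $p=(p_1,\dots,p_N)$ be the shape (row lengths) of the Z-diagram of type $(n_k;n_1,\dots,n_{k-1})$, so that its sequence of column lengths is $$p^t=(m_1,m_1,m_2,m_2,\dots,m_{s-1},m_{s-1},2m_s,m_{s+1},m_{s+1},\dots,m_k,m_k),$$ where $m_s=n_k$ and $(m_1,\dots,m_k)$ is the arrangement of $(n_1,\dots,n_k)$ for which this sequence is in descending order. Then the Richardson orbit $\mathcal{O}$ associated to $\mathfrak{p}$ has partition $$\mathbf{p}=[p_1,p_2,\dots,p_N]_{C},$$ where $[\,\cdot\,]_C$ denotes the $C$-collapse.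
   Context: Lie algebra and parabolics. $\mathfrak{g}=\mathfrak{sp}(n,\mathbb{C})$ is the symplectic Lie algebra of rank $n$ ($2n\times 2n$ matrices, type $C_n$) with simple roots $\Delta$: $\alpha_i=e_i-e_{i+1}$ ($1\le i\le n-1$), $\alpha_n=2e_n$. For $I\subset\Delta$, $\mathfrak{p}=\mathfrak{p}_I=\mathfrak{l}\oplus\mathfrak{u}$ is the standard parabolic subalgebra whose Levi factor $\mathfrak{l}$ has root system generated by $I$, $\mathfrak{u}$ being its nilradical. It is of type $(n_1,\dots,n_k)$ if $n_1,\dots,n_{k-1}$ are positive integers, $n_k=n-\sum_{i<k}n_i\ge0$, and $\Delta\setminus I=\{\alpha_{p_1},\dots,\alpha_{p_{k-1}}\}$ with $p_t=n_1+\dots+n_t$ (these indices are unrelated to the row lengths $p_i$ in the claim). Richardson orbit: the unique nilpotent $G$-orbit in $\mathfrak{g}$ ($G$ a complex Lie group with Lie algebra $\mathfrak{g}$) meeting $\mathfrak{u}$ in an open dense subset of $\mathfrak{u}$. Nilpotent orbits of $\mathfrak{sp}(n,\mathbb{C})$ are in bijection, via Jordan type, with partitions of $2n$ of type $C_n$, i.e. those in which odd parts occur with even multiplicity. Z-diagram. For integers $a_0\ge0$, $b_1,\dots,b_{k-1}>0$, the Z-diagram of type $(a_0;b_1,\dots,b_{k-1})$ is the Young diagram whose multiset of column lengths is $\{2a_0,b_1,b_1,\dots,b_{k-1},b_{k-1}\}$. Collapse. A partition $\mathbf{d}$ dominates $\mathbf{f}$ (of the same integer) if $\sum_{j\le l}d_j\ge\sum_{j\le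 l}f_j$ for all $l$. For a partition $\mathbf{d}$ of $2n$, its $C$-collapse $\mathbf{d}_C$ is the unique largest partition of $2n$ of type $C_n$ dominated by $\mathbf{d}$. *)

theory Defs
  imports "HOL-Analysis.Function_Topology" "Jordan_Normal_Form.Jordan_Normal_Form"
    "HOL-Library.Multiset"
begin

section \<open>The symplectic Lie algebra and the symplectic group\<close>

text \<open>The symplectic form on the space of column vectors of length \<open>2n\<close> has Gram matrix
  \<open>(0, 1; -1, 0)\<close> in \<open>n \<times> n\<close> blocks, so that the diagonal matrices in \<open>sp n\<close> are
  \<open>diag(h\<^sub>1, \<dots>, h\<^sub>n, -h\<^sub>1, \<dots>, -h\<^sub>n)\<close> and form a Cartan subalgebra.\<close>

definition symplectic_form :: "nat \<Rightarrow> complex mat" where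
  "symplectic_form n = four_block_mat (0\<^sub>m n n) (1\<^sub>m n) (- 1\<^sub>m n) (0\<^sub>m n n)"

definition sp :: "nat \<Rightarrow> complex mat set" where
  "sp n = {X \<in> carrier_mat (2 * n) (2 * n).
     transpose_mat X * symplectic_form n + symplectic_form n * X = 0\<^sub>m (2 * n) (2 * n)}"

definition Sp_group :: "nat \<Rightarrow> complex mat set" where
  "Sp_group n = {A \<in> carrier_mat (2 * n) (2 * n).
     transpose_mat A * symplectic_form n * A = symplectic_form n}"

definition lie_bracket :: "complex mat \<Rightarrow> complex mat \<Rightarrow> complex mat" where
  "lie_bracket X Y = X * Y - Y * X"

definition is_subspace :: "nat \<Rightarrow> complex mat set \<Rightarrow> bool" where
  "is_subspace n V \<longleftrightarrow> V \<subseteq> carrier_mat (2 * n) (2 * n) \<and> 0\<^sub>m (2 * n) (2 * n) \<in> V \<and>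
     (\<forall>X\<in>V. \<forall>Y\<in>V. X + Y \<in> V) \<and> (\<forall>c. \<forall>X\<in>V. c \<cdot>\<^sub>m X \<in> V)"

section \<open>Roots and standard parabolic subalgebras\<close>

definition cartan :: "nat \<Rightarrow> complex mat set" where
  "cartan n = {H \<in> sp n. diagonal_mat H}"

text \<open>A linear functional on the Cartan subalgebra is represented by its coordinates with
  respect to the basis \<open>e\<^sub>1, \<dots>, e\<^sub>n\<close> of the dual space, where \<open>e\<^sub>i(H) = h\<^sub>i\<close>; the coordinates
  outside \<open>{1..n}\<close> are zero. Matrix indices start at 0.\<close>

type_synonym weight = "nat \<Rightarrow> complex"

definition weight_value :: "nat \<Rightarrow> weight \<Rightarrow> complex mat \<Rightarrow> complex" where
  "weight_value n \<beta> H = (\<Sum>i = 1..n. \<beta> i * H $$ (i - 1, i - 1))"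

definition root_space :: "nat \<Rightarrow> weight \<Rightarrow> complex mat set" where
  "root_space n \<beta> = {X \<in> sp n. \<forall>H\<in>cartan n. lie_bracket H X = weight_value n \<beta> H \<cdot>\<^sub>m X}"

definition roots :: "nat \<Rightarrow> weight set" where
  "roots n = {\<beta>. (\<forall>i. i \<notin> {1..n} \<longrightarrow> \<beta> i = 0) \<and> \<beta> \<noteq> (\<lambda>_. 0) \<and>
     root_space n \<beta> \<noteq> {0\<^sub>m (2 * n) (2 * n)}}"

definition eps :: "nat \<Rightarrow> weight" where
  "eps i = (\<lambda>j. if j = i then 1 else 0)"

definition simple_root :: "nat \<Rightarrow> nat \<Rightarrow> weight" where
  "simple_root n i = (if i < n then (\<lambda>j. eps i j - eps (i + 1) j) else (\<lambda>j. 2 * eps n j))"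

definition simple_roots :: "nat \<Rightarrow> weight set" where
  "simple_roots n = simple_root n ` {1..n}"

definition positive_roots :: "nat \<Rightarrow> weight set" where
  "positive_roots n = {\<beta> \<in> roots n.
     \<exists>c :: weight \<Rightarrow> nat. \<beta> = (\<lambda>j. \<Sum>\<alpha>\<in>simple_roots n. of_nat (c \<alpha>) * \<alpha> j)}"

definition generated_roots :: "nat \<Rightarrow> weight set \<Rightarrow> weight set" where
  "generated_roots n I = {\<beta> \<in> roots n.
     \<exists>c :: weight \<Rightarrow> int. \<beta> = (\<lambda>j. \<Sum>\<alpha>\<in>I. of_int (c \<alpha>) * \<alpha> j)}"

text \<open>The standard parabolic subalgebra contains the Borel subalgebra of the positive roots.\<close>

definition standard_parabolic :: "nat \<Rightarrow> weight set \<Rightarrow> complex mat set" where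
  "standard_parabolic n I = is_subspace n hull
     (cartan n \<union> (\<Union>\<beta>\<in>positive_roots n \<union> generated_roots n I. root_space n \<beta>))"

definition parabolic_type :: "nat \<Rightarrow> weight set \<Rightarrow> nat list \<Rightarrow> bool" where
  "parabolic_type n I ns \<longleftrightarrow> ns \<noteq> [] \<and> (\<forall>m\<in>set (butlast ns). 0 < m) \<and> sum_list ns = n \<and>
     simple_roots n - I = {simple_root n (sum_list (take t ns)) | t. 1 \<le> t \<and> t < length ns}"

section \<open>The nilradical\<close>

definition is_lie_ideal :: "nat \<Rightarrow> complex mat set \<Rightarrow> complex mat set \<Rightarrow> bool" where
  "is_lie_ideal n \<aa> \<pp> \<longleftrightarrow> is_subspace n \<aa> \<and> \<aa> \<subseteq> \<pp> \<and> (\<forall>X\<in>\<pp>. \<forall>Y\<in>\<aa>. lie_bracket X Y \<in> \<aa>)"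

fun lower_central :: "nat \<Rightarrow> complex mat set \<Rightarrow> nat \<Rightarrow> complex mat set" where
  "lower_central n \<aa> 0 = \<aa>"
| "lower_central n \<aa> (Suc m) =
     is_subspace n hull {lie_bracket X Y | X Y. X \<in> \<aa> \<and> Y \<in> lower_central n \<aa> m}"

definition is_nilpotent_ideal :: "nat \<Rightarrow> complex mat set \<Rightarrow> complex mat set \<Rightarrow> bool" where
  "is_nilpotent_ideal n \<aa> \<pp> \<longleftrightarrow>
     is_lie_ideal n \<aa> \<pp> \<and> (\<exists>m. lower_central n \<aa> m = {0\<^sub>m (2 * n) (2 * n)})"

definition nilradical :: "nat \<Rightarrow> complex mat set \<Rightarrow> complex mat set" where
  "nilradical n \<pp> = (THE \<uu>. is_nilpotent_ideal n \<uu> \<pp> \<and>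
     (\<forall>\<aa>. is_nilpotent_ideal n \<aa> \<pp> \<longrightarrow> \<aa> \<subseteq> \<uu>))"

section \<open>Nilpotent orbits and Richardson orbits\<close>

definition adjoint_orbit :: "nat \<Rightarrow> complex mat \<Rightarrow> complex mat set" where
  "adjoint_orbit n X = {Y. \<exists>A\<in>Sp_group n. \<exists>B. similar_mat_wit Y X A B}"

definition is_nilpotent_orbit :: "nat \<Rightarrow> complex mat set \<Rightarrow> bool" where
  "is_nilpotent_orbit n \<O> \<longleftrightarrow>
     (\<exists>X\<in>sp n. (\<exists>m. X ^\<^sub>m m = 0\<^sub>m (2 * n) (2 * n)) \<and> \<O> = adjoint_orbit n X)"

text \<open>The usual topology on the space of \<open>nr \<times> nc\<close> matrices, i.e. that of \<open>nr \<cdot> nc\<close> complex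
  coordinates.\<close>

definition mat_topology :: "nat \<Rightarrow> nat \<Rightarrow> complex mat topology" where
  "mat_topology nr nc = pullback_topology (carrier_mat nr nc)
     (\<lambda>A. restrict (\<lambda>ij. A $$ ij) ({..<nr} \<times> {..<nc}))
     (product_topology (\<lambda>_. euclidean) ({..<nr} \<times> {..<nc}))"

definition is_richardson_orbit :: "nat \<Rightarrow> complex mat set \<Rightarrow> complex mat set \<Rightarrow> bool" where
  "is_richardson_orbit n \<pp> \<O> \<longleftrightarrow> is_nilpotent_orbit n \<O> \<and>
     (let \<uu> = nilradical n \<pp>; T = subtopology (mat_topology (2 * n) (2 * n)) \<uu>
      in openin T (\<O> \<inter> \<uu>) \<and> T closure_of (\<O> \<inter> \<uu>) = \<uu>)"

section \<open>Partitions\<close>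

definition is_partition :: "nat \<Rightarrow> nat list \<Rightarrow> bool" where
  "is_partition N d \<longleftrightarrow> sorted_wrt (\<ge>) d \<and> 0 \<notin> set d \<and> sum_list d = N"

definition is_C_partition :: "nat \<Rightarrow> nat list \<Rightarrow> bool" where
  "is_C_partition N d \<longleftrightarrow> is_partition N d \<and> (\<forall>i. odd i \<longrightarrow> even (count_list d i))"

definition dominates :: "nat list \<Rightarrow> nat list \<Rightarrow> bool" where
  "dominates d f \<longleftrightarrow> (\<forall>l. sum_list (take l f) \<le> sum_list (take l d))"

definition C_collapse :: "nat list \<Rightarrow> nat list" where
  "C_collapse d = (THE f. is_C_partition (sum_list d) f \<and> dominates d f \<and>
     (\<forall>g. is_C_partition (sum_list d) g \<and> dominates d g \<longrightarrow> dominates f g))"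

definition orbit_has_partition :: "complex mat set \<Rightarrow> nat list \<Rightarrow> bool" where
  "orbit_has_partition \<O> d \<longleftrightarrow> (\<forall>X\<in>\<O>. jordan_nf X (map (\<lambda>r. (r, 0)) d))"

text \<open>From the column lengths of a Young diagram, in any order and possibly with zeros (which
  stand for no column), to its row lengths; on partitions this is the transpose.\<close>

definition transpose_partition :: "nat list \<Rightarrow> nat list" where
  "transpose_partition cs =
     map (\<lambda>i. length (filter (\<lambda>c. i < c) cs)) [0..<Max (insert 0 (set cs))]"

definition Z_diagram :: "nat \<Rightarrow> nat list \<Rightarrow> nat list" where
  "Z_diagram a bs = transpose_partition (2 * a # bs @ bs)"

text \<open>The sequence \<open>(m\<^sub>1, m\<^sub>1, \<dots>, 2m\<^sub>s, \<dots>, m\<^sub>k, m\<^sub>k)\<close>, with the index \<open>s\<close> counted from 0.\<close>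

definition Z_columns :: "nat list \<Rightarrow> nat \<Rightarrow> nat list" where
  "Z_columns ms s =
     concat (map (\<lambda>i. if i = s then [2 * ms ! i] else [ms ! i, ms ! i]) [0..<length ms])"

end

theory Submission
  imports Defs "Jordan_Normal_Form.Jordan_Normal_Form_Existence"
begin

text \<open>
  The Jordan type \<open>d\<close> of a nilpotent matrix \<open>X\<close> is encoded in the kernel dimensions
  \<open>dim ker X\<^sup>m = (\<Sum>i. min m d\<^sub>i)\<close>, written \<open>trunc_size m d\<close> below; larger kernels mean smaller
  partitions in the dominance order (\<open>dominates_if_trunc_size_le\<close>). The theorem follows by squeezing
  the Jordan type \<open>d\<close> of the Richardson orbit between two bounds.

  Give the basis vectors of the \<open>t\<close>-th block of a parabolic of type \<open>(n\<^sub>1, \<dots>, n\<^sub>k)\<close> the degree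
  \<open>k - t\<close>, and their symplectic duals the opposite degree. The standard parabolic consists of the
  elements of \<open>sp n\<close> that do not lower degrees, and its nilradical of those that raise degrees
  (\<open>standard_parabolic_graded\<close>, \<open>nilradical_graded\<close>). The degree pieces of \<open>\<complex>\<^sup>2\<^sup>n\<close> have dimensions
  \<open>n\<^sub>1, \<dots>, n\<^bsub>k-1\<^esub>, 2n\<^sub>k, n\<^bsub>k-1\<^esub>, \<dots>, n\<^sub>1\<close>, the columns of the Z-diagram \<open>p\<close>.

  Upper bound. If \<open>X\<close> raises degrees, then \<open>dim ker X\<^sup>m\<close> is at least the total dimension of any \<open>m\<close>
  degree pieces (\<open>strictly_graded_rank_bound\<close>); taking the largest pieces shows that \<open>p\<close> dominates \<open>d\<close>.
  Moreover the form \<open>(x, X\<^sup>m y)\<close> is skew for even \<open>m\<close>, so \<open>X\<^sup>m\<close> has even rank, and this forces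
  \<open>d\<close> to be of type C (\<open>sp_jordan_type_C_partition\<close>). Hence the collapse of \<open>p\<close> dominates \<open>d\<close>.

  Lower bound. The first \<open>2n\<^sub>k\<close> rows of \<open>p\<close> are odd and the other rows are even, so the collapse
  merely moves one box from the longer to the shorter row in each unequal pair among rows
  \<open>(1, 2), (3, 4), \<dots>\<close> of the odd part (\<open>C_collapse_paired\<close>). For each \<open>m\<close> there is an explicit
  element of the nilradical, a signed partial permutation matrix running along chains of basis
  vectors, for which \<open>dim ker X\<^sup>m\<close> is at most the value belonging to the collapse
  (\<open>card_chain_bottom_le\<close>). A rank bounded below is an open condition, so by density some element of
  the orbit satisfies the same bound (\<open>dense_contains_large_rank\<close>), and \<open>dim ker X\<^sup>m\<close> is constant on
  the orbit. Therefore \<open>d\<close> dominates the collapse, and the two partitions agree.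

  The assertion on the columns of \<open>p\<close> holds because transposition is an involution on partitions
  (\<open>transpose_partition_involution\<close>).
\<close>

section \<open>Partitions and the C-collapse\<close>

definition trunc_size :: "nat \<Rightarrow> nat list \<Rightarrow> nat" where
  "trunc_size k d = sum_list (map (min k) d)"

lemma trunc_size_add_excess: "trunc_size k d + (\<Sum>x\<leftarrow>d. x - k) = sum_list d"
  unfolding trunc_size_def by (induction d) auto

lemma sum_take_le_excess: "sum_list (take l d) \<le> k * l + (\<Sum>x\<leftarrow>d. x - k)"
proof (induction d arbitrary: l)
  case (Cons x d)
  show ?case
  proof (cases l)
    case (Suc m)
    then show ?thesis using Cons.IH[of m] by auto
  qed auto
qed auto

lemma excess_of_large: "(\<forall>x\<in>set d. k \<le> x) \<Longrightarrow> k * length d + (\<Sum>x\<leftarrow>d. x - k) = sum_list d"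
  by (induction d) auto

lemma excess_of_small: "(\<forall>x\<in>set d. x \<le> k) \<Longrightarrow> (\<Sum>x\<leftarrow>d. x - k) = (0::nat)"
  by (induction d) auto

lemma sum_take_eq_excess:
  assumes "sorted_wrt (\<ge>) d" "l < length d"
  shows "sum_list (take l d) = d ! l * l + (\<Sum>x\<leftarrow>d. x - d ! l)"
proof -
  let ?k = "d ! l"
  have ge: "\<forall>x\<in>set (take l d). ?k \<le> x"
    using assms by (auto simp: in_set_conv_nth sorted_wrt_iff_nth_less)
  have le: "x \<le> ?k" if x: "x \<in> set (drop l d)" for x
  proof -
    obtain i where i: "x = d ! (l + i)" "l + i < length d"
      using x by (auto simp: in_set_conv_nth)
    show ?thesis
      using assms i by (cases i) (auto simp: sorted_wrt_iff_nth_less)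
  qed
  have "(\<Sum>x\<leftarrow>d. x - ?k) = (\<Sum>x\<leftarrow>take l d. x - ?k) + (\<Sum>x\<leftarrow>drop l d. x - ?k)"
    by (metis append_take_drop_id map_append sum_list_append)
  then show ?thesis
    using excess_of_large[OF ge] excess_of_small[of "drop l d" ?k] le assms(2) by (simp add: min_def)
qed

text \<open>For every \<open>k\<close>, a prefix of length \<open>l\<close> has sum at most \<open>k l\<close> plus the total excess of the parts
  over \<open>k\<close>; for a descending list this is an equality at \<open>k = d ! l\<close>.\<close>
lemma dominates_if_trunc_size_le:
  assumes "sorted_wrt (\<ge>) d" "sum_list d = sum_list f"
    and le: "\<And>k. trunc_size k d \<le> trunc_size k f"
  shows "dominates d f"
  unfolding dominates_def
proof
  fix l
  show "sum_list (take l f) \<le> sum_list (take l d)"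
  proof (cases "l < length d")
    case True
    let ?k = "d ! l"
    have "sum_list (take l f) \<le> ?k * l + (\<Sum>x\<leftarrow>f. x - ?k)" by (rule sum_take_le_excess)
    also have "(\<Sum>x\<leftarrow>f. x - ?k) \<le> (\<Sum>x\<leftarrow>d. x - ?k)"
      using le[of ?k] trunc_size_add_excess[of ?k d] trunc_size_add_excess[of ?k f] assms(2) by linarith
    finally show ?thesis using sum_take_eq_excess[OF assms(1) True] by simp
  next
    case False
    have "sum_list (take l f) \<le> sum_list f"
      by (metis append_take_drop_id le_add1 sum_list_append)
    then show ?thesis using False assms(2) by simp
  qed
qed

lemma eq_if_prefix_sums_eq:
  fixes d f :: "nat list"
  assumes "\<And>l. sum_list (take l d) = sum_list (take l f)" "0 \<notin> set d" "0 \<notin> set f"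
  shows "d = f"
  using assms
proof (induction d arbitrary: f)
  case Nil
  show ?case using Nil(1)[of 1] Nil(3) by (cases f) auto
next
  case (Cons x d)
  show ?case
  proof (cases f)
    case Nil
    then show ?thesis using Cons.prems(1)[of 1] Cons.prems(2) by auto
  next
    case (Cons y f')
    have xy: "x = y" using Cons.prems(1)[of 1] Cons by simp
    have "sum_list (take l d) = sum_list (take l f')" for l
      using Cons.prems(1)[of "Suc l"] Cons xy by simp
    then show ?thesis using Cons.IH[of f'] Cons.prems xy Cons by simp
  qed
qed

lemma dominates_antisym:
  assumes "is_partition N d" "is_partition N f" "dominates d f" "dominates f d"
  shows "d = f"
  using assms by (intro eq_if_prefix_sums_eq le_antisym) (auto simp: is_partition_def dominates_def)

lemma C_collapse_eqI:
  assumes "is_C_partition (sum_list d) f" "dominates d f"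
    and "\<And>g. is_C_partition (sum_list d) g \<Longrightarrow> dominates d g \<Longrightarrow> dominates f g"
  shows "C_collapse d = f"
  unfolding C_collapse_def
  using assms by (intro the_equality) (auto intro!: dominates_antisym simp: is_C_partition_def)

text \<open>A prefix with odd sum contains an odd number of odd parts, so it must cut a run of equal odd parts.\<close>
lemma C_partition_odd_prefix:
  assumes g: "is_C_partition N g" and odd: "odd (sum_list (take l g))"
  shows "0 < l \<and> l < length g \<and> g ! (l - 1) = g ! l"
proof (rule ccontr)
  assume split: "\<not> ?thesis"
  have srt: "sorted_wrt (\<ge>) g" and cnt: "\<And>i. odd i \<Longrightarrow> even (count_list g i)"
    using g by (auto simp: is_C_partition_def is_partition_def)
  have app: "g = take l g @ drop l g" by simp
  have disj: "v \<notin> set (drop l g)" if v: "v \<in> set (take l g)" for v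
  proof
    assume "v \<in> set (drop l g)"
    then obtain j where j: "v = g ! (l + j)" "l + j < length g" by (auto simp: in_set_conv_nth)
    obtain i where i: "v = g ! i" "i < l" "i < length g" using v by (auto simp: in_set_conv_nth)
    have "g ! (l - 1) \<le> v"
      using srt i j by (cases "i = l - 1") (auto simp: sorted_wrt_iff_nth_less)
    moreover have "g ! (l + j) \<le> g ! l"
      using srt j(2) by (cases "j = 0") (auto simp: sorted_wrt_iff_nth_less)
    moreover have "g ! l \<le> g ! (l - 1)"
      using srt i j by (auto simp: sorted_wrt_iff_nth_less)
    ultimately show False using split i j by auto
  qed
  have "even (count_list (take l g) v * v)" if v: "v \<in> set (take l g)" for v
  proof (cases "even v")
    case False
    have "count_list g v = count_list (take l g) v + count_list (drop l g) v"
      by (subst app) (rule count_list_append)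
    then show ?thesis using cnt[OF False] disj[OF v] by (simp add: count_list_0_iff)
  qed auto
  then have "even (\<Sum>v\<in>set (take l g). count_list (take l g) v * v)" by (intro dvd_sum) auto
  then show False
    using odd sum_list_map_eq_sum_count[of "\<lambda>x. x" "take l g"] by simp
qed

lemma sum_list_take_map_upt: "sum_list (take l (map h [0..<m])) = (\<Sum>i<min l m. h i)"
proof -
  have "take l [0..<m] = [0..<min l m]" by (cases "l \<le> m") (auto simp: min_def)
  then show ?thesis
    by (simp only: take_map interv_sum_list_conv_sum_set_nat set_upt atLeast0LessThan)
qed

lemma sum_list_take_nth: "sum_list (take l p) = (\<Sum>i<min l (length p). p ! i)"
  using sum_list_take_map_upt[of l "(!) p" "length p"] by (simp add: map_nth)

lemma sum_lessThan_pairs: "(\<Sum>r<2 * m. h r) = (\<Sum>j<m. h (2 * j) + h (2 * j + 1 :: nat) :: nat)"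
  by (induction m) auto

lemma count_list_map_upt: "count_list (map h [0..<m]) v = (\<Sum>i<m. of_bool (h i = v))"
  by (induction m) auto

text \<open>Parts are numbered from 0. When the first \<open>2a\<close> parts of \<open>p\<close> are odd and the others even, this
  is the \<open>i\<close>-th part of the C-collapse: one box moves down in each unequal pair \<open>(2j, 2j + 1)\<close> of
  odd parts, which makes both of them even.\<close>
definition paired_collapse :: "nat list \<Rightarrow> nat \<Rightarrow> nat \<Rightarrow> nat" where
  "paired_collapse p a i =
     (if i < 2 * a \<and> p ! (2 * (i div 2) + 1) < p ! (2 * (i div 2))
      then if even i then p ! i - 1 else p ! i + 1 else p ! i)"

context
  fixes p :: "nat list" and a :: nat
  assumes p_sorted: "sorted_wrt (\<ge>) p" and p_pos: "0 \<notin> set p" and p_len: "2 * a \<le> length p"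
    and p_odd: "\<And>i. i < 2 * a \<Longrightarrow> odd (p ! i)"
    and p_even: "\<And>i. 2 * a \<le> i \<Longrightarrow> i < length p \<Longrightarrow> even (p ! i)"
begin

lemma gap_at_least_two:
  assumes "j < a" "p ! (2 * j + 1) < p ! (2 * j)"
  shows "p ! (2 * j + 1) + 2 \<le> p ! (2 * j)"
  using assms p_odd[of "2 * j"] p_odd[of "2 * j + 1"] by presburger

lemma parts_antimono: "i \<le> j \<Longrightarrow> j < length p \<Longrightarrow> p ! j \<le> p ! i"
  using p_sorted by (cases "i = j") (auto simp: sorted_wrt_iff_nth_less)

lemma part_pos: "i < length p \<Longrightarrow> 0 < p ! i"
  using p_pos by (metis gr0I nth_mem)

lemma paired_collapse_even_at_gap:
  "i < 2 * a \<Longrightarrow> p ! (2 * (i div 2) + 1) < p ! (2 * (i div 2)) \<Longrightarrow> even (paired_collapse p a i)"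
  using p_odd[of i] unfolding paired_collapse_def by auto

text \<open>The collapse loses a box only in prefixes that end in the middle of an unequal pair.\<close>
lemma paired_collapse_prefix:
  "l \<le> length p \<Longrightarrow> (\<Sum>i<l. paired_collapse p a i) +
     (if odd l \<and> l < 2 * a \<and> p ! l < p ! (l - 1) then 1 else 0) = (\<Sum>i<l. p ! i)"
proof (induction l)
  case (Suc l)
  have IH: "(\<Sum>i<l. paired_collapse p a i) +
     (if odd l \<and> l < 2 * a \<and> p ! l < p ! (l - 1) then 1 else 0) = (\<Sum>i<l. p ! i)"
    using Suc by simp
  have pos: "0 < p ! l" using Suc.prems part_pos by simp
  show ?case
  proof (cases "even l")
    case True
    then have dv: "2 * (l div 2) = l" by simp
    have "l < 2 * a \<longleftrightarrow> Suc l < 2 * a" using True by presburger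
    then have "paired_collapse p a l =
        (if Suc l < 2 * a \<and> p ! Suc l < p ! l then p ! l - 1 else p ! l)"
      using True by (simp add: paired_collapse_def dv)
    then show ?thesis using True IH pos by auto
  next
    case False
    then have dv: "2 * (l div 2) = l - 1" "l - 1 + 1 = l" by presburger+
    then have "paired_collapse p a l =
        (if l < 2 * a \<and> p ! l < p ! (l - 1) then p ! l + 1 else p ! l)"
      using False by (simp only: paired_collapse_def dv) simp
    then show ?thesis using False IH by auto
  qed
qed auto

lemma paired_collapse_C_partition:
  "is_C_partition (sum_list p) (map (paired_collapse p a) [0..<length p])" (is "is_C_partition _ ?f")
proof -
  have "paired_collapse p a (Suc i) \<le> paired_collapse p a i" if i: "Suc i < length p" for i
  proof (cases "even i")
    case True
    then have dv: "2 * (i div 2) = i" "2 * (Suc i div 2) = i" by presburger+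
    have "i < 2 * a \<longleftrightarrow> Suc i < 2 * a" using True by presburger
    then show ?thesis
      using True i parts_antimono[of i "Suc i"] gap_at_least_two[of "i div 2"]
      unfolding paired_collapse_def dv by (auto simp: dv)
  next
    case False
    then have dv: "2 * (i div 2) = i - 1" "i - 1 + 1 = i" "2 * (Suc i div 2) = Suc i" by presburger+
    show ?thesis
      using False i parts_antimono[of i "Suc i"] unfolding paired_collapse_def dv by auto
  qed
  then have srt: "sorted_wrt (\<ge>) ?f"
    by (subst sorted_wrt_iff_nth_Suc_transp) (auto intro!: transpI)
  have pos: "0 \<notin> set ?f"
  proof
    assume "0 \<in> set ?f"
    then obtain i where i: "i < length p" "paired_collapse p a i = 0" by auto
    show False
    proof (cases "even i")
      case True
      then have dv: "2 * (i div 2) = i" by presburger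
      have "i < 2 * a \<longleftrightarrow> Suc i < 2 * a" using True by presburger
      then show ?thesis
        using i part_pos[of i] gap_at_least_two[of "i div 2"] unfolding paired_collapse_def dv
        by (auto simp: dv split: if_splits)
    next
      case False
      then show ?thesis using i part_pos[of i] unfolding paired_collapse_def
        by (auto split: if_splits)
    qed
  qed
  have "sum_list ?f = (\<Sum>i<length p. paired_collapse p a i)"
    using sum_list_take_map_upt[of "length p" "paired_collapse p a" "length p"] by simp
  also have "\<dots> = (\<Sum>i<length p. p ! i)"
    using paired_collapse_prefix[of "length p"] p_len by simp
  also have "\<dots> = sum_list p" using sum_list_take_nth[of "length p" p] by simp
  finally have sm: "sum_list ?f = sum_list p" .
  have "even (count_list ?f v)" if v: "odd v" for v
  proof -
    let ?e = "\<lambda>i. of_bool (paired_collapse p a i = v) :: nat"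
    have "(\<Sum>i<length p. ?e i) = (\<Sum>i<2 * a. ?e i) + (\<Sum>i = 2 * a..<length p. ?e i)"
      using sum.atLeastLessThan_concat[of 0 "2 * a" "length p" ?e] p_len by (simp add: atLeast0LessThan)
    also have "(\<Sum>i = 2 * a..<length p. ?e i) = 0"
      using p_even v by (intro sum.neutral) (auto simp: paired_collapse_def)
    finally have eq: "count_list ?f v = (\<Sum>j<a. ?e (2 * j) + ?e (2 * j + 1))"
      unfolding count_list_map_upt by (simp only: sum_lessThan_pairs add_0_right)
    have ev: "even (?e (2 * j) + ?e (2 * j + 1))" if j: "j < a" for j
    proof (cases "p ! (2 * j + 1) < p ! (2 * j)")
      case True
      then show ?thesis
        using v j paired_collapse_even_at_gap[of "2 * j"] paired_collapse_even_at_gap[of "2 * j + 1"] by auto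
    next
      case False
      then have "p ! (2 * j + 1) = p ! (2 * j)" using parts_antimono[of "2 * j" "2 * j + 1"] j p_len by simp
      then show ?thesis by (simp add: paired_collapse_def)
    qed
    show ?thesis unfolding eq by (rule dvd_sum, rule ev) simp
  qed
  then show ?thesis using srt pos sm by (simp add: is_C_partition_def is_partition_def)
qed

lemma sum_take_paired_collapse:
  "sum_list (take l (map (paired_collapse p a) [0..<length p])) +
     (if odd l \<and> l < 2 * a \<and> p ! l < p ! (l - 1) then 1 else 0) = sum_list (take l p)"
  using paired_collapse_prefix[of "min l (length p)"] p_len
  unfolding sum_list_take_map_upt sum_list_take_nth[of l p] by (auto simp: min_def split: if_splits)

text \<open>In the middle of an unequal pair the prefix sum of \<open>p\<close> is odd. A C-partition \<open>g\<close> attaining it would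
  have two equal parts there, one at least the larger and one at most the smaller part of the pair.\<close>
lemma paired_collapse_greatest:
  assumes g: "is_C_partition (sum_list p) g" and dom: "dominates p g"
  shows "dominates (map (paired_collapse p a) [0..<length p]) g" (is "dominates ?f g")
proof -
  note tk = sum_take_paired_collapse
  show ?thesis
    unfolding dominates_def
  proof
    fix l
    have le: "sum_list (take l g) \<le> sum_list (take l p)" for l using dom by (simp add: dominates_def)
    show "sum_list (take l g) \<le> sum_list (take l ?f)"
    proof (rule ccontr)
      assume "\<not> ?thesis"
      then have l: "odd l" "l < 2 * a" "p ! l < p ! (l - 1)"
          and eq: "sum_list (take l g) = sum_list (take l p)"
        using tk[of l] le[of l] by (auto split: if_splits)
      have "odd (\<Sum>i<l. p ! i)"
      proof -
        have "even ((\<Sum>i<l. p ! i) + l)"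
        proof -
          have "even (\<Sum>i<l. p ! i + 1)" using p_odd l(2) by (intro dvd_sum) auto
          also have "(\<Sum>i<l. p ! i + 1) = (\<Sum>i<l. p ! i) + l"
            by (simp only: sum.distrib sum_constant card_lessThan) simp
          finally show ?thesis .
        qed
        then show ?thesis using l(1) by simp
      qed
      then have "odd (sum_list (take l g))"
        using eq sum_list_take_nth[of l p] l(2) p_len by simp
      from C_partition_odd_prefix[OF g this]
      have gl: "0 < l" "l < length g" "g ! (l - 1) = g ! l" by auto
      have s1: "sum_list (take (Suc m) h) = sum_list (take m h) + h ! m" if "m < length h" for m and h :: "nat list"
        using that by (simp add: take_Suc_conv_app_nth)
      have "g ! l \<le> p ! l"
        using s1[of l g] s1[of l p] gl l(2) p_len le[of "Suc l"] eq by simp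
      moreover have "p ! (l - 1) \<le> g ! (l - 1)"
      proof -
        have b: "l - 1 < length g" "l - 1 < length p" "Suc (l - 1) = l"
          using gl l(2) p_len by linarith+
        show ?thesis
          using s1[OF b(1)] s1[OF b(2)] le[of "l - 1"] eq unfolding b(3) by linarith
      qed
      ultimately show False using gl l by simp
    qed
  qed
qed

lemma C_collapse_paired: "C_collapse p = map (paired_collapse p a) [0..<length p]"
proof (rule C_collapse_eqI[OF paired_collapse_C_partition _ paired_collapse_greatest])
  show "dominates p (map (paired_collapse p a) [0..<length p])"
    unfolding dominates_def using sum_take_paired_collapse by (metis le_add1)
qed

end

section \<open>Transposition and Z-diagrams\<close>

lemma length_transpose_partition:
  "length (transpose_partition cs) = Max (insert 0 (set cs))"
  by (simp add: transpose_partition_def)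

lemma nth_transpose_partition:
  "i < length (transpose_partition cs) \<Longrightarrow>
    transpose_partition cs ! i = length (filter (\<lambda>c. i < c) cs)"
  by (simp add: transpose_partition_def)

lemma le_length_transpose_partition: "c \<in> set cs \<Longrightarrow> c \<le> length (transpose_partition cs)"
  by (simp add: length_transpose_partition)

lemma length_transpose_partition_attained:
  "i < length (transpose_partition cs) \<Longrightarrow> \<exists>c\<in>set cs. i < c"
  using Max_in[of "insert 0 (set cs)"] unfolding length_transpose_partition by fastforce

lemma transpose_partition_sorted: "sorted_wrt (\<ge>) (transpose_partition cs)"
proof -
  have "length (filter (\<lambda>c. j < c) cs) \<le> length (filter (\<lambda>c. i < c) cs)" if "i < j" for i j :: nat
    using that by (induction cs) auto
  then show ?thesis
    by (auto simp: sorted_wrt_iff_nth_less nth_transpose_partition)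
qed

lemma transpose_partition_pos: "0 \<notin> set (transpose_partition cs)"
proof
  assume "0 \<in> set (transpose_partition cs)"
  then obtain i where "i < length (transpose_partition cs)" "transpose_partition cs ! i = 0"
    by (auto simp: in_set_conv_nth)
  then show False
    using length_transpose_partition_attained[of i cs]
    by (auto simp: nth_transpose_partition filter_empty_conv)
qed

lemma sum_list_transpose_partition: "sum_list (transpose_partition cs) = sum_list cs"
proof -
  have gen: "\<forall>c\<in>set cs. c \<le> m \<Longrightarrow> (\<Sum>i<m. length (filter (\<lambda>c. i < c) cs)) = sum_list cs" for m
  proof (induction cs)
    case (Cons c cs)
    have "(\<Sum>i<m. length (filter (\<lambda>c. i < c) (c # cs))) =
        (\<Sum>i<m. (if i \<in> {..<c} then 1 else 0) + length (filter (\<lambda>c. i < c) cs))"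
      by (intro sum.cong) auto
    also have "\<dots> = (\<Sum>i\<in>{..<m} \<inter> {..<c}. 1) + sum_list cs"
      using Cons by (simp only: sum.distrib sum.inter_restrict[OF finite_lessThan]) simp
    also have "{..<m} \<inter> {..<c} = {..<c}" using Cons.prems by auto
    finally show ?case by simp
  qed simp
  show ?thesis
    using gen[of "Max (insert 0 (set cs))"]
    by (simp add: transpose_partition_def interv_sum_list_conv_sum_set_nat atLeast0LessThan)
qed

lemma transpose_partition_mset: "mset cs = mset ds \<Longrightarrow> transpose_partition cs = transpose_partition ds"
proof -
  assume m: "mset cs = mset ds"
  have "length (filter (\<lambda>c. i < c) cs) = length (filter (\<lambda>c. i < c) ds)" for i
    by (metis m mset_filter size_mset)
  then show ?thesis using mset_eq_setD[OF m] by (simp add: transpose_partition_def)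
qed

lemma transpose_partition_filter_pos:
  "transpose_partition (filter (\<lambda>c. 0 < c) cs) = transpose_partition cs"
proof -
  have "Max (insert 0 (set (filter (\<lambda>c. 0 < c) cs))) = Max (insert 0 (set cs))"
    by (rule arg_cong[of _ _ Max]) auto
  moreover have "filter (\<lambda>c. i < c) (filter (\<lambda>c. 0 < c) cs) = filter (\<lambda>c. i < c) cs" for i
    by (simp only: filter_filter) (rule filter_cong, auto)
  ultimately show ?thesis unfolding transpose_partition_def by simp
qed

text \<open>In a descending list the entries larger than \<open>i\<close> form a prefix; this is the adjunction behind the
  involutivity of transposition.\<close>
lemma less_count_larger_iff:
  assumes "sorted_wrt (\<ge>) (cs :: nat list)" "j < length cs"
  shows "j < length (filter (\<lambda>c. i < c) cs) \<longleftrightarrow> i < cs ! j"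
  using assms
proof (induction cs arbitrary: j)
  case (Cons c cs)
  show ?case
  proof (cases "i < c")
    case True
    then show ?thesis using Cons by (cases j) auto
  next
    case False
    then have "filter (\<lambda>c. i < c) cs = []" using Cons.prems by (force simp: filter_empty_conv)
    moreover have "(c # cs) ! j \<le> c" using Cons.prems by (cases j) auto
    ultimately show ?thesis using False by auto
  qed
qed simp

lemma transpose_partition_involution:
  assumes "sorted_wrt (\<ge>) cs" "0 \<notin> set cs"
  shows "transpose_partition (transpose_partition cs) = cs"
proof (rule nth_equalityI)
  let ?t = "transpose_partition cs"
  have fl: "length (filter (\<lambda>c. 0 < c) cs) = length cs"
    using assms(2) by (metis bot_nat_0.not_eq_extremum filter_True)
  show len: "length (transpose_partition ?t) = length cs"
  proof (cases "cs = []")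
    case True
    then show ?thesis by (simp add: transpose_partition_def)
  next
    case False
    then have c0: "0 < cs ! 0" "cs ! 0 \<in> set cs" using assms(2) by (metis gr0I length_greater_0_conv nth_mem)+
    then have l0: "0 < length ?t" using le_length_transpose_partition[of "cs ! 0" cs] by linarith
    have "Max (insert 0 (set ?t)) = length cs"
    proof (rule Max_eqI)
      show "length cs \<in> insert 0 (set ?t)"
        using nth_mem[OF l0] fl nth_transpose_partition[OF l0] by simp
    qed (auto simp: transpose_partition_def)
    then show ?thesis by (simp add: length_transpose_partition)
  qed
  fix j assume "j < length (transpose_partition ?t)"
  then have j: "j < length cs" using len by simp
  have "transpose_partition ?t ! j = length (filter (\<lambda>r. j < r) ?t)"
    using j len by (simp add: nth_transpose_partition)
  also have "\<dots> = card {i. i < length ?t \<and> j < ?t ! i}" by (rule length_filter_conv_card)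
  also have "{i. i < length ?t \<and> j < ?t ! i} = {i. i < length ?t \<and> i < cs ! j}"
    by (intro Collect_cong conj_cong refl)
      (simp add: nth_transpose_partition less_count_larger_iff[OF assms(1) j])
  also have "\<dots> = {..<cs ! j}"
    using less_le_trans[OF _ le_length_transpose_partition[OF nth_mem[OF j]]]
    by (intro equalityI subsetI) simp_all
  finally show "transpose_partition ?t ! j = cs ! j" by simp
qed

lemma Z_columns_split:
  "Z_columns (hi @ a # lo) (length hi) =
     concat (map (\<lambda>m. [m, m]) hi) @ 2 * a # concat (map (\<lambda>m. [m, m]) lo)"
proof -
  let ?ms = "hi @ a # lo"
  let ?h = "\<lambda>i. if i = length hi then [2 * ?ms ! i] else [?ms ! i, ?ms ! i]"
  have up: "[0..<length ?ms] = [0..<length hi] @ length hi # [Suc (length hi)..<length ?ms]"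
    using upt_add_eq_append[of 0 "length hi" "Suc (length lo)"]
      upt_conv_Cons[of "length hi" "length ?ms"] by (simp del: upt_Suc)
  have 1: "map ?h [0..<length hi] = map (\<lambda>m. [m, m]) hi"
    by (rule nth_equalityI) (auto simp: nth_append simp del: upt_Suc)
  have 2: "map ?h [Suc (length hi)..<length ?ms] = map (\<lambda>m. [m, m]) lo"
    by (rule nth_equalityI) (auto simp: nth_append simp del: upt_Suc)
  show ?thesis unfolding Z_columns_def up by (simp only: map_append list.map 1 2) simp
qed

text \<open>The column \<open>2a\<close> is inserted between the pairs of columns that are at least \<open>2a\<close> and the smaller ones.\<close>
lemma Z_columns_arrangement:
  "\<exists>ms s. mset ms = mset (bs @ [a]) \<and> s < length ms \<and> ms ! s = a \<and>
     sorted_wrt (\<ge>) (Z_columns ms s) \<and> mset (Z_columns ms s) = mset (2 * a # bs @ bs)"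
proof -
  define desc where "desc = rev (sort bs)"
  define hi where "hi = filter (\<lambda>b. 2 * a \<le> b) desc"
  define lo where "lo = filter (\<lambda>b. \<not> 2 * a \<le> b) desc"
  have m: "mset hi + mset lo = mset bs"
    unfolding hi_def lo_def desc_def by (simp only: mset_filter mset_rev mset_sort multiset_partition[symmetric])
  have "sorted_wrt (\<ge>) desc" unfolding desc_def by (simp add: sorted_wrt_rev)
  then have srt: "sorted_wrt (\<ge>) hi" "sorted_wrt (\<ge>) lo"
    unfolding hi_def lo_def by (auto intro: sorted_wrt_filter)
  have dup: "sorted_wrt (\<ge>) xs \<Longrightarrow> sorted_wrt (\<ge>) (concat (map (\<lambda>m. [m, m]) xs))" for xs :: "nat list"
    by (induction xs) auto
  have dm: "mset (concat (map (\<lambda>m. [m, m]) xs)) = mset xs + mset xs" for xs :: "nat list"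
    by (induction xs) auto
  have "sorted_wrt (\<ge>) (Z_columns (hi @ a # lo) (length hi))"
    unfolding Z_columns_split using srt
    by (auto simp: sorted_wrt_append dup hi_def lo_def)
  moreover have "mset (Z_columns (hi @ a # lo) (length hi)) = mset (2 * a # bs @ bs)"
    unfolding Z_columns_split by (simp add: dm m[symmetric])
  moreover have "mset (hi @ a # lo) = mset (bs @ [a])" using m by simp
  ultimately show ?thesis by (intro exI[of _ "hi @ a # lo"] exI[of _ "length hi"]) auto
qed

lemma Z_diagram_columns:
  assumes "ns \<noteq> []"
  shows "\<exists>ms s. mset ms = mset ns \<and> s < length ms \<and> ms ! s = last ns \<and>
       sorted_wrt (\<ge>) (Z_columns ms s) \<and>
       transpose_partition (Z_diagram (last ns) (butlast ns)) = filter (\<lambda>m. 0 < m) (Z_columns ms s)"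
proof -
  obtain ms s where ms: "mset ms = mset ns" "s < length ms" "ms ! s = last ns"
      "sorted_wrt (\<ge>) (Z_columns ms s)"
      "mset (Z_columns ms s) = mset (2 * last ns # butlast ns @ butlast ns)"
    using Z_columns_arrangement[of "butlast ns" "last ns"] assms by auto
  have "transpose_partition (Z_diagram (last ns) (butlast ns)) =
      transpose_partition (transpose_partition (filter (\<lambda>m. 0 < m) (Z_columns ms s)))"
    unfolding Z_diagram_def using transpose_partition_mset[OF ms(5)]
    by (simp add: transpose_partition_filter_pos)
  also have "\<dots> = filter (\<lambda>m. 0 < m) (Z_columns ms s)"
    using ms(4) by (intro transpose_partition_involution sorted_wrt_filter) auto
  finally show ?thesis using ms by blast
qed

section \<open>Ranks of matrices\<close>

lemma square_zero_row_kernel: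
  fixes A :: "complex mat"
  assumes A: "A \<in> carrier_mat r r" and i: "i < r" and z: "\<And>j. j < r \<Longrightarrow> A $$ (i, j) = 0"
  shows "\<exists>v. v \<in> carrier_vec r \<and> v \<noteq> 0\<^sub>v r \<and> A *\<^sub>v v = 0\<^sub>v r"
proof -
  have "det A = 0"
    using laplace_expansion_row[OF A i] z by simp
  then show ?thesis using det_0_iff_vec_prod_zero[OF A] by blast
qed

text \<open>Fewer equations than unknowns: the nonzero rows are padded to a square matrix with a zero row.\<close>
lemma underdetermined_kernel:
  fixes B :: "complex mat"
  assumes B: "B \<in> carrier_mat m r" and M: "finite M" "card M < r"
    and z: "\<And>i j. i < m \<Longrightarrow> i \<notin> M \<Longrightarrow> j < r \<Longrightarrow> B $$ (i, j) = 0"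
  shows "\<exists>v. v \<in> carrier_vec r \<and> v \<noteq> 0\<^sub>v r \<and> B *\<^sub>v v = 0\<^sub>v m"
proof -
  obtain h where h: "bij_betw h {..<card M} M"
    using ex_bij_betw_nat_finite[OF M(1)] by (auto simp: atLeast0LessThan)
  define C where "C = mat r r (\<lambda>(i, j). if i < card M \<and> h i < m then B $$ (h i, j) else 0)"
  have C: "C \<in> carrier_mat r r" by (simp add: C_def)
  have "\<exists>v. v \<in> carrier_vec r \<and> v \<noteq> 0\<^sub>v r \<and> C *\<^sub>v v = 0\<^sub>v r"
    by (rule square_zero_row_kernel[OF C M(2)]) (simp add: C_def M(2))
  then obtain v where v: "v \<in> carrier_vec r" "v \<noteq> 0\<^sub>v r" "C *\<^sub>v v = 0\<^sub>v r" by blast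
  have "B *\<^sub>v v = 0\<^sub>v m"
  proof (rule eq_vecI)
    fix i assume "i < dim_vec (0\<^sub>v m :: complex vec)"
    then have i: "i < m" by simp
    show "(B *\<^sub>v v) $ i = 0\<^sub>v m $ i"
    proof (cases "i \<in> M")
      case True
      then obtain l where l: "l < card M" "h l = i"
        using h by (metis bij_betw_imp_surj_on imageE lessThan_iff)
      then have lr: "l < r" using M by simp
      have "row C l = row B i"
        using l i lr B by (intro eq_vecI) (auto simp: C_def)
      moreover have "(C *\<^sub>v v) $ l = 0" using v(3) lr by simp
      ultimately show ?thesis using i lr B C by simp
    next
      case False
      have "row B i = 0\<^sub>v r" using z[OF i False] i B by (intro eq_vecI) auto
      then show ?thesis using i B v(1) by simp
    qed
  qed (use B in auto)
  then show ?thesis using v by blast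
qed

text \<open>\<open>A\<close> factors through dimension \<open>r\<close> with an injective \<open>F\<close> and a surjective \<open>G\<close>, so that \<open>r\<close> is the
  rank of \<open>A\<close>. The one-sided inverses \<open>F'\<close>, \<open>G'\<close> are what the rank estimates below compute with, and
  for powers of Jordan matrices they can be written down.\<close>
definition has_rank :: "nat \<Rightarrow> complex mat \<Rightarrow> nat \<Rightarrow> bool" where
  "has_rank N A r \<longleftrightarrow>
     (\<exists>F\<in>carrier_mat N r. \<exists>G\<in>carrier_mat r N. \<exists>F'\<in>carrier_mat r N. \<exists>G'\<in>carrier_mat N r.
        A = F * G \<and> F' * F = 1\<^sub>m r \<and> G * G' = 1\<^sub>m r)"

lemma has_rank_similar:
  assumes "has_rank N A r" and P: "P \<in> carrier_mat N N" and Q: "Q \<in> carrier_mat N N"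
    and PQ: "P * Q = 1\<^sub>m N" "Q * P = 1\<^sub>m N"
  shows "has_rank N (P * A * Q) r"
proof -
  obtain F G F' G' where c: "F \<in> carrier_mat N r" "G \<in> carrier_mat r N" "F' \<in> carrier_mat r N" "G' \<in> carrier_mat N r"
    and e: "A = F * G" "F' * F = 1\<^sub>m r" "G * G' = 1\<^sub>m r"
    using assms(1) unfolding has_rank_def by blast
  have "P * A * Q = (P * F) * (G * Q)"
    unfolding e(1) using c P Q
    by (simp add: assoc_mult_mat[of _ N N _ N _ N] assoc_mult_mat[of _ N N _ r _ N] assoc_mult_mat[of _ N r _ N _ N])
  moreover have "(F' * Q) * (P * F) = 1\<^sub>m r"
  proof -
    have "(F' * Q) * (P * F) = F' * (Q * (P * F))" using c P Q by (simp add: assoc_mult_mat[of _ r N _ N _ r])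
    also have "Q * (P * F) = (Q * P) * F" using c(1) P Q by (simp add: assoc_mult_mat[of _ N N _ N _ r])
    finally show ?thesis using e c PQ by simp
  qed
  moreover have "(G * Q) * (P * G') = 1\<^sub>m r"
  proof -
    have "(G * Q) * (P * G') = G * (Q * (P * G'))" using c P Q by (simp add: assoc_mult_mat[of _ r N _ N _ r])
    also have "Q * (P * G') = (Q * P) * G'" using c P Q by (simp add: assoc_mult_mat[of _ N N _ N _ r])
    finally show ?thesis using e c PQ by simp
  qed
  moreover have "P * F \<in> carrier_mat N r" "G * Q \<in> carrier_mat r N"
      "F' * Q \<in> carrier_mat r N" "P * G' \<in> carrier_mat N r"
    using c P Q by auto
  ultimately show ?thesis unfolding has_rank_def by blast
qed

lemma has_rank_direct_sum:
  assumes 1: "has_rank m A r" and 2: "has_rank n B s"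
  shows "has_rank (m + n) (four_block_mat A (0\<^sub>m m n) (0\<^sub>m n m) B) (r + s)"
proof -
  obtain F G F' G' where c: "F \<in> carrier_mat m r" "G \<in> carrier_mat r m" "F' \<in> carrier_mat r m" "G' \<in> carrier_mat m r"
    and e: "A = F * G" "F' * F = 1\<^sub>m r" "G * G' = 1\<^sub>m r"
    using 1 unfolding has_rank_def by blast
  obtain H K H' K' where d: "H \<in> carrier_mat n s" "K \<in> carrier_mat s n" "H' \<in> carrier_mat s n" "K' \<in> carrier_mat n s"
    and f: "B = H * K" "H' * H = 1\<^sub>m s" "K * K' = 1\<^sub>m s"
    using 2 unfolding has_rank_def by blast
  let ?F = "four_block_mat F (0\<^sub>m m s) (0\<^sub>m n r) H"
  let ?G = "four_block_mat G (0\<^sub>m r n) (0\<^sub>m s m) K"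
  let ?F' = "four_block_mat F' (0\<^sub>m r n) (0\<^sub>m s m) H'"
  let ?G' = "four_block_mat G' (0\<^sub>m m s) (0\<^sub>m n r) K'"
  note z = zero_carrier_mat
  have one: "four_block_mat (1\<^sub>m r) (0\<^sub>m r s) (0\<^sub>m s r) (1\<^sub>m s) = (1\<^sub>m (r + s) :: complex mat)"
    by (rule eq_matI) auto
  have "?F * ?G = four_block_mat A (0\<^sub>m m n) (0\<^sub>m n m) B"
    by (subst mult_four_block_mat[OF c(1) z z d(1) c(2) z z d(2)], insert c d,
        simp add: e f right_add_zero_mat left_add_zero_mat)
  moreover have "?F' * ?F = 1\<^sub>m (r + s)"
    by (subst mult_four_block_mat[OF c(3) z z d(3) c(1) z z d(1)], insert c d, simp add: e f one)
  moreover have "?G * ?G' = 1\<^sub>m (r + s)"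
    by (subst mult_four_block_mat[OF c(2) z z d(2) c(4) z z d(4)], insert c d, simp add: e f one)
  moreover have "?F \<in> carrier_mat (m + n) (r + s)" "?G \<in> carrier_mat (r + s) (m + n)"
      "?F' \<in> carrier_mat (r + s) (m + n)" "?G' \<in> carrier_mat (m + n) (r + s)"
    using c d by (auto intro!: four_block_carrier_mat)
  ultimately show ?thesis unfolding has_rank_def by metis
qed

lemma sum_delta_mult:
  fixes c :: "nat \<Rightarrow> complex"
  shows "(\<Sum>q = 0..<m. (if i = q then 1 else 0) * c q) = (if i < m then c i else 0)"
    "(\<Sum>q = 0..<m. (if q = i then 1 else 0) * c q) = (if i < m then c i else 0)"
  by (simp_all add: if_distrib[of "\<lambda>x. x * _"] cong: if_cong)

text \<open>The \<open>k\<close>-th power of a nilpotent Jordan block is the shift by \<open>k\<close>.\<close>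
lemma has_rank_nilpotent_block:
  "has_rank l (jordan_block l (0 :: complex) ^\<^sub>m k) (l - k)"
proof -
  let ?F = "mat l (l - k) (\<lambda>(i, j). if i = j then 1 else 0 :: complex)"
  let ?G = "mat (l - k) l (\<lambda>(i, j). if j = i + k then 1 else 0 :: complex)"
  have "jordan_block l (0 :: complex) ^\<^sub>m k = ?F * ?G"
    by (rule eq_matI) (auto simp: scalar_prod_def sum_delta_mult jordan_block_zero_pow)
  moreover have "transpose_mat ?F * ?F = 1\<^sub>m (l - k)"
    by (rule eq_matI) (auto simp: scalar_prod_def sum_delta_mult)
  moreover have "?G * transpose_mat ?G = 1\<^sub>m (l - k)"
    by (rule eq_matI) (auto simp: scalar_prod_def sum_delta_mult)
  ultimately show ?thesis
    unfolding has_rank_def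
    by (intro bexI[of _ ?F] bexI[of _ ?G] bexI[of _ "transpose_mat ?F"] bexI[of _ "transpose_mat ?G"] conjI) auto
qed

lemma has_rank_jordan_matrix:
  "has_rank (sum_list d) (jordan_matrix (map (\<lambda>r. (r, 0)) d) ^\<^sub>m k)
     (\<Sum>x\<leftarrow>d. x - k)"
proof (induction d)
  case Nil
  show ?case unfolding has_rank_def
    by (intro bexI[of _ "1\<^sub>m 0"] conjI eq_matI) (auto simp: jordan_matrix_dim)
next
  case (Cons x d)
  have sm: "sum_list (map fst (map (\<lambda>r. (r, 0 :: complex)) d)) = sum_list d" by (simp add: o_def)
  have "jordan_matrix (map (\<lambda>r. (r, 0 :: complex)) (x # d)) ^\<^sub>m k =
     four_block_mat (jordan_block x 0 ^\<^sub>m k) (0\<^sub>m x (sum_list d)) (0\<^sub>m (sum_list d) x)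
       (jordan_matrix (map (\<lambda>r. (r, 0)) d) ^\<^sub>m k)"
    unfolding list.map jordan_matrix_Cons sm
    by (rule pow_four_block_mat) (auto simp: jordan_matrix_dim o_def intro!: carrier_matI)
  then show ?case
    using has_rank_direct_sum[OF has_rank_nilpotent_block Cons.IH] by simp
qed

lemma has_rank_jordan_nf:
  assumes X: "X \<in> carrier_mat N N" and jnf: "jordan_nf X (map (\<lambda>r. (r, 0)) d)"
  shows "sum_list d = N" "has_rank N (X ^\<^sub>m k) (\<Sum>x\<leftarrow>d. x - k)"
proof -
  let ?J = "jordan_matrix (map (\<lambda>r. (r, 0 :: complex)) d)"
  obtain P Q where w: "similar_mat_wit X ?J P Q"
    using jnf unfolding jordan_nf_def similar_mat_def by blast
  note w2 = similar_mat_witD2[OF X w]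
  have "dim_row ?J = sum_list d" by (simp add: jordan_matrix_dim o_def)
  then show N: "sum_list d = N" using w2 by auto
  show "has_rank N (X ^\<^sub>m k) (\<Sum>x\<leftarrow>d. x - k)"
    using has_rank_similar[OF has_rank_jordan_matrix[of d k, unfolded N], of P Q]
      similar_mat_wit_pow_id[OF w] w2 by simp
qed

text \<open>\<open>A\<close> is injective on the \<open>r\<close>-dimensional image of \<open>G'\<close>, hence so is \<open>L\<close>, which has at most
  \<open>card M\<close> nonzero rows.\<close>
lemma rank_le_if_kernel_contained:
  assumes fr: "has_rank N A r"
    and L: "L \<in> carrier_mat N N" and M: "finite M"
    and zero: "\<And>i j. i < N \<Longrightarrow> i \<notin> M \<Longrightarrow> j < N \<Longrightarrow> L $$ (i, j) = 0"
    and ker: "\<And>v. v \<in> carrier_vec N \<Longrightarrow> L *\<^sub>v v = 0\<^sub>v N \<Longrightarrow> A *\<^sub>v v = 0\<^sub>v N"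
  shows "r \<le> card M"
proof (rule ccontr)
  assume "\<not> ?thesis"
  then have less: "card M < r" by simp
  obtain F G F' G' where c: "F \<in> carrier_mat N r" "G \<in> carrier_mat r N" "F' \<in> carrier_mat r N" "G' \<in> carrier_mat N r"
    and e: "A = F * G" "F' * F = 1\<^sub>m r" "G * G' = 1\<^sub>m r"
    using fr unfolding has_rank_def by blast
  have "\<exists>v. v \<in> carrier_vec r \<and> v \<noteq> 0\<^sub>v r \<and> (L * G') *\<^sub>v v = 0\<^sub>v N"
  proof (rule underdetermined_kernel[OF _ M less])
    fix i j assume ij: "i < N" "i \<notin> M" "j < r"
    have "row L i = 0\<^sub>v N" using ij zero L by (intro eq_vecI) auto
    then show "(L * G') $$ (i, j) = 0" using ij L c by simp
  qed (use L c in auto)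
  then obtain v where v: "v \<in> carrier_vec r" "v \<noteq> 0\<^sub>v r" "(L * G') *\<^sub>v v = 0\<^sub>v N" by blast
  have "A *\<^sub>v (G' *\<^sub>v v) = 0\<^sub>v N"
    using ker[of "G' *\<^sub>v v"] v L c by (simp add: assoc_mult_mat_vec[of _ N N _ r])
  moreover have "A *\<^sub>v (G' *\<^sub>v v) = F *\<^sub>v v"
  proof -
    have "A *\<^sub>v (G' *\<^sub>v v) = F *\<^sub>v (G *\<^sub>v (G' *\<^sub>v v))"
      unfolding e(1) using c v by (simp add: assoc_mult_mat_vec[of _ N r _ N])
    also have "G *\<^sub>v (G' *\<^sub>v v) = (G * G') *\<^sub>v v" using c v by (simp add: assoc_mult_mat_vec[of _ r N _ r])
    finally show ?thesis using e v by simp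
  qed
  moreover have "F' *\<^sub>v 0\<^sub>v N = 0\<^sub>v r" using c by (intro eq_vecI) auto
  ultimately have "F' *\<^sub>v (F *\<^sub>v v) = 0\<^sub>v r" by simp
  then have "(F' * F) *\<^sub>v v = 0\<^sub>v r" using c v by (simp add: assoc_mult_mat_vec[of _ r N _ r])
  then show False using e v by simp
qed

text \<open>The \<open>r\<close> equations of \<open>G v = 0\<close> and the vanishing of the coordinates in \<open>Q\<close> have only the zero solution.\<close>
lemma rank_ge_if_kernel_trivial:
  assumes fr: "has_rank N A r" and Q: "finite Q"
    and ker: "\<And>v. v \<in> carrier_vec N \<Longrightarrow> A *\<^sub>v v = 0\<^sub>v N \<Longrightarrow> (\<And>i. i \<in> Q \<Longrightarrow> i < N \<Longrightarrow> v $ i = 0) \<Longrightarrow> v = 0\<^sub>v N"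
  shows "N \<le> r + card Q"
proof (rule ccontr)
  assume "\<not> ?thesis"
  then have less: "r + card Q < N" by simp
  obtain F G where c: "F \<in> carrier_mat N r" "G \<in> carrier_mat r N" and e: "A = F * G"
    using fr unfolding has_rank_def by blast
  define E where "E = mat N N (\<lambda>(i, j). if i = j \<and> i \<in> Q then 1 else 0 :: complex)"
  define B where "B = mat (r + N) N (\<lambda>(i, j). if i < r then G $$ (i, j) else E $$ (i - r, j))"
  have "\<exists>v. v \<in> carrier_vec N \<and> v \<noteq> 0\<^sub>v N \<and> B *\<^sub>v v = 0\<^sub>v (r + N)"
  proof (rule underdetermined_kernel[of _ _ _ "{..<r} \<union> (\<lambda>i. r + i) ` Q"])
    have "card ({..<r} \<union> (\<lambda>i. r + i) ` Q) \<le> r + card Q"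
      using card_Un_le[of "{..<r}" "(\<lambda>i. r + i) ` Q"] card_image_le[OF Q, of "\<lambda>i. r + i"] by simp
    then show "card ({..<r} \<union> (\<lambda>i. r + i) ` Q) < N" using less by linarith
    fix i j assume "i < r + N" "i \<notin> {..<r} \<union> (\<lambda>i. r + i) ` Q" "j < N"
    then show "B $$ (i, j) = 0"
      by (auto simp: B_def E_def image_iff)
  qed (use Q in \<open>auto simp: B_def\<close>)
  then obtain v where v: "v \<in> carrier_vec N" "v \<noteq> 0\<^sub>v N" "B *\<^sub>v v = 0\<^sub>v (r + N)" by blast
  have "G *\<^sub>v v = 0\<^sub>v r"
  proof (rule eq_vecI)
    fix i assume "i < dim_vec (0\<^sub>v r :: complex vec)"
    then have i: "i < r" by simp
    have "row B i = row G i" using i c by (intro eq_vecI) (auto simp: B_def)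
    moreover have "(B *\<^sub>v v) $ i = 0" using v(3) i by simp
    ultimately show "(G *\<^sub>v v) $ i = 0\<^sub>v r $ i" using i c by (simp add: B_def)
  qed (use c in auto)
  moreover have "F *\<^sub>v 0\<^sub>v r = 0\<^sub>v N" using c by (intro eq_vecI) auto
  ultimately have "A *\<^sub>v v = 0\<^sub>v N" unfolding e using c v(1) by (simp add: assoc_mult_mat_vec[of _ N r _ N])
  moreover have "v $ i = 0" if i: "i \<in> Q" "i < N" for i
  proof -
    have "row B (r + i) = unit_vec N i" using i by (intro eq_vecI) (auto simp: B_def E_def)
    moreover have "(B *\<^sub>v v) $ (r + i) = 0" using v(3) i by simp
    ultimately show ?thesis using i v(1) by (simp add: B_def)
  qed
  ultimately show False using ker v by blast
qed

text \<open>The skew form with matrix \<open>J A\<close> induces a nondegenerate skew form in dimension \<open>r\<close>.\<close>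
lemma rank_skew_even:
  assumes fr: "has_rank N A r" and J: "J \<in> carrier_mat N N"
    and Jinv: "J' \<in> carrier_mat N N" "J' * J = 1\<^sub>m N"
    and skew: "transpose_mat (J * A) = - (J * A)"
  shows "even r"
proof -
  obtain F G F' G' where c: "F \<in> carrier_mat N r" "G \<in> carrier_mat r N" "F' \<in> carrier_mat r N" "G' \<in> carrier_mat N r"
    and e: "A = F * G" "F' * F = 1\<^sub>m r" "G * G' = 1\<^sub>m r"
    using fr unfolding has_rank_def by blast
  define C where "C = J * F"
  define C' where "C' = F' * J'"
  have C: "C \<in> carrier_mat N r" "C' \<in> carrier_mat r N" using J Jinv c by (auto simp: C_def C'_def)
  have CC: "C' * C = 1\<^sub>m r"
  proof -
    have "C' * C = F' * (J' * (J * F))"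
      unfolding C_def C'_def using c J Jinv by (simp add: assoc_mult_mat[of _ r N _ N _ r])
    also have "J' * (J * F) = (J' * J) * F" using c J Jinv(1) by (simp add: assoc_mult_mat[of _ N N _ N _ r])
    finally show ?thesis using Jinv c e by simp
  qed
  have JA: "J * A = C * G" unfolding e C_def using J c by (simp add: assoc_mult_mat[of _ N N _ r _ N])
  \<comment> \<open>\<open>J * A = G\<^sup>T * M * G\<close>, so \<open>M\<close> is the Gram matrix of the form induced modulo the kernel of \<open>A\<close>.\<close>
  define M where "M = transpose_mat G' * C"
  have M: "M \<in> carrier_mat r r" using c C by (simp add: M_def)
  have tr: "transpose_mat G * transpose_mat C = - (C * G)"
    using skew C c unfolding JA by (simp add: transpose_mult[of _ N r])
  have CG': "C * G * G' = C" using C c e by (simp add: assoc_mult_mat[of _ N r _ N _ r])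
  have G'G: "transpose_mat G' * transpose_mat G = 1\<^sub>m r"
    using arg_cong[OF e(3), of transpose_mat] c by (simp add: transpose_mult[of _ r N])
  have "transpose_mat M = transpose_mat G' * transpose_mat G * (transpose_mat C * G')"
    unfolding G'G M_def using C c by (simp add: transpose_mult[of _ r N _ r])
  also have "\<dots> = transpose_mat G' * (transpose_mat G * transpose_mat C * G')"
    using C c by (simp add: assoc_mult_mat[of _ r N _ r _ r] assoc_mult_mat[of _ N r _ N _ r])
  also have "\<dots> = - (transpose_mat G' * (C * G * G'))" unfolding tr using C c by simp
  finally have Mt: "transpose_mat M = - M" unfolding CG' M_def .
  have "C = transpose_mat G * (transpose_mat C * (- G'))"
  proof -
    have "C = - (transpose_mat G * transpose_mat C * G')" unfolding tr using CG' C c by simp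
    then show ?thesis using C c by (simp add: assoc_mult_mat[of _ N r _ N _ r])
  qed
  then have "C' * (transpose_mat G * (transpose_mat C * (- G'))) = 1\<^sub>m r" using CC by simp
  moreover have "transpose_mat C * (- G') = M"
    using Mt C c unfolding M_def by (simp add: transpose_mult[of _ r N _ r])
  ultimately have "C' * transpose_mat G * M = 1\<^sub>m r"
    using C c M by (simp add: assoc_mult_mat[of _ r N _ r _ r])
  then have "det (C' * transpose_mat G) * det M = 1"
    using det_mult[of "C' * transpose_mat G" r M] C c M by simp
  then have "det M \<noteq> 0" by auto
  moreover have "det M = (-1) ^ r * det M"
  proof -
    have "det M = det (- M)" using Mt det_transpose[OF M] by simp
    also have "- M = (-1) \<cdot>\<^sub>m M" using M by (intro eq_matI) auto
    finally show ?thesis using M by (simp add: det_smult)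
  qed
  ultimately show ?thesis by (cases "even r") auto
qed

lemma pow_mat_Suc_left:
  fixes A :: "'a :: semiring_1 mat"
  assumes "A \<in> carrier_mat N N"
  shows "A ^\<^sub>m Suc k = A * A ^\<^sub>m k"
proof (induction k)
  case (Suc k)
  have "A ^\<^sub>m Suc (Suc k) = A ^\<^sub>m Suc k * A" by simp
  also have "\<dots> = A * A ^\<^sub>m k * A" by (simp only: Suc)
  also have "\<dots> = A * (A ^\<^sub>m k * A)" using assms by (intro assoc_mult_mat[of _ N N _ N _ N]) auto
  finally show ?case by simp
qed (use assms in simp)

lemma index_mult_mat_vec_sum:
  "A \<in> carrier_mat m n \<Longrightarrow> v \<in> carrier_vec n \<Longrightarrow> i < m \<Longrightarrow>
     (A *\<^sub>v v) $ i = (\<Sum>j = 0..<n. A $$ (i, j) * v $ j)"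
  by (auto simp: scalar_prod_def intro: sum.cong)

lemma pow_mat_Suc_mult_vec:
  fixes A :: "'a :: comm_semiring_1 mat"
  assumes "A \<in> carrier_mat N N" "v \<in> carrier_vec N"
  shows "A ^\<^sub>m Suc k *\<^sub>v v = A *\<^sub>v (A ^\<^sub>m k *\<^sub>v v)"
  unfolding pow_mat_Suc_left[OF assms(1)] using assms by (intro assoc_mult_mat_vec[of _ N N _ N]) auto

section \<open>Jordan types of nilpotent matrices\<close>

lemma similar_four_block_swap:
  fixes A B :: "complex mat"
  assumes A: "A \<in> carrier_mat n n" and B: "B \<in> carrier_mat m m"
  shows "similar_mat (four_block_mat A (0\<^sub>m n m) (0\<^sub>m m n) B) (four_block_mat B (0\<^sub>m m n) (0\<^sub>m n m) A)"
proof (rule similar_matI)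
  let ?P = "four_block_mat (0\<^sub>m n m) (1\<^sub>m n) (1\<^sub>m m) (0\<^sub>m m n) :: complex mat"
  let ?Q = "four_block_mat (0\<^sub>m m n) (1\<^sub>m m) (1\<^sub>m n) (0\<^sub>m n m) :: complex mat"
  note z = zero_carrier_mat one_carrier_mat
  have one: "four_block_mat (1\<^sub>m r) (0\<^sub>m r s) (0\<^sub>m s r) (1\<^sub>m s) = (1\<^sub>m (r + s) :: complex mat)" for r s
    by (rule eq_matI) auto
  show "?P * ?Q = 1\<^sub>m (n + m)"
    by (subst mult_four_block_mat[OF z(1) z(2) z(2) z(1) z(1) z(2) z(2) z(1)]) (simp add: one)
  have "?Q * ?P = 1\<^sub>m (m + n)"
    by (subst mult_four_block_mat[OF z(1) z(2) z(2) z(1) z(1) z(2) z(2) z(1)]) (simp add: one)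
  then show "?Q * ?P = 1\<^sub>m (n + m)" by (simp add: add.commute)
  have "?P * four_block_mat B (0\<^sub>m m n) (0\<^sub>m n m) A = four_block_mat (0\<^sub>m n m) A B (0\<^sub>m m n)"
    by (subst mult_four_block_mat[OF z(1) z(2) z(2) z(1) B z(1) z(1) A], insert A B, simp)
  also have "\<dots> * ?Q = four_block_mat A (0\<^sub>m n m) (0\<^sub>m m n) B"
    by (subst mult_four_block_mat[OF z(1) A B z(1) z(1) z(2) z(2) z(1)], insert A B, simp)
  finally show "four_block_mat A (0\<^sub>m n m) (0\<^sub>m m n) B =
      ?P * four_block_mat B (0\<^sub>m m n) (0\<^sub>m n m) A * ?Q" by simp
qed (use A B in auto)

lemma jordan_matrix_append:
  "jordan_matrix (xs @ ys) = four_block_mat (jordan_matrix xs)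
     (0\<^sub>m (sum_list (map fst xs)) (sum_list (map fst ys)))
     (0\<^sub>m (sum_list (map fst ys)) (sum_list (map fst xs))) (jordan_matrix ys)"
proof -
  have "four_block_mat (jordan_matrix ys) (0\<^sub>m (sum_list (map fst ys)) 0) (0\<^sub>m 0 (sum_list (map fst ys))) (0\<^sub>m 0 0) =
      jordan_matrix ys"
    by (rule eq_matI) (auto simp: jordan_matrix_dim)
  then show ?thesis
    using jordan_matrix_concat_diag_block_mat[of "[xs, ys]"] by (simp add: jordan_matrix_dim Let_def)
qed

lemma similar_jordan_matrix_append_commute:
  "similar_mat (jordan_matrix (xs @ ys :: (nat \<times> complex) list)) (jordan_matrix (ys @ xs))"
  unfolding jordan_matrix_append by (rule similar_four_block_swap) auto

lemma similar_jordan_matrix_append: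
  fixes xs ys xs' ys' :: "(nat \<times> complex) list"
  assumes "similar_mat (jordan_matrix xs) (jordan_matrix xs')" "similar_mat (jordan_matrix ys) (jordan_matrix ys')"
  shows "similar_mat (jordan_matrix (xs @ ys)) (jordan_matrix (xs' @ ys'))"
proof -
  have dim: "sum_list (map fst zs) = sum_list (map fst zs')"
    if sim: "similar_mat (jordan_matrix zs) (jordan_matrix zs')" for zs zs' :: "(nat \<times> complex) list"
  proof -
    obtain n where "jordan_matrix zs \<in> carrier_mat n n" "jordan_matrix zs' \<in> carrier_mat n n"
      using similar_matD[OF sim] by blast
    from carrier_matD(1)[OF this(1)] carrier_matD(1)[OF this(2)] show ?thesis
      by (simp add: jordan_matrix_dim)
  qed
  note eq = dim[OF assms(1)] dim[OF assms(2)]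
  show ?thesis
    unfolding jordan_matrix_append eq
    by (rule similar_mat_four_block_0_0[OF assms]) (metis eq jordan_matrix_carrier)+
qed

text \<open>Jordan blocks may be reordered; this puts the block sizes into descending order.\<close>
lemma similar_jordan_matrix_perm:
  fixes xs ys :: "(nat \<times> complex) list"
  shows "mset xs = mset ys \<Longrightarrow> similar_mat (jordan_matrix xs) (jordan_matrix ys)"
proof (induction xs arbitrary: ys)
  case Nil
  then show ?case by (auto intro!: similar_mat_refl[OF jordan_matrix_carrier])
next
  case (Cons x xs)
  have "x \<in> set ys" using Cons.prems by (metis list.set_intros(1) mset_eq_setD)
  then obtain us vs where ys: "ys = us @ x # vs" by (meson split_list)
  have refl: "similar_mat (jordan_matrix zs) (jordan_matrix zs)" for zs :: "(nat \<times> complex) list"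
    by (rule similar_mat_refl[OF jordan_matrix_carrier])
  have "similar_mat (jordan_matrix xs) (jordan_matrix (us @ vs))"
    using Cons ys by auto
  then have "similar_mat (jordan_matrix ([x] @ xs)) (jordan_matrix ([x] @ us @ vs))"
    by (rule similar_jordan_matrix_append[OF refl])
  moreover have "similar_mat (jordan_matrix (([x] @ us) @ vs)) (jordan_matrix ((us @ [x]) @ vs))"
    by (rule similar_jordan_matrix_append[OF similar_jordan_matrix_append_commute refl])
  ultimately show ?case unfolding ys by (auto intro: similar_mat_trans)
qed

lemma zero_mat_mult_vec: "v \<in> carrier_vec n \<Longrightarrow> 0\<^sub>m m n *\<^sub>v v = 0\<^sub>v m"
  by (intro eq_vecI) auto

lemma uminus_zero_mat: "- 0\<^sub>m m n = (0\<^sub>m m n :: complex mat)"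
  by (intro eq_matI) auto

lemma nilpotent_eigenvalue_zero:
  assumes X: "X \<in> carrier_mat N N" and nil: "X ^\<^sub>m m = 0\<^sub>m N N" and ev: "eigenvalue X (a :: complex)"
  shows "a = 0"
proof -
  obtain v where v: "eigenvector X v a" using ev unfolding eigenvalue_def by blast
  then have vc: "v \<in> carrier_vec N" "v \<noteq> 0\<^sub>v N" "X *\<^sub>v v = a \<cdot>\<^sub>v v"
    using X unfolding eigenvector_def by auto
  have "a ^ m \<cdot>\<^sub>v v = 0\<^sub>v N" using eigenvector_pow[OF X v, of m] nil vc(1)
    by (metis eq_vecI zero_mat_mult_vec)
  then have "\<And>i. i < N \<Longrightarrow> a ^ m * v $ i = 0" using vc(1)
    by (metis carrier_vecD index_smult_vec(1) index_zero_vec(1))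
  moreover obtain i where "i < N" "v $ i \<noteq> 0" using vc
    by (metis carrier_vecD eq_vecI index_zero_vec)
  ultimately have "a ^ m = 0" by force
  then show ?thesis by auto
qed

lemma nilpotent_jordan_type_exists:
  assumes X: "X \<in> carrier_mat N N" and nil: "X ^\<^sub>m m = (0\<^sub>m N N :: complex mat)"
  shows "\<exists>d. is_partition N d \<and> jordan_nf X (map (\<lambda>r. (r, 0)) d)"
proof -
  obtain as where "char_poly X = (\<Prod>a\<leftarrow>as. [:- a, 1:])" using char_poly_factorized[OF X] by auto
  from jordan_nf_exists[OF X this] obtain n_as where jnf: "jordan_nf X n_as" by blast
  have zero: "a = 0" if "(l, a) \<in> set n_as" for l a
  proof -
    have "l \<noteq> 0" using jnf that unfolding jordan_nf_def by force
    then have "poly (char_poly X) a = 0"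
      unfolding jordan_nf_char_poly[OF jnf] poly_prod_list
      using that by (force simp: prod_list_zero_iff)
    then show ?thesis
      using eigenvalue_root_char_poly[OF X] nilpotent_eigenvalue_zero[OF X nil] by blast
  qed
  define d where "d = rev (sort (map fst n_as))"
  have "map (\<lambda>r. (r, 0)) (map fst n_as) = n_as"
    using zero by (auto simp: o_def intro!: map_idI)
  then have "mset n_as = mset (map (\<lambda>r. (r, 0)) d)"
    unfolding d_def by (metis mset_map mset_rev mset_sort)
  from similar_jordan_matrix_perm[OF this]
  have "similar_mat X (jordan_matrix (map (\<lambda>r. (r, 0)) d))"
    using jnf similar_mat_trans unfolding jordan_nf_def by blast
  moreover have "0 \<notin> set d" using jnf unfolding jordan_nf_def d_def by auto
  ultimately have jd: "jordan_nf X (map (\<lambda>r. (r, 0)) d)" unfolding jordan_nf_def by auto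
  moreover have "is_partition N d"
    using has_rank_jordan_nf(1)[OF X jd] \<open>0 \<notin> set d\<close>
    by (simp add: is_partition_def d_def sorted_wrt_rev)
  ultimately show ?thesis by blast
qed

section \<open>Jordan types in the symplectic Lie algebra\<close>

lemma symplectic_form_carrier [simp, intro]: "symplectic_form n \<in> carrier_mat (2 * n) (2 * n)"
  unfolding symplectic_form_def mult_2 by (rule four_block_carrier_mat) auto

lemma dim_symplectic_form [simp]:
  "dim_row (symplectic_form n) = 2 * n" "dim_col (symplectic_form n) = 2 * n"
  using carrier_matD[OF symplectic_form_carrier] by auto

lemma symplectic_form_transpose: "transpose_mat (symplectic_form n) = - symplectic_form n"
  unfolding symplectic_form_def by (intro eq_matI) (auto simp: four_block_mat_def Let_def)

lemma symplectic_form_square: "- symplectic_form n * symplectic_form n = 1\<^sub>m (2 * n)"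
proof -
  have m: "- 1\<^sub>m n \<in> carrier_mat n n" by simp
  note z = zero_carrier_mat one_carrier_mat m
  have "symplectic_form n * symplectic_form n = four_block_mat (- 1\<^sub>m n) (0\<^sub>m n n) (0\<^sub>m n n) (- 1\<^sub>m n)"
    unfolding symplectic_form_def
    by (subst mult_four_block_mat[OF z(1) z(2) z(3) z(1) z(1) z(2) z(3) z(1)])
      (simp add: uminus_zero_mat)
  moreover have "four_block_mat (- 1\<^sub>m n) (0\<^sub>m n n) (0\<^sub>m n n) (- 1\<^sub>m n) = - (1\<^sub>m (2 * n) :: complex mat)"
    by (rule eq_matI) auto
  ultimately show ?thesis by simp
qed

text \<open>The form \<open>(x, X\<^sup>k y)\<close> is skew for even \<open>k\<close> and symmetric for odd \<open>k\<close>.\<close>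
lemma sp_pow_transpose:
  assumes "X \<in> sp n"
  shows "transpose_mat (X ^\<^sub>m k) * symplectic_form n = (-1) ^ k \<cdot>\<^sub>m (symplectic_form n * X ^\<^sub>m k)"
proof (induction k)
  case 0
  have "X \<in> carrier_mat (2 * n) (2 * n)" using assms by (simp add: sp_def)
  then show ?case by (auto intro!: eq_matI)
next
  case (Suc k)
  let ?J = "symplectic_form n" and ?N = "2 * n"
  have X: "X \<in> carrier_mat ?N ?N" and eq: "transpose_mat X * ?J + ?J * X = 0\<^sub>m ?N ?N"
    using assms by (auto simp: sp_def)
  have anti: "transpose_mat X * ?J = - (?J * X)"
  proof (rule eq_matI)
    fix i j assume ij: "i < dim_row (- (?J * X))" "j < dim_col (- (?J * X))"
    then have "(transpose_mat X * ?J + ?J * X) $$ (i, j) = 0" using X eq by auto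
    then show "(transpose_mat X * ?J) $$ (i, j) = (- (?J * X)) $$ (i, j)"
      using ij X by (simp add: eq_neg_iff_add_eq_0)
  qed (use X in auto)
  note as = assoc_mult_mat[of _ ?N ?N _ ?N _ ?N]
  have Xk: "X ^\<^sub>m k \<in> carrier_mat ?N ?N" using X by simp
  have "transpose_mat (X ^\<^sub>m Suc k) * ?J = transpose_mat X * (transpose_mat (X ^\<^sub>m k) * ?J)"
    using X by (simp add: transpose_mult[of _ ?N ?N _ ?N] as)
  also have "\<dots> = (-1) ^ k \<cdot>\<^sub>m (transpose_mat X * (?J * X ^\<^sub>m k))"
    unfolding Suc using X by (intro mult_smult_distrib[of _ ?N ?N _ ?N]) auto
  also have "transpose_mat X * (?J * X ^\<^sub>m k) = transpose_mat X * ?J * X ^\<^sub>m k"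
    using X by (simp add: as)
  also have "\<dots> = - (?J * X * X ^\<^sub>m k)" unfolding anti using X by simp
  also have "?J * X * X ^\<^sub>m k = ?J * X ^\<^sub>m Suc k"
    unfolding pow_mat_Suc_left[OF X] using X by (simp add: as)
  finally show ?case using X by (auto intro!: eq_matI)
qed

lemma excess_second_difference:
  "0 < i \<Longrightarrow> (\<Sum>x\<leftarrow>d. x - (i - 1)) + (\<Sum>x\<leftarrow>d. x - (i + 1)) = 2 * (\<Sum>x\<leftarrow>d. x - i) + count_list d (i :: nat)"
  by (induction d) auto

text \<open>The multiplicity of \<open>i\<close> is the second difference of the ranks of the powers at \<open>i\<close>. For odd \<open>i\<close> the
  two outer ranks belong to even powers and are even, and the middle one is counted twice.\<close>
lemma sp_jordan_type_C_partition:
  assumes X: "X \<in> sp n" and d: "is_partition (2 * n) d" and jnf: "jordan_nf X (map (\<lambda>r. (r, 0)) d)"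
  shows "is_C_partition (2 * n) d"
proof -
  let ?J = "symplectic_form n" and ?N = "2 * n"
  have Xc: "X \<in> carrier_mat ?N ?N" using X by (simp add: sp_def)
  have ev: "even (\<Sum>x\<leftarrow>d. x - k)" if k: "even k" for k
  proof (rule rank_skew_even[OF has_rank_jordan_nf(2)[OF Xc jnf, of k], where J = ?J and J' = "- ?J"])
    have "transpose_mat (?J * X ^\<^sub>m k) = transpose_mat (X ^\<^sub>m k) * (- ?J)"
      using Xc by (simp add: transpose_mult[of _ ?N ?N _ ?N] symplectic_form_transpose)
    also have "\<dots> = - (transpose_mat (X ^\<^sub>m k) * ?J)" using Xc by simp
    also have "\<dots> = - (?J * X ^\<^sub>m k)" unfolding sp_pow_transpose[OF X] using k Xc by (auto intro!: eq_matI)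
    finally show "transpose_mat (?J * X ^\<^sub>m k) = - (?J * X ^\<^sub>m k)" .
  qed (simp_all add: symplectic_form_square)
  have "even (count_list d i)" if i: "odd i" for i
  proof -
    have "even ((\<Sum>x\<leftarrow>d. x - (i - 1)) + (\<Sum>x\<leftarrow>d. x - (i + 1)))"
      using ev[of "i - 1"] ev[of "i + 1"] i by simp
    then show ?thesis
      unfolding excess_second_difference[OF odd_pos[OF i]] by simp
  qed
  then show ?thesis using d by (simp add: is_C_partition_def)
qed

section \<open>Ranks of powers of strictly graded matrices\<close>

text \<open>Impose on \<open>v\<close> one linear condition for every index \<open>i\<close> of degree outside \<open>T\<close>: the \<open>i\<close>-th coordinate of
  \<open>Y\<^sup>m v\<close> vanishes, where \<open>m\<close> is the number of degrees in \<open>T\<close> below that of \<open>i\<close>. By induction on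
  \<open>m\<close>, the vector \<open>Y\<^sup>m v\<close> then has no coordinate in degrees with at most \<open>m\<close> elements of
  \<open>T\<close> weakly below them, because \<open>Y\<close> raises degrees. So these conditions imply \<open>Y\<^sup>k v = 0\<close>.\<close>
lemma strictly_graded_rank_bound:
  fixes g :: "nat \<Rightarrow> int"
  assumes Y: "Y \<in> carrier_mat N N"
    and graded: "\<And>i j. i < N \<Longrightarrow> j < N \<Longrightarrow> \<not> g j < g i \<Longrightarrow> Y $$ (i, j) = 0"
    and T: "finite T" "card T \<le> k"
    and fr: "has_rank N (Y ^\<^sub>m k) r"
  shows "r \<le> card {i. i < N \<and> g i \<notin> T}"
proof -
  let ?below = "\<lambda>i. card {t \<in> T. t < g i}" and ?upto = "\<lambda>i. card {t \<in> T. t \<le> g i}"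
  \<comment> \<open>\<open>L\<close> collects the linear conditions, one row per index of degree outside \<open>T\<close>\<close>
  define L where "L = mat N N (\<lambda>(i, j). if g i \<in> T then 0 else (Y ^\<^sub>m ?below i) $$ (i, j))"
  have L: "L \<in> carrier_mat N N" by (simp add: L_def)
  have Yk: "Y ^\<^sub>m m \<in> carrier_mat N N" for m using Y by simp
  show ?thesis
  proof (rule rank_le_if_kernel_contained[OF fr L])
    fix i j assume "i < N" "i \<notin> {i. i < N \<and> g i \<notin> T}" "j < N"
    then show "L $$ (i, j) = 0" by (simp add: L_def)
  next
    fix v assume v: "v \<in> carrier_vec N" and Lv: "L *\<^sub>v v = 0\<^sub>v N"
    have lin: "(Y ^\<^sub>m ?below i *\<^sub>v v) $ i = 0" if i: "i < N" "g i \<notin> T" for i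
    proof -
      have "(Y ^\<^sub>m ?below i *\<^sub>v v) $ i = (L *\<^sub>v v) $ i"
        unfolding index_mult_mat_vec_sum[OF Yk v i(1)] index_mult_mat_vec_sum[OF L v i(1)]
        using i by (intro sum.cong) (auto simp: L_def)
      then show ?thesis using Lv i by simp
    qed
    have claim: "i < N \<Longrightarrow> ?upto i \<le> m \<Longrightarrow> (Y ^\<^sub>m m *\<^sub>v v) $ i = 0" for m i
    proof (induction m arbitrary: i)
      case 0
      then have "{t \<in> T. t \<le> g i} = {}" using T(1) by auto
      then have "g i \<notin> T" "?below i = 0" by (auto intro!: card_eq_0_iff[THEN iffD2])
      then show ?case using lin[of i] 0 by simp
    next
      case (Suc m)
      show ?case
      proof (cases "g i \<notin> T \<and> ?upto i = Suc m")
        case True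
        then have "{t \<in> T. t < g i} = {t \<in> T. t \<le> g i}" by (auto simp: less_le)
        then show ?thesis using lin[of i] True Suc.prems by simp
      next
        case False
        have "?below i \<le> m"
        proof (cases "g i \<in> T")
          case True
          have "{t \<in> T. t < g i} \<subset> {t \<in> T. t \<le> g i}" using True by auto
          then have "?below i < ?upto i" using T(1) by (intro psubset_card_mono) auto
          then show ?thesis using Suc.prems by simp
        next
          case F: False
          have "?below i \<le> ?upto i" using T(1) by (intro card_mono) auto
          then show ?thesis using Suc.prems False F by simp
        qed
        have below: "(Y ^\<^sub>m m *\<^sub>v v) $ j = 0" if j: "j < N" "g j < g i" for j
        proof (rule Suc.IH[OF j(1)])
          have "?upto j \<le> ?below i" using T(1) j by (intro card_mono) auto
          then show "?upto j \<le> m" using \<open>?below i \<le> m\<close> by simp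
        qed
        have "(Y *\<^sub>v (Y ^\<^sub>m m *\<^sub>v v)) $ i = (\<Sum>j = 0..<N. Y $$ (i, j) * (Y ^\<^sub>m m *\<^sub>v v) $ j)"
          using Suc.prems(1) by (intro index_mult_mat_vec_sum[OF Y mult_mat_vec_carrier[OF Yk v]])
        also have "\<dots> = 0"
          using graded[OF Suc.prems(1)] below by (intro sum.neutral) (metis atLeastLessThan_iff mult_eq_0_iff)
        finally show ?thesis using pow_mat_Suc_mult_vec[OF Y v, of m] by simp
      qed
    qed
    show "Y ^\<^sub>m k *\<^sub>v v = 0\<^sub>v N"
    proof (rule eq_vecI)
      fix i assume "i < dim_vec (0\<^sub>v N :: complex vec)"
      then have i: "i < N" by simp
      have "?upto i \<le> card T" using T(1) by (intro card_mono) auto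
      then show "(Y ^\<^sub>m k *\<^sub>v v) $ i = 0\<^sub>v N $ i" using claim[OF i, of k] T(2) i by simp
    qed (use Yk[of k] in auto)
  qed simp
qed

lemma ex_largest_subset:
  fixes c :: "'a \<Rightarrow> nat"
  assumes "finite S" "k \<le> card S"
  shows "\<exists>T\<subseteq>S. card T = k \<and> (\<forall>t\<in>T. \<forall>b\<in>S - T. c b \<le> c t)"
  using assms(2)
proof (induction k)
  case 0
  then show ?case by (intro exI[of _ "{}"]) auto
next
  case (Suc k)
  then obtain T where T: "T \<subseteq> S" "card T = k" "\<forall>t\<in>T. \<forall>b\<in>S - T. c b \<le> c t" by auto
  have fT: "finite T" using T assms(1) finite_subset by blast
  have "S - T \<noteq> {}" using T Suc.prems by auto
  then have "Max (c ` (S - T)) \<in> c ` (S - T)" using assms(1) by (intro Max_in) auto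
  then obtain u where "u \<in> S - T" "c u = Max (c ` (S - T))" by auto
  then have u: "u \<in> S - T" "\<forall>b\<in>S - T. c b \<le> c u" using assms(1) by auto
  then show ?case using T fT by (intro exI[of _ "insert u T"]) auto
qed

text \<open>The \<open>k\<close> largest columns meet every row of the diagram in \<open>k\<close> boxes or in the whole row.\<close>
lemma ex_levels_truncated_sum:
  fixes c :: "'a \<Rightarrow> nat"
  assumes "finite S"
  shows "\<exists>T\<subseteq>S. card T \<le> k \<and> (\<Sum>i<m. min k (card {t \<in> S. i < c t})) \<le> (\<Sum>t\<in>T. c t)"
proof -
  obtain T where T: "T \<subseteq> S" "card T = min k (card S)" "\<forall>t\<in>T. \<forall>b\<in>S - T. c b \<le> c t"
    using ex_largest_subset[OF assms, of "min k (card S)" c] by auto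
  have fT: "finite T" using T assms finite_subset by blast
  have "min k (card {t \<in> S. i < c t}) \<le> card {t \<in> T. i < c t}" for i
  proof (cases "\<forall>t\<in>T. i < c t")
    case True
    have "card {t \<in> S. i < c t} \<le> card S" using assms by (intro card_mono) auto
    moreover have "{t \<in> T. i < c t} = T" using True by auto
    ultimately show ?thesis using T(2) by simp
  next
    case False
    then obtain t\<^sub>0 where "t\<^sub>0 \<in> T" "c t\<^sub>0 \<le> i" by auto
    then have "b \<in> T" if "b \<in> S" "i < c b" for b
      using T(3) that by (metis DiffI le_trans linorder_not_less)
    then have "{t \<in> S. i < c t} = {t \<in> T. i < c t}" using T(1) by auto
    then show ?thesis by simp
  qed
  then have "(\<Sum>i<m. min k (card {t \<in> S. i < c t})) \<le> (\<Sum>i<m. card {t \<in> T. i < c t})"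
    by (intro sum_mono)
  also have "\<dots> = (\<Sum>i<m. \<Sum>t\<in>T. if i < c t then 1 else 0)"
    using fT by (intro sum.cong) (auto simp: sum.If_cases Int_def)
  also have "\<dots> = (\<Sum>t\<in>T. \<Sum>i<m. if i < c t then 1 else 0)" by (rule sum.swap)
  also have "\<dots> \<le> (\<Sum>t\<in>T. c t)"
  proof (rule sum_mono)
    fix t
    have "(\<Sum>i<m. if i < c t then 1 else 0 :: nat) = card {i \<in> {..<m}. i < c t}"
      by (simp add: sum.If_cases Int_def)
    also have "\<dots> \<le> card {..<c t}" by (intro card_mono) auto
    finally show "(\<Sum>i<m. if i < c t then 1 else 0) \<le> c t" by simp
  qed
  finally show ?thesis using T by (intro exI[of _ T]) auto
qed

section \<open>Open conditions on matrices\<close>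

lemma continuous_map_mult_field:
  fixes f h :: "'a \<Rightarrow> complex"
  assumes "continuous_map T euclidean f" "continuous_map T euclidean h"
  shows "continuous_map T euclidean (\<lambda>x. f x * h x)"
  using assms unfolding continuous_map_atin limitin_canonical_iff by (auto intro: tendsto_mult)

lemma continuous_map_prod_field:
  fixes f :: "'i \<Rightarrow> 'a \<Rightarrow> complex"
  assumes "finite I" "\<And>i. i \<in> I \<Longrightarrow> continuous_map T euclidean (f i)"
  shows "continuous_map T euclidean (\<lambda>x. \<Prod>i\<in>I. f i x)"
  using assms by (induction I rule: finite_induct) (auto intro: continuous_map_mult_field)

definition continuous_mat_map :: "complex mat topology \<Rightarrow> nat \<Rightarrow> (complex mat \<Rightarrow> complex mat) \<Rightarrow> bool" where
  "continuous_mat_map T N F \<longleftrightarrow> (\<forall>X\<in>topspace T. F X \<in> carrier_mat N N) \<and>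
     (\<forall>i<N. \<forall>j<N. continuous_map T euclidean (\<lambda>X. F X $$ (i, j)))"

lemma continuous_mat_map_id:
  "continuous_mat_map (subtopology (mat_topology N N) U) N (\<lambda>X. X)"
proof -
  have "continuous_map (mat_topology N N) euclidean (\<lambda>X. X $$ (i, j))" if "i < N" "j < N" for i j
  proof -
    have "continuous_map (mat_topology N N) euclidean
        ((\<lambda>x. x (i, j)) \<circ> (\<lambda>A. restrict (\<lambda>ij. A $$ ij) ({..<N} \<times> {..<N})))"
      unfolding mat_topology_def using that
      by (intro continuous_map_pullback continuous_map_product_coordinates) auto
    then show ?thesis using that by (simp add: o_def)
  qed
  then show ?thesis
    unfolding continuous_mat_map_def
    by (auto intro: continuous_map_from_subtopology
        simp: mat_topology_def topspace_pullback_topology)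
qed

lemma continuous_mat_mapI:
  assumes "\<And>X. X \<in> topspace T \<Longrightarrow> F X \<in> carrier_mat N N"
    and "\<And>i j. i < N \<Longrightarrow> j < N \<Longrightarrow> continuous_map T euclidean (E i j)"
    and "\<And>X i j. X \<in> topspace T \<Longrightarrow> i < N \<Longrightarrow> j < N \<Longrightarrow> E i j X = F X $$ (i, j)"
  shows "continuous_mat_map T N F"
  unfolding continuous_mat_map_def using assms by (blast intro: continuous_map_eq)

lemma continuous_mat_mapD:
  assumes "continuous_mat_map T N F"
  shows "X \<in> topspace T \<Longrightarrow> F X \<in> carrier_mat N N"
    and "i < N \<Longrightarrow> j < N \<Longrightarrow> continuous_map T euclidean (\<lambda>X. F X $$ (i, j))"
  using assms unfolding continuous_mat_map_def by blast+

lemma continuous_mat_map_mult: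
  assumes F: "continuous_mat_map T N F" and G: "continuous_mat_map T N G"
  shows "continuous_mat_map T N (\<lambda>X. F X * G X)"
proof (rule continuous_mat_mapI)
  fix X i j assume X: "X \<in> topspace T" and ij: "i < N" "j < N"
  show "(\<Sum>l = 0..<N. F X $$ (i, l) * G X $$ (l, j)) = (F X * G X) $$ (i, j)"
    using ij continuous_mat_mapD(1)[OF F X] continuous_mat_mapD(1)[OF G X]
    by (auto simp: scalar_prod_def intro: sum.cong)
qed (auto intro!: continuous_map_sum continuous_map_mult_field mult_carrier_mat
    continuous_mat_mapD[OF F] continuous_mat_mapD[OF G])

lemma continuous_mat_map_const:
  "C \<in> carrier_mat N N \<Longrightarrow> continuous_mat_map T N (\<lambda>X. C)"
  unfolding continuous_mat_map_def by simp

lemma continuous_mat_map_add: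
  assumes F: "continuous_mat_map T N F" and G: "continuous_mat_map T N G"
  shows "continuous_mat_map T N (\<lambda>X. F X + G X)"
proof (rule continuous_mat_mapI)
  fix X i j assume X: "X \<in> topspace T" and ij: "i < N" "j < N"
  show "F X $$ (i, j) + G X $$ (i, j) = (F X + G X) $$ (i, j)"
    using ij continuous_mat_mapD(1)[OF F X] continuous_mat_mapD(1)[OF G X] by simp
qed (auto intro!: continuous_map_add add_carrier_mat
    continuous_mat_mapD[OF F] continuous_mat_mapD[OF G])

lemma continuous_mat_map_pow:
  assumes F: "continuous_mat_map T N F"
  shows "continuous_mat_map T N (\<lambda>X. F X ^\<^sub>m k)"
proof (induction k)
  case 0
  have "F X ^\<^sub>m 0 = 1\<^sub>m N" if "X \<in> topspace T" for X
    using continuous_mat_mapD(1)[OF F that] by auto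
  then show ?case
    by (intro continuous_mat_mapI[where E = "\<lambda>i j X. 1\<^sub>m N $$ (i, j)"]) simp_all
next
  case (Suc k)
  then show ?case using F by (simp add: continuous_mat_map_mult)
qed

lemma continuous_map_det:
  assumes "continuous_mat_map T N F"
  shows "continuous_map T euclidean (\<lambda>X. det (F X))"
proof -
  have "continuous_map T euclidean
      (\<lambda>X. \<Sum>p\<in>{p. p permutes {0..<N}}. signof p * (\<Prod>i = 0..<N. F X $$ (i, p i)))"
  proof (intro continuous_map_sum continuous_map_mult_field continuous_map_prod_field finite_permutations)
    fix p i assume "p \<in> {p. p permutes {0..<N}}" "i \<in> {0..<N}"
    then have "i < N" "p i < N"
      using permutes_in_image[of p "{0..<N}" i] by auto
    then show "continuous_map T euclidean (\<lambda>X. F X $$ (i, p i))"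
      using assms unfolding continuous_mat_map_def by blast
  qed auto
  moreover have "(\<Sum>p\<in>{p. p permutes {0..<N}}. signof p * (\<Prod>i = 0..<N. F X $$ (i, p i))) = det (F X)"
    if "X \<in> topspace T" for X
    using assms that unfolding continuous_mat_map_def by (subst det_def'[of _ N]) auto
  ultimately show ?thesis by (rule continuous_map_eq)
qed

text \<open>The determinant is a continuous function of \<open>X\<close>, so its nonvanishing is an open condition.\<close>
lemma dense_meets_det_nonzero:
  assumes U: "U \<subseteq> carrier_mat N N" and dense: "subtopology (mat_topology N N) U closure_of D = U"
    and C: "C \<in> carrier_mat N N" and E: "E \<in> carrier_mat N N"
    and Y: "Y \<in> U" "det (C * Y ^\<^sub>m k + E) \<noteq> 0"
  shows "\<exists>X\<in>D. det (C * X ^\<^sub>m k + E) \<noteq> 0"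
proof -
  let ?T = "subtopology (mat_topology N N) U"
  have "continuous_map ?T euclidean (\<lambda>X. det (C * X ^\<^sub>m k + E))"
    by (intro continuous_map_det[where N = N] continuous_mat_map_add continuous_mat_map_mult
        continuous_mat_map_pow continuous_mat_map_id continuous_mat_map_const C E)
  then have op: "openin ?T {X \<in> topspace ?T. det (C * X ^\<^sub>m k + E) \<in> - {0}}" (is "openin _ ?W")
    by (rule openin_continuous_map_preimage) (auto simp: open_Compl)
  have Yc: "Y \<in> ?T closure_of D" using Y dense by simp
  then have "Y \<in> topspace ?T" by (meson in_closure_of)
  then have "Y \<in> ?W" using Y(2) by simp
  then obtain X where "X \<in> D" "X \<in> ?W"
    using Yc op unfolding in_closure_of by meson
  then show ?thesis by auto
qed

text \<open>A common zero of \<open>X\<^sup>k\<close> and of the coordinates in \<open>Q\<close> is killed by the invertible matrix.\<close>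
lemma rank_ge_if_det_nonzero:
  assumes X: "X \<in> carrier_mat N N" and C: "C \<in> carrier_mat N N" and Q: "finite Q"
    and det: "det (C * X ^\<^sub>m k + mat N N (\<lambda>(i, j). if i = j \<and> i \<in> Q then 1 else 0)) \<noteq> 0"
    and fr: "has_rank N (X ^\<^sub>m k) r"
  shows "N \<le> r + card Q"
proof (rule rank_ge_if_kernel_trivial[OF fr Q])
  let ?E = "mat N N (\<lambda>(i, j). if i = j \<and> i \<in> Q then 1 else 0 :: complex)"
  fix v assume v: "v \<in> carrier_vec N" and Xv: "X ^\<^sub>m k *\<^sub>v v = 0\<^sub>v N"
    and vQ: "\<And>i. i \<in> Q \<Longrightarrow> i < N \<Longrightarrow> v $ i = 0"
  have Xk: "X ^\<^sub>m k \<in> carrier_mat N N" using X by simp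
  have "?E *\<^sub>v v = 0\<^sub>v N"
  proof (rule eq_vecI)
    fix i assume "i < dim_vec (0\<^sub>v N :: complex vec)"
    then have i: "i < N" by simp
    have "(?E *\<^sub>v v) $ i = (\<Sum>j = 0..<N. (if i = j \<and> i \<in> Q then 1 else 0) * v $ j)"
      using i v by (auto simp: scalar_prod_def intro: sum.cong)
    also have "\<dots> = 0" using vQ by (intro sum.neutral) auto
    finally show "(?E *\<^sub>v v) $ i = 0\<^sub>v N $ i" using i by simp
  qed simp
  moreover have "(C * X ^\<^sub>m k) *\<^sub>v v = 0\<^sub>v N"
  proof -
    have "(C * X ^\<^sub>m k) *\<^sub>v v = C *\<^sub>v (X ^\<^sub>m k *\<^sub>v v)"
      using C Xk v by (rule assoc_mult_mat_vec)
    also have "\<dots> = 0\<^sub>v N" unfolding Xv using C by (intro eq_vecI) auto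
    finally show ?thesis .
  qed
  ultimately have "(C * X ^\<^sub>m k + ?E) *\<^sub>v v = 0\<^sub>v N"
    using C Xk v by (subst add_mult_distrib_mat_vec[of _ N N]) auto
  then show "v = 0\<^sub>v N"
    using det det_0_iff_vec_prod_zero[of "C * X ^\<^sub>m k + ?E" N] C Xk v by auto
qed

section \<open>Signed partial permutation matrices of chains\<close>

text \<open>Indices \<open>0, \<dots>, N - 1\<close> of basis vectors are distributed over rows, and \<open>g\<close> orders each row into a
  chain. A chain matrix sends every basis vector to the next one above it in its row, up to a sign;
  the last vector of a chain is sent to zero.\<close>
locale chain_structure =
  fixes N :: nat and row_of :: "nat \<Rightarrow> 'c" and g :: "nat \<Rightarrow> int"
  assumes row_inj: "i < N \<Longrightarrow> j < N \<Longrightarrow> row_of i = row_of j \<Longrightarrow> g i = g j \<Longrightarrow> i = j"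
begin

definition covers :: "nat \<Rightarrow> nat \<Rightarrow> bool" where
  "covers i j \<longleftrightarrow> i < N \<and> j < N \<and> row_of i = row_of j \<and> g j < g i \<and>
     (\<forall>l<N. row_of l = row_of i \<longrightarrow> \<not> (g j < g l \<and> g l < g i))"

definition above :: "nat \<Rightarrow> nat set" where
  "above j = {l. l < N \<and> row_of l = row_of j \<and> g j < g l}"

lemma finite_above [simp]: "finite (above j)"
  by (simp add: above_def)

lemma covers_unique_left: "covers i j \<Longrightarrow> covers i' j \<Longrightarrow> i = i'"
  unfolding covers_def by (metis row_inj linorder_cases)

lemma covers_unique_right: "covers i j \<Longrightarrow> covers i j' \<Longrightarrow> j = j'"
  unfolding covers_def by (metis row_inj linorder_cases)

lemma above_covers: "covers i j \<Longrightarrow> above j = insert i (above i)"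
  unfolding covers_def above_def
  by (auto intro: less_trans) (metis row_inj linorder_cases)

lemma card_above_covers: "covers i j \<Longrightarrow> card (above j) = Suc (card (above i))"
  by (subst above_covers) (auto simp: above_def card_insert_if)

lemma ex_covers:
  assumes "j < N" "above j \<noteq> {}"
  shows "\<exists>i. covers i j"
proof -
  have "Min (g ` above j) \<in> g ` above j" using assms by (intro Min_in) auto
  then obtain i where i: "i \<in> above j" "g i = Min (g ` above j)" by auto
  have "g i \<le> g l" if "l \<in> above j" for l using i that by simp
  then have "\<not> (g j < g l \<and> g l < g i)" if "l < N" "row_of l = row_of i" for l
    using i(1) that by (force simp: above_def)
  then have "covers i j" using i(1) assms(1) unfolding covers_def by (auto simp: above_def)
  then show ?thesis by blast
qed

definition chain_mat :: "(nat \<Rightarrow> nat \<Rightarrow> complex) \<Rightarrow> complex mat" where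
  "chain_mat s = mat N N (\<lambda>(i, j). if covers i j then s i j else 0)"

lemma chain_mat_carrier [simp]: "chain_mat s \<in> carrier_mat N N"
  and chain_mat_dim [simp]: "dim_row (chain_mat s) = N" "dim_col (chain_mat s) = N"
  by (simp_all add: chain_mat_def)

text \<open>The \<open>k\<close>-th power kills the basis vectors with fewer than \<open>k\<close> others above them and maps the remaining
  ones to distinct basis vectors, up to sign.\<close>
lemma chain_mat_pow_gram:
  assumes s: "\<And>i j. s i j * s i j = 1"
  shows "transpose_mat (chain_mat s) ^\<^sub>m k * chain_mat s ^\<^sub>m k =
     mat N N (\<lambda>(i, j). if i = j \<and> k \<le> card (above i) then 1 else 0)"
proof (induction k)
  case 0
  show ?case by (rule eq_matI) (auto simp: chain_mat_def)
next
  case (Suc k)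
  let ?Y = "chain_mat s"
  let ?D = "\<lambda>k. mat N N (\<lambda>(i, j). if i = j \<and> k \<le> card (above i) then 1 else 0 :: complex)"
  have Y: "?Y \<in> carrier_mat N N" "transpose_mat ?Y \<in> carrier_mat N N" by auto
  have D: "?D k \<in> carrier_mat N N" by simp
  have "transpose_mat ?Y ^\<^sub>m Suc k * ?Y ^\<^sub>m Suc k =
      transpose_mat ?Y * ((transpose_mat ?Y ^\<^sub>m k * ?Y ^\<^sub>m k) * ?Y)"
  proof -
    have P: "transpose_mat ?Y ^\<^sub>m k \<in> carrier_mat N N" "?Y ^\<^sub>m k \<in> carrier_mat N N"
      using Y by (blast intro: pow_carrier_mat)+
    have "transpose_mat ?Y ^\<^sub>m k * (?Y ^\<^sub>m k * ?Y) = transpose_mat ?Y ^\<^sub>m k * ?Y ^\<^sub>m k * ?Y"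
      using P Y by (intro assoc_mult_mat[symmetric, of _ N N _ N _ N])
    moreover have "transpose_mat ?Y * transpose_mat ?Y ^\<^sub>m k * (?Y ^\<^sub>m k * ?Y) =
        transpose_mat ?Y * (transpose_mat ?Y ^\<^sub>m k * (?Y ^\<^sub>m k * ?Y))"
      by (rule assoc_mult_mat[OF Y(2) P(1) mult_carrier_mat[OF P(2) Y(1)]])
    ultimately show ?thesis unfolding pow_mat_Suc_left[OF Y(2)] by simp
  qed
  also have "\<dots> = transpose_mat ?Y * (?D k * ?Y)" unfolding Suc ..
  also have "\<dots> = ?D (Suc k)"
  proof (rule eq_matI)
    fix j l assume "j < dim_row (?D (Suc k))" "l < dim_col (?D (Suc k))"
    then have jl: "j < N" "l < N" by auto
    have DY: "(?D k * ?Y) $$ (i, l) = (if k \<le> card (above i) then ?Y $$ (i, l) else 0)" if i: "i < N" for i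
    proof -
      have "(?D k * ?Y) $$ (i, l) = (\<Sum>q = 0..<N. (if i = q \<and> k \<le> card (above i) then 1 else 0) * ?Y $$ (q, l))"
        using i jl Y(1) by (simp add: scalar_prod_def)
      also have "\<dots> = (\<Sum>q = 0..<N. if q = i then (if k \<le> card (above i) then ?Y $$ (i, l) else 0) else 0)"
        by (rule sum.cong) auto
      finally show ?thesis using i by simp
    qed
    have "(transpose_mat ?Y * (?D k * ?Y)) $$ (j, l) = (\<Sum>i = 0..<N. ?Y $$ (i, j) * (?D k * ?Y) $$ (i, l))"
      using jl Y by (simp add: scalar_prod_def)
    also have "\<dots> = (\<Sum>i = 0..<N. if covers i j \<and> j = l \<and> k \<le> card (above i) then 1 else 0)"
    proof (rule sum.cong)
      fix i assume "i \<in> {0..<N}"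
      then have i: "i < N" by simp
      show "?Y $$ (i, j) * (?D k * ?Y) $$ (i, l) = (if covers i j \<and> j = l \<and> k \<le> card (above i) then 1 else 0)"
        unfolding DY[OF i] using i jl s covers_unique_right[of i j l] by (auto simp: chain_mat_def)
    qed simp
    also have "\<dots> = (if j = l \<and> Suc k \<le> card (above j) then 1 else 0)"
    proof (cases "j = l \<and> Suc k \<le> card (above j)")
      case True
      then obtain c where c: "covers c j" using ex_covers[OF jl(1)] by fastforce
      then have "\<And>i. covers i j \<and> j = l \<and> k \<le> card (above i) \<longleftrightarrow> i = c"
        using True card_above_covers[OF c] covers_unique_left by auto
      moreover have "c < N" using c by (simp add: covers_def)
      moreover have "(if j = l \<and> Suc k \<le> card (above j) then 1 else 0 :: complex) = 1"
        using True by (rule if_P)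
      ultimately show ?thesis by simp
    next
      case False
      then show ?thesis using card_above_covers by (intro trans[OF sum.neutral]) auto
    qed
    finally show "(transpose_mat ?Y * (?D k * ?Y)) $$ (j, l) = ?D (Suc k) $$ (j, l)" using jl by simp
  qed (use Y in auto)
  finally show ?case .
qed

lemma card_above_strict: "i < N \<Longrightarrow> row_of i = row_of j \<Longrightarrow> g j < g i \<Longrightarrow> card (above i) < card (above j)"
  by (rule psubset_card_mono) (auto simp: above_def)

lemma card_few_above_le:
  assumes lab: "finite R" "\<And>j. j < N \<Longrightarrow> row_of j \<in> R"
  shows "card {j. j < N \<and> card (above j) < k} \<le> (\<Sum>c\<in>R. min k (card {j. j < N \<and> row_of j = c}))"
proof -
  have "{j. j < N \<and> card (above j) < k} = (\<Union>c\<in>R. {j. j < N \<and> row_of j = c \<and> card (above j) < k})"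
    using lab(2) by auto
  then have "card {j. j < N \<and> card (above j) < k} \<le> (\<Sum>c\<in>R. card {j. j < N \<and> row_of j = c \<and> card (above j) < k})"
    using card_UN_le[OF lab(1)] by simp
  also have "\<dots> \<le> (\<Sum>c\<in>R. min k (card {j. j < N \<and> row_of j = c}))"
  proof (intro sum_mono min.boundedI)
    fix c
    let ?S = "{j. j < N \<and> row_of j = c \<and> card (above j) < k}"
    show "card ?S \<le> card {j. j < N \<and> row_of j = c}" by (intro card_mono) auto
    have "inj_on (\<lambda>j. card (above j)) ?S"
    proof (rule inj_onI)
      fix i j assume "i \<in> ?S" "j \<in> ?S" "card (above i) = card (above j)"
      then show "i = j"
        using card_above_strict[of i j] card_above_strict[of j i] row_inj[of i j] by force
    qed
    then have "card ?S \<le> card {..<k}" by (rule card_inj_on_le) auto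
    then show "card ?S \<le> k" by simp
  qed
  finally show ?thesis .
qed

text \<open>The coordinates with fewer than \<open>k\<close> others above them cut out a complement of \<open>ker Y\<^sup>k\<close> for the
  chain matrix \<open>Y\<close>. This is expressed by a determinant that equals 1 at \<open>Y\<close>, hence is nonzero
  somewhere on every dense subset.\<close>
lemma dense_contains_large_rank:
  assumes U: "U \<subseteq> carrier_mat N N" and dense: "subtopology (mat_topology N N) U closure_of D = U"
    and s: "\<And>i j. s i j * s i j = 1" and Y: "chain_mat s \<in> U"
  shows "\<exists>X\<in>D. \<forall>r. X \<in> carrier_mat N N \<longrightarrow> has_rank N (X ^\<^sub>m k) r \<longrightarrow>
     N \<le> r + card {j. j < N \<and> card (above j) < k}"
proof -
  let ?Y = "chain_mat s" and ?Q = "{j. j < N \<and> card (above j) < k}"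
  let ?C = "transpose_mat ?Y ^\<^sub>m k"
  let ?E = "mat N N (\<lambda>(i, j). if i = j \<and> i \<in> ?Q then 1 else 0 :: complex)"
  have C: "?C \<in> carrier_mat N N" by (rule pow_carrier_mat) simp
  have "?C * ?Y ^\<^sub>m k + ?E = 1\<^sub>m N"
    unfolding chain_mat_pow_gram[OF s] by (rule eq_matI) auto
  then have "det (?C * ?Y ^\<^sub>m k + ?E) \<noteq> 0" by simp
  from dense_meets_det_nonzero[OF U dense C _ Y this]
  obtain X where "X \<in> D" "det (?C * X ^\<^sub>m k + ?E) \<noteq> 0" by auto
  then show ?thesis using rank_ge_if_det_nonzero[OF _ C, of X ?Q k] by auto
qed

end

section \<open>Coordinates on the symplectic Lie algebra\<close>

text \<open>The basis vector that pairs nontrivially with the \<open>i\<close>-th one under the symplectic form.\<close>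
definition dual :: "nat \<Rightarrow> nat \<Rightarrow> nat" where
  "dual n i = (if i < n then i + n else i - n)"

definition form_sign :: "nat \<Rightarrow> nat \<Rightarrow> complex" where
  "form_sign n i = (if i < n then 1 else - 1)"

lemma dual_less [simp]: "i < 2 * n \<Longrightarrow> dual n i < 2 * n"
  by (auto simp: dual_def)

lemma dual_dual [simp]: "i < 2 * n \<Longrightarrow> dual n (dual n i) = i"
  by (auto simp: dual_def)

lemma dual_less_iff: "i < 2 * n \<Longrightarrow> dual n i < n \<longleftrightarrow> \<not> i < n"
  by (auto simp: dual_def)

lemma dual_inj: "i < 2 * n \<Longrightarrow> j < 2 * n \<Longrightarrow> dual n i = dual n j \<longleftrightarrow> i = j"
  by (metis dual_dual)

lemma form_sign_square [simp]: "form_sign n i * form_sign n i = 1" "form_sign n i * (form_sign n i * z) = z"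
  by (auto simp: form_sign_def)

lemma form_sign_dual [simp]: "i < 2 * n \<Longrightarrow> form_sign n (dual n i) = - form_sign n i"
  by (auto simp: form_sign_def dual_def)

lemma cnj_form_sign [simp]: "cnj (form_sign n i) = form_sign n i"
  by (simp add: form_sign_def)

lemma sum_dual: "(\<Sum>l = 0..<2 * n. f (dual n l)) = (\<Sum>l = 0..<2 * n. f l)"
  by (rule sum.reindex_bij_witness[of _ "dual n" "dual n"]) auto

lemma symplectic_form_index:
  "i < 2 * n \<Longrightarrow> j < 2 * n \<Longrightarrow>
     symplectic_form n $$ (i, j) = (if j = dual n i then form_sign n i else 0)"
  by (auto simp: symplectic_form_def dual_def form_sign_def)

text \<open>Membership in \<open>sp n\<close> relates the entries at \<open>(i, j)\<close> and \<open>(j\<^sup>*, i\<^sup>*)\<close>, where the star is the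
  duality of indices.\<close>
lemma sp_iff:
  "X \<in> sp n \<longleftrightarrow> X \<in> carrier_mat (2 * n) (2 * n) \<and>
     (\<forall>i<2 * n. \<forall>j<2 * n. X $$ (dual n j, dual n i) = - form_sign n i * form_sign n j * X $$ (i, j))"
proof (cases "X \<in> carrier_mat (2 * n) (2 * n)")
  case X: True
  let ?J = "symplectic_form n" and ?N = "2 * n" and ?d = "dual n" and ?s = "form_sign n"
  have entry: "(transpose_mat X * ?J + ?J * X) $$ (i, j) = - ?s j * X $$ (?d j, i) + ?s i * X $$ (?d i, j)"
    if ij: "i < ?N" "j < ?N" for i j
  proof -
    have "(transpose_mat X * ?J) $$ (i, j) = (\<Sum>l = 0..<?N. X $$ (l, i) * ?J $$ (l, j))"
      using ij X by (simp add: scalar_prod_def)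
    also have "\<dots> = (\<Sum>l = 0..<?N. if l = ?d j then - ?s j * X $$ (?d j, i) else 0)"
      using ij by (intro sum.cong) (auto simp: symplectic_form_index)
    also have "\<dots> = - ?s j * X $$ (?d j, i)" using ij by simp
    finally have 1: "(transpose_mat X * ?J) $$ (i, j) = - ?s j * X $$ (?d j, i)" .
    have "(?J * X) $$ (i, j) = (\<Sum>l = 0..<?N. ?J $$ (i, l) * X $$ (l, j))"
      using ij X by (simp add: scalar_prod_def)
    also have "\<dots> = (\<Sum>l = 0..<?N. if l = ?d i then ?s i * X $$ (?d i, j) else 0)"
      using ij by (intro sum.cong) (auto simp: symplectic_form_index)
    also have "\<dots> = ?s i * X $$ (?d i, j)" using ij by simp
    finally show ?thesis using 1 ij X by simp
  qed
  have "X \<in> sp n \<longleftrightarrow> (\<forall>i<?N. \<forall>j<?N. - ?s j * X $$ (?d j, i) + ?s i * X $$ (?d i, j) = 0)"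
    (is "_ \<longleftrightarrow> ?C")
  proof
    assume "X \<in> sp n"
    then have "transpose_mat X * ?J + ?J * X = 0\<^sub>m ?N ?N" by (simp add: sp_def)
    then show ?C using entry by (metis index_zero_mat(1))
  next
    assume ?C
    then have "transpose_mat X * ?J + ?J * X = 0\<^sub>m ?N ?N"
      using X by (intro eq_matI) (simp_all add: entry del: index_add_mat(1))
    then show "X \<in> sp n" using X by (simp add: sp_def)
  qed
  also have "?C \<longleftrightarrow> (\<forall>i<?N. \<forall>j<?N. X $$ (?d j, ?d i) = - ?s i * ?s j * X $$ (i, j))"
  proof (intro iffI allI impI)
    fix i j assume C: ?C and ij: "i < ?N" "j < ?N"
    have "- ?s j * X $$ (?d j, ?d i) + ?s (?d i) * X $$ (?d (?d i), j) = 0"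
      using C ij dual_less by blast
    then have "- (?s j * X $$ (?d j, ?d i)) = ?s i * X $$ (i, j)"
      using ij by simp
    then have "?s j * (?s j * X $$ (?d j, ?d i)) = ?s j * (- (?s i * X $$ (i, j)))"
      by (metis minus_minus)
    then show "X $$ (?d j, ?d i) = - ?s i * ?s j * X $$ (i, j)" by (simp add: mult_ac)
  next
    fix i j assume C: "\<forall>i<?N. \<forall>j<?N. X $$ (?d j, ?d i) = - ?s i * ?s j * X $$ (i, j)"
      and ij: "i < ?N" "j < ?N"
    have "X $$ (?d j, ?d (?d i)) = - ?s (?d i) * ?s j * X $$ (?d i, j)"
      using C ij dual_less by blast
    then show "- ?s j * X $$ (?d j, i) + ?s i * X $$ (?d i, j) = 0" using ij by (simp add: algebra_simps)
  qed
  finally show ?thesis using X by simp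
qed (simp add: sp_def)

lemma sp_carrier: "X \<in> sp n \<Longrightarrow> X \<in> carrier_mat (2 * n) (2 * n)"
  by (simp add: sp_def)

lemma sp_dual_entry:
  "X \<in> sp n \<Longrightarrow> i < 2 * n \<Longrightarrow> j < 2 * n \<Longrightarrow>
     X $$ (dual n j, dual n i) = - form_sign n i * form_sign n j * X $$ (i, j)"
  unfolding sp_iff by blast

lemma lie_bracket_carrier:
  "X \<in> carrier_mat N N \<Longrightarrow> Y \<in> carrier_mat N N \<Longrightarrow> lie_bracket X Y \<in> carrier_mat N N"
  unfolding lie_bracket_def by auto

lemma lie_bracket_index:
  assumes "X \<in> carrier_mat N N" "Y \<in> carrier_mat N N" "i < N" "j < N"
  shows "lie_bracket X Y $$ (i, j) =
    (\<Sum>l = 0..<N. X $$ (i, l) * Y $$ (l, j)) - (\<Sum>l = 0..<N. Y $$ (i, l) * X $$ (l, j))"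
  using assms by (simp add: lie_bracket_def scalar_prod_def)

lemma sp_lie_bracket:
  assumes X: "X \<in> sp n" and Y: "Y \<in> sp n"
  shows "lie_bracket X Y \<in> sp n"
proof -
  let ?N = "2 * n" and ?d = "dual n" and ?s = "form_sign n"
  note c = sp_carrier[OF X] sp_carrier[OF Y]
  have "lie_bracket X Y $$ (?d j, ?d i) = - ?s i * ?s j * lie_bracket X Y $$ (i, j)"
    if ij: "i < ?N" "j < ?N" for i j
  proof -
    have prod: "(\<Sum>l = 0..<?N. A $$ (?d j, l) * B $$ (l, ?d i)) =
        ?s i * ?s j * (\<Sum>l = 0..<?N. B $$ (i, l) * A $$ (l, j))"
      if A: "A \<in> sp n" and B: "B \<in> sp n" for A B
    proof -
      have "(\<Sum>l = 0..<?N. A $$ (?d j, l) * B $$ (l, ?d i)) = (\<Sum>l = 0..<?N. A $$ (?d j, ?d l) * B $$ (?d l, ?d i))"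
        by (rule sum_dual[symmetric])
      also have "\<dots> = (\<Sum>l = 0..<?N. ?s i * ?s j * (B $$ (i, l) * A $$ (l, j)))"
      proof (rule sum.cong)
        fix l assume "l \<in> {0..<?N}"
        then show "A $$ (?d j, ?d l) * B $$ (?d l, ?d i) = ?s i * ?s j * (B $$ (i, l) * A $$ (l, j))"
          using sp_dual_entry[OF A _ ij(2), of l] sp_dual_entry[OF B ij(1), of l]
          by (simp add: mult_ac)
      qed simp
      finally show ?thesis by (simp add: sum_distrib_left)
    qed
    show ?thesis
      unfolding lie_bracket_index[OF c dual_less[OF ij(2)] dual_less[OF ij(1)]]
        lie_bracket_index[OF c ij] prod[OF X Y] prod[OF Y X] by (simp add: algebra_simps)
  qed
  then show ?thesis using lie_bracket_carrier[OF c] unfolding sp_iff by blast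
qed

section \<open>Subspaces cut out by a grading\<close>

lemma is_subspace_vanishing:
  "is_subspace n {X \<in> sp n. \<forall>i<2 * n. \<forall>j<2 * n. R i j \<longrightarrow> X $$ (i, j) = 0}"
proof -
  have "X + Y \<in> sp n" if "X \<in> sp n" "Y \<in> sp n" for X Y
    using that unfolding sp_iff by (auto simp: distrib_left)
  moreover have "c \<cdot>\<^sub>m X \<in> sp n" if "X \<in> sp n" for X c
    using that unfolding sp_iff by auto
  moreover have "0\<^sub>m (2 * n) (2 * n) \<in> sp n" unfolding sp_iff by auto
  moreover have "(X + Y) $$ (i, j) = X $$ (i, j) + Y $$ (i, j)" "(c \<cdot>\<^sub>m X) $$ (i, j) = c * X $$ (i, j)"
    if "X \<in> sp n" "Y \<in> sp n" "i < 2 * n" "j < 2 * n" for X Y c i j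
    using that sp_carrier[of X n] sp_carrier[of Y n] by simp_all
  ultimately show ?thesis
    unfolding is_subspace_def using sp_carrier by auto
qed

lemma is_subspaceD:
  assumes "is_subspace n V"
  shows "V \<subseteq> carrier_mat (2 * n) (2 * n)" "0\<^sub>m (2 * n) (2 * n) \<in> V"
    "X \<in> V \<Longrightarrow> Y \<in> V \<Longrightarrow> X + Y \<in> V" "X \<in> V \<Longrightarrow> c \<cdot>\<^sub>m X \<in> V"
  using assms unfolding is_subspace_def by auto

lemma zero_in_subspace_hull: "0\<^sub>m (2 * n) (2 * n) \<in> is_subspace n hull S"
  unfolding hull_def using is_subspaceD(2) by blast

lemma smult_in_subspace_hull: "X \<in> is_subspace n hull S \<Longrightarrow> c \<cdot>\<^sub>m X \<in> is_subspace n hull S"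
  unfolding hull_def using is_subspaceD(4) by blast

text \<open>The nilradical is determined for every integral grading of \<open>\<complex>\<^sup>2\<^sup>n\<close> that is compatible with the
  symplectic form. \<open>graded a\<close> consists of the elements raising degrees by at least \<open>a\<close>.\<close>
locale symplectic_grading =
  fixes n :: nat and g :: "nat \<Rightarrow> int"
  assumes g_dual: "i < 2 * n \<Longrightarrow> g (dual n i) = - g i"
begin

definition graded :: "int \<Rightarrow> complex mat set" where
  "graded a = {X \<in> sp n. \<forall>i<2 * n. \<forall>j<2 * n. g i < g j + a \<longrightarrow> X $$ (i, j) = 0}"

lemma gradedD: "X \<in> graded a \<Longrightarrow> X \<in> sp n"
  "X \<in> graded a \<Longrightarrow> X \<in> carrier_mat (2 * n) (2 * n)"
  "X \<in> graded a \<Longrightarrow> i < 2 * n \<Longrightarrow> j < 2 * n \<Longrightarrow> g i < g j + a \<Longrightarrow> X $$ (i, j) = 0"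
  unfolding graded_def using sp_carrier by blast+

lemma gradedI:
  "X \<in> sp n \<Longrightarrow> (\<And>i j. i < 2 * n \<Longrightarrow> j < 2 * n \<Longrightarrow> g i < g j + a \<Longrightarrow> X $$ (i, j) = 0) \<Longrightarrow> X \<in> graded a"
  unfolding graded_def by blast

lemma is_subspace_graded: "is_subspace n (graded a)"
  unfolding graded_def by (rule is_subspace_vanishing)

lemma graded_lie_bracket:
  assumes X: "X \<in> graded a" and Y: "Y \<in> graded b"
  shows "lie_bracket X Y \<in> graded (a + b)"
proof (rule gradedI[OF sp_lie_bracket[OF gradedD(1)[OF X] gradedD(1)[OF Y]]])
  fix i j assume ij: "i < 2 * n" "j < 2 * n" "g i < g j + (a + b)"
  have "(\<Sum>l = 0..<2 * n. X $$ (i, l) * Y $$ (l, j)) = 0"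
  proof (rule sum.neutral, rule ballI)
    fix l assume "l \<in> {0..<2 * n}"
    then show "X $$ (i, l) * Y $$ (l, j) = 0"
      using gradedD(3)[OF X ij(1), of l] gradedD(3)[OF Y _ ij(2), of l] ij(3)
      by (cases "g i < g l + a") auto
  qed
  moreover have "(\<Sum>l = 0..<2 * n. Y $$ (i, l) * X $$ (l, j)) = 0"
  proof (rule sum.neutral, rule ballI)
    fix l assume "l \<in> {0..<2 * n}"
    then show "Y $$ (i, l) * X $$ (l, j) = 0"
      using gradedD(3)[OF Y ij(1), of l] gradedD(3)[OF X _ ij(2), of l] ij(3)
      by (cases "g i < g l + b") auto
  qed
  ultimately show "lie_bracket X Y $$ (i, j) = 0"
    using ij by (simp add: lie_bracket_index[OF gradedD(2)[OF X] gradedD(2)[OF Y]])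
qed

lemma graded_large: "\<exists>m::nat. graded (int m + 1) = {0\<^sub>m (2 * n) (2 * n)}"
proof -
  define B where "B = (\<Sum>i<2 * n. \<bar>g i\<bar>)"
  have B: "\<bar>g i\<bar> \<le> B" if "i < 2 * n" for i
    unfolding B_def using that by (intro member_le_sum) auto
  have "X = 0\<^sub>m (2 * n) (2 * n)" if X: "X \<in> graded (int (nat (2 * B)) + 1)" for X
  proof (rule eq_matI)
    fix i j assume "i < dim_row (0\<^sub>m (2 * n) (2 * n) :: complex mat)" "j < dim_col (0\<^sub>m (2 * n) (2 * n) :: complex mat)"
    then have "i < 2 * n" "j < 2 * n" by auto
    then show "X $$ (i, j) = 0\<^sub>m (2 * n) (2 * n) $$ (i, j)"
      using gradedD(3)[OF X, of i j] B[of i] B[of j] by (cases "0 \<le> B") auto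
  qed (use gradedD(2)[OF X] in auto)
  then show ?thesis using is_subspaceD(2)[OF is_subspace_graded] by blast
qed

lemma lower_central_graded: "lower_central n (graded 1) m \<subseteq> graded (int m + 1)"
proof (induction m)
  case (Suc m)
  have "lie_bracket X Y \<in> graded (int (Suc m) + 1)"
    if "X \<in> graded 1" "Y \<in> lower_central n (graded 1) m" for X Y
  proof -
    have "lie_bracket X Y \<in> graded (1 + (int m + 1))"
      using that Suc by (intro graded_lie_bracket) auto
    then show ?thesis by (simp add: add.commute)
  qed
  then show ?case
    unfolding lower_central.simps by (intro hull_minimal is_subspace_graded) blast
qed simp

lemma graded_1_nilpotent_ideal: "is_nilpotent_ideal n (graded 1) (graded 0)"
proof -
  have sub: "graded 1 \<subseteq> graded 0" unfolding graded_def by auto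
  have "lie_bracket X Y \<in> graded 1" if "X \<in> graded 0" "Y \<in> graded 1" for X Y
    using graded_lie_bracket[OF that] by simp
  then have "is_lie_ideal n (graded 1) (graded 0)"
    unfolding is_lie_ideal_def using is_subspace_graded sub by blast
  moreover have "\<exists>m. lower_central n (graded 1) m = {0\<^sub>m (2 * n) (2 * n)}"
  proof -
    obtain m :: nat where "graded (int m + 1) = {0\<^sub>m (2 * n) (2 * n)}" using graded_large by blast
    moreover have "0\<^sub>m (2 * n) (2 * n) \<in> lower_central n (graded 1) m"
      by (cases m) (auto simp: zero_in_subspace_hull is_subspaceD(2)[OF is_subspace_graded])
    ultimately show ?thesis using lower_central_graded[of m] by blast
  qed
  ultimately show ?thesis unfolding is_nilpotent_ideal_def by blast
qed

subsection \<open>Maximality\<close>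

definition diag_sp :: "(nat \<Rightarrow> complex) \<Rightarrow> complex mat" where
  "diag_sp h = mat (2 * n) (2 * n) (\<lambda>(i, j). if i = j then h i else 0)"

lemma diag_sp_in_graded_0:
  assumes "\<And>i. i < 2 * n \<Longrightarrow> h (dual n i) = - h i"
  shows "diag_sp h \<in> graded 0"
proof (rule gradedI)
  show "diag_sp h \<in> sp n"
    unfolding sp_iff diag_sp_def using assms by (auto simp: dual_inj)
qed (auto simp: diag_sp_def)

lemma lie_bracket_diag:
  assumes D: "D \<in> carrier_mat N N" "\<And>i j. i < N \<Longrightarrow> j < N \<Longrightarrow> i \<noteq> j \<Longrightarrow> D $$ (i, j) = 0"
    and X: "X \<in> carrier_mat N N" and ij: "i < N" "j < N"
  shows "lie_bracket D X $$ (i, j) = (D $$ (i, i) - D $$ (j, j)) * X $$ (i, j)"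
proof -
  have "(\<Sum>l = 0..<N. D $$ (i, l) * X $$ (l, j)) = (\<Sum>l = 0..<N. if l = i then D $$ (i, i) * X $$ (i, j) else 0)"
    using D(2)[OF ij(1)] by (intro sum.cong) auto
  moreover have "(\<Sum>l = 0..<N. X $$ (i, l) * D $$ (l, j)) = (\<Sum>l = 0..<N. if l = j then X $$ (i, j) * D $$ (j, j) else 0)"
    using D(2)[OF _ ij(2)] by (intro sum.cong) auto
  ultimately show ?thesis using ij by (simp add: lie_bracket_index[OF D(1) X] algebra_simps)
qed

context
  fixes \<aa> :: "complex mat set"
  assumes ideal: "is_lie_ideal n \<aa> (graded 0)"
begin

lemma ideal_subspace: "is_subspace n \<aa>" and ideal_sub: "\<aa> \<subseteq> graded 0"
  and ideal_bracket: "X \<in> graded 0 \<Longrightarrow> Y \<in> \<aa> \<Longrightarrow> lie_bracket X Y \<in> \<aa>"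
  using ideal unfolding is_lie_ideal_def by auto

lemma ideal_carrier: "X \<in> \<aa> \<Longrightarrow> X \<in> carrier_mat (2 * n) (2 * n)"
  using ideal_sub gradedD(2) by blast

text \<open>An ideal is stable under \<open>ad H\<close> for diagonal \<open>H\<close>, hence under polynomials in \<open>ad H\<close>.\<close>
lemma ideal_polynomial_filter:
  fixes h :: "nat \<Rightarrow> complex"
  assumes h: "\<And>i. i < 2 * n \<Longrightarrow> h (dual n i) = - h i" and X: "X \<in> \<aa>" and E: "finite E"
  shows "\<exists>X'\<in>\<aa>. \<forall>i<2 * n. \<forall>j<2 * n. X' $$ (i, j) = (\<Prod>e\<in>E. h i - h j - e) * X $$ (i, j)"
  using E
proof (induction E rule: finite_induct)
  case empty
  then show ?case using X by auto
next
  case (insert e E)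
  then obtain X' where X': "X' \<in> \<aa>"
      "\<forall>i<2 * n. \<forall>j<2 * n. X' $$ (i, j) = (\<Prod>e\<in>E. h i - h j - e) * X $$ (i, j)" by blast
  let ?D = "diag_sp h"
  have D: "?D \<in> graded 0" using h by (rule diag_sp_in_graded_0)
  let ?X = "lie_bracket ?D X' + (- e) \<cdot>\<^sub>m X'"
  have "?X \<in> \<aa>"
    using ideal_bracket[OF D X'(1)] X'(1) is_subspaceD[OF ideal_subspace] by blast
  moreover have "?X $$ (i, j) = (\<Prod>e\<in>insert e E. h i - h j - e) * X $$ (i, j)" if ij: "i < 2 * n" "j < 2 * n" for i j
  proof -
    have "lie_bracket ?D X' $$ (i, j) = (h i - h j) * X' $$ (i, j)"
      using lie_bracket_diag[OF gradedD(2)[OF D] _ ideal_carrier[OF X'(1)] ij] ij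
      by (simp add: diag_sp_def)
    then have "?X $$ (i, j) = (h i - h j - e) * X' $$ (i, j)"
      using ij ideal_carrier[OF X'(1)] lie_bracket_carrier[OF gradedD(2)[OF D] ideal_carrier[OF X'(1)]]
      by (simp add: algebra_simps)
    then show ?thesis using insert.hyps X'(2) ij by simp
  qed
  ultimately show ?case by blast
qed

text \<open>Annihilating all other eigenvalues of \<open>ad H\<close> projects an element of the ideal, up to a scalar, to
  its component of eigenvalue \<open>w\<close>.\<close>
lemma ideal_eigencomponent:
  fixes h :: "nat \<Rightarrow> complex"
  assumes h: "\<And>i. i < 2 * n \<Longrightarrow> h (dual n i) = - h i" and X: "X \<in> \<aa>"
  shows "\<exists>X'\<in>\<aa>. \<exists>c. c \<noteq> 0 \<and> (\<forall>i<2 * n. \<forall>j<2 * n.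
     X' $$ (i, j) = (if h i - h j = w then c * X $$ (i, j) else 0))"
proof -
  let ?E = "(\<lambda>(i, j). h i - h j) ` ({..<2 * n} \<times> {..<2 * n}) - {w}"
  obtain X' where X': "X' \<in> \<aa>"
      "\<forall>i<2 * n. \<forall>j<2 * n. X' $$ (i, j) = (\<Prod>e\<in>?E. h i - h j - e) * X $$ (i, j)"
    using ideal_polynomial_filter[of h X ?E, OF h X] by auto
  have "(\<Prod>e\<in>?E. h i - h j - e) = (if h i - h j = w then \<Prod>e\<in>?E. w - e else 0)"
    if "i < 2 * n" "j < 2 * n" for i j
  proof (cases "h i - h j = w")
    case False
    then have "h i - h j \<in> ?E" using that by auto
    then show ?thesis using False by (auto intro!: prod_zero)
  qed auto
  moreover have "(\<Prod>e\<in>?E. w - e) \<noteq> 0" by (auto simp: prod_zero_iff)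
  ultimately show ?thesis using X' by (intro bexI[of _ X'] exI[of _ "\<Prod>e\<in>?E. w - e"]) auto
qed

text \<open>A nonzero diagonal \<open>D\<close> acts on some long root vector \<open>E\<close> of \<open>graded 0\<close> by a nonzero scalar, so \<open>E\<close>
  would lie in every term of the lower central series.\<close>
lemma nilpotent_ideal_no_diagonal:
  assumes nil: "lower_central n \<aa> m = {0\<^sub>m (2 * n) (2 * n)}"
    and D: "D \<in> \<aa>" "\<And>i j. i < 2 * n \<Longrightarrow> j < 2 * n \<Longrightarrow> i \<noteq> j \<Longrightarrow> D $$ (i, j) = 0"
    and i: "i < 2 * n"
  shows "D $$ (i, i) = 0"
proof (rule ccontr)
  assume ne: "D $$ (i, i) \<noteq> 0"
  have Dsp: "D \<in> sp n" using D ideal_sub gradedD(1) by blast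
  have Dd: "D $$ (dual n q, dual n q) = - D $$ (q, q)" if "q < 2 * n" for q
    using sp_dual_entry[OF Dsp that that] by simp
  obtain q where q: "q < 2 * n" "D $$ (q, q) \<noteq> 0" "0 \<le> g q"
  proof (cases "0 \<le> g i")
    case False
    then show thesis using that[of "dual n i"] Dd[OF i] g_dual[OF i] ne i by simp
  qed (use that i ne in blast)
  \<comment> \<open>The long root vector at \<open>q\<close> is an eigenvector of \<open>D\<close> with eigenvalue \<open>2 D\<^sub>q\<^sub>q\<close>.\<close>
  define E where "E = mat (2 * n) (2 * n) (\<lambda>(a, b). if a = q \<and> b = dual n q then 1 else 0 :: complex)"
  have E: "E \<in> graded 0"
  proof (rule gradedI)
    show "E \<in> sp n"
      unfolding sp_iff
    proof (intro conjI allI impI)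
      fix a b assume ab: "a < 2 * n" "b < 2 * n"
      then show "E $$ (dual n b, dual n a) = - form_sign n a * form_sign n b * E $$ (a, b)"
        using q(1) dual_dual by (auto simp: E_def dual_inj)
    qed (simp add: E_def)
    fix a b assume "a < 2 * n" "b < 2 * n" "g a < g b + 0"
    then show "E $$ (a, b) = 0" using q g_dual[OF q(1)] by (auto simp: E_def)
  qed
  have Ec: "E \<in> carrier_mat (2 * n) (2 * n)" by (simp add: E_def)
  have br: "lie_bracket D E = (2 * D $$ (q, q)) \<cdot>\<^sub>m E"
  proof (rule eq_matI)
    fix a b assume "a < dim_row ((2 * D $$ (q, q)) \<cdot>\<^sub>m E)" "b < dim_col ((2 * D $$ (q, q)) \<cdot>\<^sub>m E)"
    then have ab: "a < 2 * n" "b < 2 * n" by (auto simp: E_def)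
    show "lie_bracket D E $$ (a, b) = ((2 * D $$ (q, q)) \<cdot>\<^sub>m E) $$ (a, b)"
      using lie_bracket_diag[OF ideal_carrier[OF D(1)] D(2) Ec ab] ab Dd[OF q(1)]
      by (auto simp: E_def)
  qed (use Ec lie_bracket_carrier[OF ideal_carrier[OF D(1)] Ec] in auto)
  have scale: "inverse (2 * D $$ (q, q)) \<cdot>\<^sub>m lie_bracket D E = E"
    unfolding br using q(2) Ec by (intro eq_matI) auto
  have "lie_bracket E D = (-1) \<cdot>\<^sub>m lie_bracket D E"
    using ideal_carrier[OF D(1)] Ec unfolding lie_bracket_def by (intro eq_matI) auto
  then have "lie_bracket D E = (-1) \<cdot>\<^sub>m lie_bracket E D"
    using lie_bracket_carrier[OF ideal_carrier[OF D(1)] Ec] by (intro eq_matI) auto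
  then have "lie_bracket D E \<in> \<aa>"
    using ideal_bracket[OF E D(1)] is_subspaceD(4)[OF ideal_subspace] by metis
  then have Ea: "E \<in> \<aa>" using is_subspaceD(4)[OF ideal_subspace] scale by metis
  have "E \<in> lower_central n \<aa> m" for m
  proof (induction m)
    case (Suc m)
    have "lie_bracket D E \<in> lower_central n \<aa> (Suc m)"
      using D(1) Suc by (auto intro!: hull_inc)
    then have "inverse (2 * D $$ (q, q)) \<cdot>\<^sub>m lie_bracket D E \<in> lower_central n \<aa> (Suc m)"
      by (simp add: smult_in_subspace_hull)
    then show ?case by (simp only: scale)
  qed (simp add: Ea)
  then have "E = 0\<^sub>m (2 * n) (2 * n)" using nil by blast
  then have "E $$ (q, dual n q) = 0" using q by simp
  then show False using q by (simp add: E_def)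
qed

text \<open>An element with a nonzero entry of degree 0 is projected to its degree 0 part and then to an
  eigencomponent \<open>Z\<close> of a regular diagonal element. Either \<open>Z\<close> is diagonal, or its conjugate transpose
  lies in \<open>graded 0\<close> and the bracket of the two is a nonzero diagonal element of the ideal.\<close>
lemma nilpotent_ideal_subset:
  assumes nil: "lower_central n \<aa> m = {0\<^sub>m (2 * n) (2 * n)}"
  shows "\<aa> \<subseteq> graded 1"
proof
  fix X assume X: "X \<in> \<aa>"
  have Xsp: "X \<in> sp n" using X ideal_sub gradedD(1) by blast
  have zero: "X $$ (p, q) = 0" if pq: "p < 2 * n" "q < 2 * n" "g p = g q" for p q
  proof (rule ccontr)
    assume ne: "X $$ (p, q) \<noteq> 0"
    let ?g = "\<lambda>i. of_int (g i) :: complex"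
    \<comment> \<open>a Cartan element with pairwise distinct diagonal entries\<close>
    define h where "h i = (of_int (if i < n then int i + 1 else - int (i - n) - 1) :: complex)" for i
    have h_dual: "h (dual n i) = - h i" if "i < 2 * n" for i
      using that by (auto simp: h_def dual_def)
    have h_inj: "i = j" if "i < 2 * n" "j < 2 * n" "h i = h j" for i j
      using that unfolding h_def of_int_eq_iff by (auto split: if_splits)
    have g_dual': "?g (dual n i) = - ?g i" if "i < 2 * n" for i using g_dual[OF that] by simp
    obtain X\<^sub>1 c\<^sub>1 where X1: "X\<^sub>1 \<in> \<aa>" "c\<^sub>1 \<noteq> 0"
        "\<forall>i<2 * n. \<forall>j<2 * n. X\<^sub>1 $$ (i, j) = (if ?g i - ?g j = 0 then c\<^sub>1 * X $$ (i, j) else 0)"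
      using ideal_eigencomponent[of ?g X 0, OF g_dual' X] by blast
    define w where "w = h p - h q"
    obtain Z c\<^sub>2 where Z: "Z \<in> \<aa>" "c\<^sub>2 \<noteq> 0"
        "\<forall>i<2 * n. \<forall>j<2 * n. Z $$ (i, j) = (if h i - h j = w then c\<^sub>2 * X\<^sub>1 $$ (i, j) else 0)"
      using ideal_eigencomponent[of h X\<^sub>1 w, OF h_dual X1(1)] by blast
    have Zpq: "Z $$ (p, q) \<noteq> 0" using Z X1 pq ne w_def by simp
    have Zsupp: "h i - h j = w" "g i = g j" if "i < 2 * n" "j < 2 * n" "Z $$ (i, j) \<noteq> 0" for i j
    proof -
      have Zij: "Z $$ (i, j) = (if h i - h j = w then c\<^sub>2 * X\<^sub>1 $$ (i, j) else 0)" using Z(3) that by blast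
      then show "h i - h j = w" using that(3) by argo
      then have "X\<^sub>1 $$ (i, j) \<noteq> 0" using Zij that(3) by auto
      moreover have "X\<^sub>1 $$ (i, j) = (if ?g i - ?g j = 0 then c\<^sub>1 * X $$ (i, j) else 0)" using X1(3) that by blast
      ultimately have "?g i - ?g j = 0" by argo
      then show "g i = g j" by simp
    qed
    have Zsp: "Z \<in> sp n" and Zc: "Z \<in> carrier_mat (2 * n) (2 * n)"
      using Z ideal_sub gradedD(1) ideal_carrier by blast+
    show False
    proof (cases "w = 0")
      case True
      have "Z $$ (i, j) = 0" if "i < 2 * n" "j < 2 * n" "i \<noteq> j" for i j
        using Zsupp[OF that(1,2)] h_inj[OF that(1,2)] that(3) True by auto
      moreover have "p = q" using True h_inj[OF pq(1,2)] w_def by simp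
      ultimately show False using nilpotent_ideal_no_diagonal[OF nil Z(1) _ pq(1)] Zpq by simp
    next
      case False
      define Y where "Y = mat (2 * n) (2 * n) (\<lambda>(i, j). cnj (Z $$ (j, i)))"
      have Yc: "Y \<in> carrier_mat (2 * n) (2 * n)" by (simp add: Y_def)
      have Yij: "Y $$ (i, j) = cnj (Z $$ (j, i))" if "i < 2 * n" "j < 2 * n" for i j
        using that by (simp add: Y_def)
      have Y: "Y \<in> graded 0"
      proof (rule gradedI)
        have "Y $$ (dual n j, dual n i) = - form_sign n i * form_sign n j * Y $$ (i, j)"
          if "i < 2 * n" "j < 2 * n" for i j
          unfolding Yij[OF dual_less[OF that(2)] dual_less[OF that(1)]] Yij[OF that]
            sp_dual_entry[OF Zsp that(2,1)] by (simp add: mult_ac)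
        then show "Y \<in> sp n" using Yc unfolding sp_iff by blast
        fix i j assume "i < 2 * n" "j < 2 * n" "g i < g j + 0"
        then show "Y $$ (i, j) = 0" using Zsupp(2)[of j i] by (auto simp: Yij)
      qed
      let ?D = "lie_bracket Y Z"
      have Da: "?D \<in> \<aa>" using ideal_bracket[OF Y Z(1)] .
      have Dij: "?D $$ (i, j) = (\<Sum>l = 0..<2 * n. cnj (Z $$ (l, i)) * Z $$ (l, j)) -
          (\<Sum>l = 0..<2 * n. Z $$ (i, l) * cnj (Z $$ (j, l)))" if "i < 2 * n" "j < 2 * n" for i j
        using that by (simp add: lie_bracket_index[OF Yc Zc] Yij)
      have Doff: "?D $$ (i, j) = 0" if ij: "i < 2 * n" "j < 2 * n" "i \<noteq> j" for i j
      proof -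
        have a: "cnj (Z $$ (l, i)) * Z $$ (l, j) = 0" if "l < 2 * n" for l
          using Zsupp(1)[OF that ij(1)] Zsupp(1)[OF that ij(2)] h_inj[OF ij(1,2)] ij(3) by force
        have b: "Z $$ (i, l) * cnj (Z $$ (j, l)) = 0" if "l < 2 * n" for l
          using Zsupp(1)[OF ij(1) that] Zsupp(1)[OF ij(2) that] h_inj[OF ij(1,2)] ij(3) by force
        have "(\<Sum>l = 0..<2 * n. cnj (Z $$ (l, i)) * Z $$ (l, j)) = 0"
          by (rule sum.neutral, rule ballI, rule a) simp
        moreover have "(\<Sum>l = 0..<2 * n. Z $$ (i, l) * cnj (Z $$ (j, l))) = 0"
          by (rule sum.neutral, rule ballI, rule b) simp
        ultimately show ?thesis using ij by (simp add: Dij)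
      qed
      have D0: "?D $$ (i, i) = 0" if "i < 2 * n" for i
        by (rule nilpotent_ideal_no_diagonal[OF nil Da Doff that])
      \<comment> \<open>The weighted trace of \<open>[Z\<^sup>*, Z]\<close> is a nonzero multiple of the squared norm of \<open>Z\<close>.\<close>
      let ?S = "\<Sum>i = 0..<2 * n. \<Sum>l = 0..<2 * n. cnj (Z $$ (l, i)) * Z $$ (l, i)"
      have "0 = (\<Sum>i = 0..<2 * n. h i * ?D $$ (i, i))" using D0 by simp
      also have "\<dots> = (\<Sum>i = 0..<2 * n. \<Sum>l = 0..<2 * n. h i * (cnj (Z $$ (l, i)) * Z $$ (l, i))) -
          (\<Sum>i = 0..<2 * n. \<Sum>l = 0..<2 * n. h i * (Z $$ (i, l) * cnj (Z $$ (i, l))))"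
        by (simp add: Dij right_diff_distrib sum_subtractf sum_distrib_left)
      also have "(\<Sum>i = 0..<2 * n. \<Sum>l = 0..<2 * n. h i * (Z $$ (i, l) * cnj (Z $$ (i, l)))) =
          (\<Sum>i = 0..<2 * n. \<Sum>l = 0..<2 * n. h l * (cnj (Z $$ (l, i)) * Z $$ (l, i)))"
        by (subst sum.swap) (simp add: mult_ac)
      also have "(\<Sum>i = 0..<2 * n. \<Sum>l = 0..<2 * n. h i * (cnj (Z $$ (l, i)) * Z $$ (l, i))) - \<dots> =
          (\<Sum>i = 0..<2 * n. \<Sum>l = 0..<2 * n. (- w) * (cnj (Z $$ (l, i)) * Z $$ (l, i)))"
        unfolding sum_subtractf[symmetric]
      proof (intro sum.cong refl)
        fix i l assume "i \<in> {0..<2 * n}" "l \<in> {0..<2 * n}"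
        then show "h i * (cnj (Z $$ (l, i)) * Z $$ (l, i)) - h l * (cnj (Z $$ (l, i)) * Z $$ (l, i)) =
            - w * (cnj (Z $$ (l, i)) * Z $$ (l, i))"
          using Zsupp(1)[of l i] by (cases "Z $$ (l, i) = 0") (auto simp: algebra_simps)
      qed
      also have "\<dots> = - w * ?S" by (simp add: sum_distrib_left)
      finally have S0: "?S = 0" using False by simp
      have eqS: "?S = of_real (\<Sum>i = 0..<2 * n. \<Sum>l = 0..<2 * n. (cmod (Z $$ (l, i)))\<^sup>2)"
        by (simp add: mult.commute complex_norm_square[symmetric])
      have "(\<Sum>i = 0..<2 * n. \<Sum>l = 0..<2 * n. (cmod (Z $$ (l, i)))\<^sup>2) = 0"
        using trans[OF eqS[symmetric] S0] by (simp only: of_real_eq_0_iff)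
      then have "(\<Sum>l = 0..<2 * n. (cmod (Z $$ (l, q)))\<^sup>2) = 0"
        using pq(2) by (subst (asm) sum_nonneg_eq_0_iff) (auto intro: sum_nonneg)
      then have "(cmod (Z $$ (p, q)))\<^sup>2 = 0"
        using pq(1) by (subst (asm) sum_nonneg_eq_0_iff) auto
      then show False using Zpq by simp
    qed
  qed
  show "X \<in> graded 1"
  proof (rule gradedI[OF Xsp])
    fix i j assume ij: "i < 2 * n" "j < 2 * n" "g i < g j + 1"
    have "X \<in> graded 0" using X ideal_sub by blast
    then show "X $$ (i, j) = 0"
      using gradedD(3)[of X 0 i j] zero[OF ij(1,2)] ij by (cases "g i = g j") auto
  qed
qed

end

lemma nilradical_graded: "nilradical n (graded 0) = graded 1"
  unfolding nilradical_def
proof (rule the_equality)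
  have max: "\<aa> \<subseteq> graded 1" if "is_nilpotent_ideal n \<aa> (graded 0)" for \<aa>
    using that nilpotent_ideal_subset unfolding is_nilpotent_ideal_def by blast
  then show "is_nilpotent_ideal n (graded 1) (graded 0) \<and>
      (\<forall>\<aa>. is_nilpotent_ideal n \<aa> (graded 0) \<longrightarrow> \<aa> \<subseteq> graded 1)"
    using graded_1_nilpotent_ideal by blast
  fix \<uu> assume "is_nilpotent_ideal n \<uu> (graded 0) \<and>
      (\<forall>\<aa>. is_nilpotent_ideal n \<aa> (graded 0) \<longrightarrow> \<aa> \<subseteq> \<uu>)"
  then show "\<uu> = graded 1" using max graded_1_nilpotent_ideal by blast
qed

end

section \<open>Roots of the symplectic Lie algebra\<close>

text \<open>The weight of the \<open>i\<close>-th basis vector: matrix indices start at 0, coordinates of weights at 1.\<close>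
definition index_weight :: "nat \<Rightarrow> nat \<Rightarrow> weight" where
  "index_weight n i = (\<lambda>l. if i < n then eps (i + 1) l else - eps (i - n + 1) l)"

text \<open>The sum of the first \<open>m\<close> coordinates of the weight of the \<open>i\<close>-th basis vector.\<close>
definition prefix_sign :: "nat \<Rightarrow> nat \<Rightarrow> nat \<Rightarrow> int" where
  "prefix_sign n m i = (if i < n then of_bool (i < m) else - of_bool (i - n < m))"

lemma index_weight_outside: "i < 2 * n \<Longrightarrow> l \<notin> {1..n} \<Longrightarrow> index_weight n i l = 0"
  by (auto simp: index_weight_def eps_def)

lemma index_weight_inj:
  assumes "i < 2 * n" "j < 2 * n" "index_weight n i = index_weight n j"
  shows "i = j"
proof -
  have "index_weight n i (if i < n then i + 1 else i - n + 1) = index_weight n j (if i < n then i + 1 else i - n + 1)"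
    using assms(3) by simp
  then show ?thesis using assms(1,2) by (auto simp: index_weight_def eps_def split: if_splits)
qed

lemma sum_index_weight:
  assumes "m \<le> n"
  shows "(\<Sum>a = 1..m. index_weight n i a) = of_int (prefix_sign n m i)"
proof -
  have "(\<Sum>a = 1..m. eps l a) = of_bool (l \<in> {1..m})" for l
    unfolding eps_def by (simp add: sum.delta)
  then show ?thesis by (auto simp: index_weight_def prefix_sign_def sum_negf)
qed

lemma sum_simple_root:
  assumes "1 \<le> m" "m \<le> n" "1 \<le> l" "l \<le> n"
  shows "(\<Sum>a = 1..m. simple_root n l a) = (if l = m then if m < n then 1 else 2 else 0)"
proof -
  have "(\<Sum>a = 1..m. eps l a) = of_bool (l \<in> {1..m})" for l
    unfolding eps_def by (simp add: sum.delta)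
  then show ?thesis
    using assms by (auto simp: simple_root_def sum_subtractf sum_distrib_left[symmetric])
qed

lemma simple_root_inj: "inj_on (simple_root n) {1..n}"
proof (rule linorder_inj_onI)
  fix l m assume "l < m" "l \<in> {1..n}" "m \<in> {1..n}"
  then have "simple_root n l l = 1" "simple_root n m l = 0"
    by (auto simp: simple_root_def eps_def)
  then show "simple_root n l \<noteq> simple_root n m" by auto
qed auto

text \<open>Abel summation: the coefficients are the partial sums of the coordinates, halved at the long root.\<close>
lemma simple_root_expansion:
  assumes n: "1 \<le> n" and z: "\<And>l. l \<notin> {1..n} \<Longrightarrow> \<beta> l = 0"
    and c: "\<And>m. m < n \<Longrightarrow> c m = (\<Sum>a = 1..m. \<beta> a)" "2 * c n = (\<Sum>a = 1..n. \<beta> a)"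
  shows "\<beta> l = (\<Sum>m = 1..n. c m * simple_root n m l)"
proof -
  have "(\<Sum>m = 1..n. c m * simple_root n m l) = (\<Sum>m = 1..<n. c m * simple_root n m l) + 2 * c n * eps n l"
  proof -
    have "{1..n} = insert n {1..<n}" using n by auto
    then show ?thesis by (simp add: simple_root_def)
  qed
  also have "(\<Sum>m = 1..<n. c m * simple_root n m l) =
      (\<Sum>m = 1..<n. if m = l then c l else 0) - (\<Sum>m = 1..<n. if m = l - 1 \<and> 1 \<le> l then c (l - 1) else 0)"
    unfolding sum_subtractf[symmetric]
    by (intro sum.cong) (auto simp: simple_root_def eps_def)
  also have "(\<Sum>m = 1..<n. if m = l then c l else 0) = (if l \<in> {1..<n} then c l else 0)" by simp
  also have "(\<Sum>m = 1..<n. if m = l - 1 \<and> 1 \<le> l then c (l - 1) else 0) = (if l \<in> {2..n} then c (l - 1) else 0)"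
  proof (cases "1 \<le> l")
    case True
    then have "(\<Sum>m = 1..<n. if m = l - 1 \<and> 1 \<le> l then c (l - 1) else 0) = (\<Sum>m = 1..<n. if m = l - 1 then c (l - 1) else 0)"
      by simp
    then show ?thesis by auto
  qed simp
  also have "(if l \<in> {1..<n} then c l else 0) - (if l \<in> {2..n} then c (l - 1) else 0) + 2 * c n * eps n l = \<beta> l"
  proof (cases "l \<in> {1..n}")
    case True
    then have l: "{1..l} = insert l {1..l - 1}" "l \<notin> {1..l - 1}" by auto
    have s: "(\<Sum>a = 1..l. \<beta> a) = \<beta> l + (\<Sum>a = 1..l - 1. \<beta> a)"
      unfolding l(1) using l(2) by (intro sum.insert) auto
    show ?thesis
    proof (cases "l = n")
      case l: True
      then show ?thesis using s c(1)[of "n - 1"] c(2) n by (auto simp: eps_def)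
    next
      case False
      then show ?thesis using True s c(1)[of l] c(1)[of "l - 1"] by (auto simp: eps_def)
    qed
  qed (use z n in \<open>auto simp: eps_def\<close>)
  finally show ?thesis by simp
qed

definition root_coeff :: "nat \<Rightarrow> nat \<Rightarrow> nat \<Rightarrow> nat \<Rightarrow> int" where
  "root_coeff n i j m =
     (if m < n then prefix_sign n m i - prefix_sign n m j else of_bool (i < n) - of_bool (j < n))"

lemma index_weight_diff_expansion:
  assumes n: "1 \<le> n" and ij: "i < 2 * n" "j < 2 * n"
  shows "index_weight n i l - index_weight n j l = (\<Sum>m = 1..n. of_int (root_coeff n i j m) * simple_root n m l)"
proof (rule simple_root_expansion[OF n])
  fix m assume "m < n"
  then show "of_int (root_coeff n i j m) = (\<Sum>a = 1..m. index_weight n i a - index_weight n j a)"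
    unfolding sum_subtractf using sum_index_weight[of m n i] sum_index_weight[of m n j]
    by (simp add: root_coeff_def)
next
  show "2 * of_int (root_coeff n i j n) = (\<Sum>a = 1..n. index_weight n i a - index_weight n j a)"
    unfolding sum_subtractf sum_index_weight[OF order_refl]
    using ij by (auto simp: root_coeff_def prefix_sign_def)
qed (use ij in \<open>simp add: index_weight_outside\<close>)

text \<open>The prefix sums of the weights are monotone along the order
  \<open>e\<^sub>1, \<dots>, e\<^sub>n, - e\<^sub>n, \<dots>, - e\<^sub>1\<close>.\<close>
lemma root_coeff_sign:
  assumes "i < 2 * n" "j < 2 * n"
  shows "(\<forall>m\<le>n. 0 \<le> root_coeff n i j m) \<or> (\<forall>m\<le>n. root_coeff n i j m \<le> 0)"
  using assms
  by (cases "i < n"; cases "j < n"; cases "i \<le> j") (auto simp: root_coeff_def prefix_sign_def)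

lemma weight_value_index_weight:
  assumes H: "H \<in> cartan n" and i: "i < 2 * n"
  shows "weight_value n (index_weight n i) H = H $$ (i, i)"
proof -
  have Hsp: "H \<in> sp n" using H by (simp add: cartan_def)
  show ?thesis
  proof (cases "i < n")
    case True
    then have "weight_value n (index_weight n i) H = (\<Sum>l = 1..n. if l = i + 1 then H $$ (i, i) else 0)"
      unfolding weight_value_def by (intro sum.cong) (auto simp: index_weight_def eps_def)
    then show ?thesis using True by simp
  next
    case False
    then have "weight_value n (index_weight n i) H = (\<Sum>l = 1..n. if l = i - n + 1 then - H $$ (i - n, i - n) else 0)"
      unfolding weight_value_def by (intro sum.cong) (auto simp: index_weight_def eps_def)
    moreover have "H $$ (i - n, i - n) = - H $$ (i, i)"
      using sp_dual_entry[OF Hsp i i] False by (simp add: dual_def)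
    ultimately show ?thesis using False i by simp
  qed
qed

lemma weight_value_diff:
  "weight_value n (\<lambda>l. \<beta> l - \<gamma> l) H = weight_value n \<beta> H - weight_value n \<gamma> H"
  unfolding weight_value_def by (simp add: left_diff_distrib sum_subtractf)

lemma cartan_index_weight_diag:
  assumes "1 \<le> a" "a \<le> n"
  shows "mat (2 * n) (2 * n) (\<lambda>(i, j). if i = j then index_weight n i a else 0) \<in> cartan n"
proof -
  have "index_weight n (dual n i) a = - index_weight n i a" if "i < 2 * n" for i
    using that by (auto simp: index_weight_def dual_def)
  then show ?thesis
    unfolding cartan_def diagonal_mat_def by (auto simp: sp_iff dual_inj)
qed

lemma lie_bracket_cartan_index:
  assumes H: "H \<in> cartan n" and X: "X \<in> carrier_mat (2 * n) (2 * n)" and ij: "i < 2 * n" "j < 2 * n"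
  shows "lie_bracket H X $$ (i, j) = (H $$ (i, i) - H $$ (j, j)) * X $$ (i, j)"
proof -
  interpret symplectic_grading n "\<lambda>_. 0" by unfold_locales simp
  have "H \<in> carrier_mat (2 * n) (2 * n)" using H sp_carrier by (simp add: cartan_def)
  moreover from this have "H $$ (i, j) = 0" if "i < 2 * n" "j < 2 * n" "i \<noteq> j" for i j
    using H that unfolding cartan_def diagonal_mat_def by auto
  ultimately show ?thesis using lie_bracket_diag[of H "2 * n" X i j] X ij by blast
qed

text \<open>A root vector can only have entries at positions whose difference of weights is its root, as the
  coordinate elements of the Cartan subalgebra show.\<close>
lemma root_space_nonzero_entry:
  assumes X: "X \<in> root_space n \<beta>" and ij: "i < 2 * n" "j < 2 * n" "X $$ (i, j) \<noteq> 0" and a: "a \<in> {1..n}"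
  shows "\<beta> a = index_weight n i a - index_weight n j a"
proof -
  have Xc: "X \<in> carrier_mat (2 * n) (2 * n)" using X sp_carrier by (simp add: root_space_def)
  define H where "H = mat (2 * n) (2 * n) (\<lambda>(i, j). if i = j then index_weight n i a else 0)"
  have H: "H \<in> cartan n" unfolding H_def using a by (intro cartan_index_weight_diag) auto
  have Hd: "H $$ (q, q) = index_weight n q a" if "q < 2 * n" for q using that by (simp add: H_def)
  have "lie_bracket H X $$ (i, j) = (weight_value n \<beta> H \<cdot>\<^sub>m X) $$ (i, j)"
    using X H by (simp add: root_space_def)
  then have "(index_weight n i a - index_weight n j a) * X $$ (i, j) = weight_value n \<beta> H * X $$ (i, j)"
    using ij Xc Hd by (simp add: lie_bracket_cartan_index[OF H Xc])
  moreover have "weight_value n \<beta> H = (\<Sum>l = 1..n. if l = a then \<beta> a else 0)"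
    unfolding weight_value_def
  proof (intro sum.cong refl)
    fix l assume l: "l \<in> {1..n}"
    then have "H $$ (l - 1, l - 1) = (if l = a then 1 else 0)"
      using Hd[of "l - 1"] by (auto simp: index_weight_def eps_def)
    then show "\<beta> l * H $$ (l - 1, l - 1) = (if l = a then \<beta> a else 0)" by simp
  qed
  ultimately show ?thesis using ij a by simp
qed

text \<open>The part of \<open>X\<close> at the positions \<open>(i, j)\<close> and \<open>(j\<^sup>*, i\<^sup>*)\<close>, doubled if they coincide. In this
  way every position occurs exactly twice when \<open>i\<close> and \<open>j\<close> run over all indices.\<close>
definition root_vector :: "nat \<Rightarrow> complex mat \<Rightarrow> nat \<Rightarrow> nat \<Rightarrow> complex mat" where
  "root_vector n X i j = mat (2 * n) (2 * n) (\<lambda>(a, b).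
     (if a = i \<and> b = j then X $$ (a, b) else 0) +
     (if a = dual n j \<and> b = dual n i then X $$ (a, b) else 0))"

lemma root_vector_sp:
  assumes X: "X \<in> sp n" and ij: "i < 2 * n" "j < 2 * n"
  shows "root_vector n X i j \<in> sp n"
  unfolding sp_iff
proof (intro conjI allI impI)
  fix a b assume ab: "a < 2 * n" "b < 2 * n"
  have eq: "dual n b = dual n j \<and> dual n a = dual n i \<longleftrightarrow> a = i \<and> b = j"
      "dual n b = i \<and> dual n a = j \<longleftrightarrow> a = dual n j \<and> b = dual n i"
    using ab ij by (metis dual_dual)+
  show "root_vector n X i j $$ (dual n b, dual n a) =
      - form_sign n a * form_sign n b * root_vector n X i j $$ (a, b)"
  proof -
    let ?T = "X $$ (dual n b, dual n a)"
    have "root_vector n X i j $$ (dual n b, dual n a) =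
        (if dual n b = i \<and> dual n a = j then ?T else 0) +
        (if dual n b = dual n j \<and> dual n a = dual n i then ?T else 0)"
      unfolding root_vector_def using ab by (subst index_mat) auto
    also have "\<dots> = - form_sign n a * form_sign n b *
        ((if a = i \<and> b = j then X $$ (a, b) else 0) +
         (if a = dual n j \<and> b = dual n i then X $$ (a, b) else 0))"
    proof -
      have "(if Q then c * x else 0) + (if P then c * x else 0) =
          c * ((if P then x else 0) + (if Q then x else 0))" for P Q and c x :: complex
        by (simp add: distrib_left)
      then show ?thesis unfolding eq sp_dual_entry[OF X ab] by blast
    qed
    finally show ?thesis using ab by (simp add: root_vector_def)
  qed
qed (simp add: root_vector_def)

lemma root_vector_root_space:
  assumes X: "X \<in> sp n" and ij: "i < 2 * n" "j < 2 * n"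
  shows "root_vector n X i j \<in> root_space n (\<lambda>l. index_weight n i l - index_weight n j l)"
proof -
  let ?M = "root_vector n X i j" and ?\<beta> = "\<lambda>l. index_weight n i l - index_weight n j l"
  have Mc: "?M \<in> carrier_mat (2 * n) (2 * n)" by (simp add: root_vector_def)
  have "lie_bracket H ?M = weight_value n ?\<beta> H \<cdot>\<^sub>m ?M"
    if H: "H \<in> cartan n" for H
  proof (rule eq_matI)
    fix a b assume "a < dim_row (weight_value n ?\<beta> H \<cdot>\<^sub>m ?M)"
      "b < dim_col (weight_value n ?\<beta> H \<cdot>\<^sub>m ?M)"
    then have ab: "a < 2 * n" "b < 2 * n" using Mc by auto
    have Hsp: "H \<in> sp n" using H by (simp add: cartan_def)
    have wv: "weight_value n ?\<beta> H = H $$ (i, i) - H $$ (j, j)"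
      by (simp add: weight_value_diff weight_value_index_weight[OF H] ij)
    have Hd: "H $$ (dual n q, dual n q) = - H $$ (q, q)" if "q < 2 * n" for q
      using sp_dual_entry[OF Hsp that that] by simp
    show "lie_bracket H ?M $$ (a, b) = (weight_value n ?\<beta> H \<cdot>\<^sub>m ?M) $$ (a, b)"
      unfolding wv lie_bracket_cartan_index[OF H Mc ab]
      using ab Mc Hd[OF ij(1)] Hd[OF ij(2)] by (auto simp: root_vector_def)
  qed (use Mc lie_bracket_carrier[of H "2 * n" ?M] H sp_carrier in \<open>auto simp: cartan_def\<close>)
  then show ?thesis using root_vector_sp[OF assms] by (simp add: root_space_def)
qed

lemma subspace_sum:
  assumes V: "is_subspace n V" and A: "finite A" "\<And>x. x \<in> A \<Longrightarrow> F x \<in> V"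
  shows "mat (2 * n) (2 * n) (\<lambda>ab. \<Sum>x\<in>A. F x $$ ab) \<in> V"
  using A
proof (induction A rule: finite_induct)
  case empty
  have "mat (2 * n) (2 * n) (\<lambda>ab. \<Sum>x\<in>{}. F x $$ ab) = 0\<^sub>m (2 * n) (2 * n)" by (intro eq_matI) auto
  then show ?case using is_subspaceD(2)[OF V] by simp
next
  case (insert x A)
  have c: "F x \<in> carrier_mat (2 * n) (2 * n)" using insert.prems is_subspaceD(1)[OF V] by blast
  have "F x + mat (2 * n) (2 * n) (\<lambda>ab. \<Sum>x\<in>A. F x $$ ab) \<in> V"
    using insert by (intro is_subspaceD(3)[OF V]) auto
  also have "F x + mat (2 * n) (2 * n) (\<lambda>ab. \<Sum>x\<in>A. F x $$ ab) = mat (2 * n) (2 * n) (\<lambda>ab. \<Sum>x\<in>insert x A. F x $$ ab)"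
    using insert.hyps c by (intro eq_matI) auto
  finally show ?case .
qed

lemma sp_root_vector_decomposition:
  assumes X: "X \<in> sp n" and V: "is_subspace n V"
    and M: "\<And>i j. i < 2 * n \<Longrightarrow> j < 2 * n \<Longrightarrow> root_vector n X i j \<in> V"
  shows "X \<in> V"
proof -
  let ?A = "{0..<2 * n} \<times> {0..<2 * n}"
  let ?S = "mat (2 * n) (2 * n) (\<lambda>ab. \<Sum>(i, j)\<in>?A. root_vector n X i j $$ ab)"
  have "mat (2 * n) (2 * n) (\<lambda>ab. \<Sum>x\<in>?A. (case x of (i, j) \<Rightarrow> root_vector n X i j) $$ ab) \<in> V"
    using M by (intro subspace_sum[OF V]) auto
  then have S: "?S \<in> V" by (simp add: case_prod_unfold)
  have "(1 / 2) \<cdot>\<^sub>m ?S = X"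
  proof (rule eq_matI)
    fix a b assume "a < dim_row X" "b < dim_col X"
    then have ab: "a < 2 * n" "b < 2 * n" using sp_carrier[OF X] by auto
    have "(\<Sum>(i, j)\<in>?A. root_vector n X i j $$ (a, b)) =
        (\<Sum>i = 0..<2 * n. \<Sum>j = 0..<2 * n. (if j = b then if i = a then X $$ (a, b) else 0 else 0) +
          (if j = dual n a then if i = dual n b then X $$ (a, b) else 0 else 0))"
      unfolding sum.cartesian_product[symmetric]
    proof (intro sum.cong refl)
      fix i j assume "i \<in> {0..<2 * n}" "j \<in> {0..<2 * n}"
      then have "a = dual n j \<longleftrightarrow> j = dual n a" "b = dual n i \<longleftrightarrow> i = dual n b"
        using ab by auto
      then show "root_vector n X i j $$ (a, b) = (if j = b then if i = a then X $$ (a, b) else 0 else 0) +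
          (if j = dual n a then if i = dual n b then X $$ (a, b) else 0 else 0)"
        using ab by (auto simp: root_vector_def)
    qed
    also have "\<dots> = 2 * X $$ (a, b)" using ab by (simp add: sum.distrib)
    finally show "((1 / 2) \<cdot>\<^sub>m ?S) $$ (a, b) = X $$ (a, b)" using ab by simp
  qed (use sp_carrier[OF X] in auto)
  then show ?thesis using is_subspaceD(4)[OF V S, of "1 / 2"] by simp
qed

section \<open>The grading of a standard parabolic subalgebra\<close>

text \<open>The grading element is the sum of the fundamental coweights, in the basis dual to the simple roots, that
  belong to the simple roots outside \<open>I\<close>; at \<open>\<alpha>\<^sub>n\<close> twice that coweight is used. On the
  \<open>b\<close>-th block, counted from 0, its value is \<open>length ns - 1 - b\<close>.\<close>
definition type_grade :: "nat \<Rightarrow> nat list \<Rightarrow> nat \<Rightarrow> int" where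
  "type_grade n ns i = (\<Sum>t = 1..<length ns. prefix_sign n (sum_list (take t ns)) i)"

lemma prefix_sign_dual: "i < 2 * n \<Longrightarrow> prefix_sign n m (dual n i) = - prefix_sign n m i"
  by (auto simp: prefix_sign_def dual_def)

lemma sum_in_Nats:
  fixes f :: "'a \<Rightarrow> complex"
  shows "(\<And>x. x \<in> A \<Longrightarrow> f x \<in> \<nat>) \<Longrightarrow> sum f A \<in> \<nat>"
  by (induction A rule: infinite_finite_induct) auto

lemma symplectic_grading_type: "symplectic_grading n (type_grade n ns)"
  by unfold_locales (simp add: type_grade_def prefix_sign_dual sum_negf)

context
  fixes n :: nat and I :: "weight set" and ns :: "nat list"
  assumes n: "1 \<le> n" and I: "I \<subseteq> simple_roots n" and type: "parabolic_type n I ns"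
begin

interpretation symplectic_grading n "type_grade n ns" by (rule symplectic_grading_type)

abbreviation "break t \<equiv> sum_list (take t ns)"

lemma break_bounds: "1 \<le> t \<Longrightarrow> t < length ns \<Longrightarrow> 1 \<le> break t \<and> break t \<le> n"
proof -
  assume t: "1 \<le> t" "t < length ns"
  have "sum_list (take t ns) + sum_list (drop t ns) = n"
    using type by (simp add: parabolic_type_def flip: sum_list_append)
  moreover have "hd ns \<in> set (butlast ns)" using t
    by (cases ns; cases "tl ns") auto
  then have "0 < hd ns" using type by (simp add: parabolic_type_def)
  moreover have "hd ns \<le> sum_list (take t ns)" using t by (cases ns; cases t) auto
  ultimately show ?thesis by linarith
qed

lemma grade_diff_eq_weight_sum:
  assumes "\<And>a. a \<in> {1..n} \<Longrightarrow> \<beta> a = index_weight n i a - index_weight n j a"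
  shows "(\<Sum>t = 1..<length ns. \<Sum>a = 1..break t. \<beta> a) = of_int (type_grade n ns i - type_grade n ns j)"
proof -
  have "(\<Sum>a = 1..break t. \<beta> a) = of_int (prefix_sign n (break t) i - prefix_sign n (break t) j)"
    if "t \<in> {1..<length ns}" for t
  proof -
    have b: "break t \<le> n" using break_bounds that by auto
    have "(\<Sum>a = 1..break t. \<beta> a) = (\<Sum>a = 1..break t. index_weight n i a - index_weight n j a)"
      using assms b by (intro sum.cong) auto
    also have "\<dots> = of_int (prefix_sign n (break t) i - prefix_sign n (break t) j)"
      unfolding sum_subtractf sum_index_weight[OF b] by simp
    finally show ?thesis .
  qed
  then show ?thesis by (simp add: type_grade_def sum_subtractf)
qed

lemma simple_root_break_sum:
  assumes "\<alpha> \<in> simple_roots n" "1 \<le> t" "t < length ns"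
  shows "(\<Sum>a = 1..break t. \<alpha> a) \<in> \<nat>" "\<alpha> \<in> I \<Longrightarrow> (\<Sum>a = 1..break t. \<alpha> a) = 0"
proof -
  obtain m where m: "\<alpha> = simple_root n m" "1 \<le> m" "m \<le> n"
    using assms(1) by (auto simp: simple_roots_def)
  have b: "1 \<le> break t" "break t \<le> n" using break_bounds[OF assms(2,3)] by auto
  show "(\<Sum>a = 1..break t. \<alpha> a) \<in> \<nat>"
    unfolding m(1) sum_simple_root[OF b m(2,3)] by simp
  assume "\<alpha> \<in> I"
  moreover have "simple_root n (break t) \<notin> I"
    using type assms(2,3) unfolding parabolic_type_def by blast
  ultimately have "m \<noteq> break t" using m by auto
  then show "(\<Sum>a = 1..break t. \<alpha> a) = 0"
    unfolding m(1) sum_simple_root[OF b m(2,3)] by simp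
qed

lemma finite_simple_roots: "finite (simple_roots n)"
  by (simp add: simple_roots_def)

text \<open>The grading takes nonnegative values on the simple roots and vanishes on \<open>I\<close>.\<close>
lemma root_space_subset_graded:
  assumes "\<beta> \<in> positive_roots n \<union> generated_roots n I"
  shows "root_space n \<beta> \<subseteq> graded 0"
proof
  fix X assume X: "X \<in> root_space n \<beta>"
  show "X \<in> graded 0"
  proof (rule gradedI)
    show "X \<in> sp n" using X by (simp add: root_space_def)
    fix i j assume ij: "i < 2 * n" "j < 2 * n" and less: "type_grade n ns i < type_grade n ns j + 0"
    show "X $$ (i, j) = 0"
    proof (rule ccontr)
      assume ne: "X $$ (i, j) \<noteq> 0"
      have gd: "of_int (type_grade n ns i - type_grade n ns j) = (\<Sum>t = 1..<length ns. \<Sum>a = 1..break t. \<beta> a)"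
        using root_space_nonzero_entry[OF X ij ne] by (rule grade_diff_eq_weight_sum[symmetric])
      have "(\<Sum>t = 1..<length ns. \<Sum>a = 1..break t. \<beta> a) \<in> \<nat>"
        using assms
      proof
        assume "\<beta> \<in> positive_roots n"
        then obtain c :: "weight \<Rightarrow> nat" where c: "\<beta> = (\<lambda>j. \<Sum>\<alpha>\<in>simple_roots n. of_nat (c \<alpha>) * \<alpha> j)"
          by (auto simp: positive_roots_def)
        have "(\<Sum>a = 1..break t. \<beta> a) \<in> \<nat>" if t: "t \<in> {1..<length ns}" for t
        proof -
          have "(\<Sum>a = 1..break t. \<beta> a) = (\<Sum>\<alpha>\<in>simple_roots n. of_nat (c \<alpha>) * (\<Sum>a = 1..break t. \<alpha> a))"
            unfolding c sum_distrib_left by (rule sum.swap)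
          also have "\<dots> \<in> \<nat>"
          proof (rule sum_in_Nats)
            fix \<alpha> assume "\<alpha> \<in> simple_roots n"
            then have "(\<Sum>a = 1..break t. \<alpha> a) \<in> \<nat>" using simple_root_break_sum(1) t by auto
            then show "of_nat (c \<alpha>) * (\<Sum>a = 1..break t. \<alpha> a) \<in> \<nat>" by (rule Nats_mult[OF of_nat_in_Nats])
          qed
          finally show ?thesis .
        qed
        then show ?thesis by (rule sum_in_Nats)
      next
        assume "\<beta> \<in> generated_roots n I"
        then obtain c :: "weight \<Rightarrow> int" where c: "\<beta> = (\<lambda>j. \<Sum>\<alpha>\<in>I. of_int (c \<alpha>) * \<alpha> j)"
          by (auto simp: generated_roots_def)
        have "(\<Sum>a = 1..break t. \<beta> a) = 0" if t: "t \<in> {1..<length ns}" for t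
        proof -
          have "(\<Sum>a = 1..break t. \<beta> a) = (\<Sum>\<alpha>\<in>I. of_int (c \<alpha>) * (\<Sum>a = 1..break t. \<alpha> a))"
            unfolding c sum_distrib_left by (rule sum.swap)
          also have "\<dots> = 0"
            using simple_root_break_sum(2) t I by (intro sum.neutral) auto
          finally show ?thesis .
        qed
        then show ?thesis by simp
      qed
      then obtain m :: nat where "(of_int (type_grade n ns i - type_grade n ns j) :: complex) = of_nat m"
        unfolding gd[symmetric] by (elim Nats_cases)
      then have "(of_int (type_grade n ns i - type_grade n ns j) :: complex) = of_int (int m)" by simp
      then have "type_grade n ns i - type_grade n ns j = int m" by (simp only: of_int_eq_iff)
      then show False using less by simp
    qed
  qed
qed

text \<open>If the coefficients are nonpositive while the degree is nonnegative, then the coefficients at all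
  simple roots outside \<open>I\<close> vanish.\<close>
lemma index_weight_diff_root:
  assumes ij: "i < 2 * n" "j < 2 * n" "i \<noteq> j" and le: "type_grade n ns j \<le> type_grade n ns i"
    and root: "(\<lambda>l. index_weight n i l - index_weight n j l) \<in> roots n" (is "?\<beta> \<in> _")
  shows "?\<beta> \<in> positive_roots n \<union> generated_roots n I"
proof -
  let ?idx = "the_inv_into {1..n} (simple_root n)"
  have idx: "?idx (simple_root n m) = m" if "m \<in> {1..n}" for m
    using that by (rule the_inv_into_f_f[OF simple_root_inj])
  have exp: "?\<beta> = (\<lambda>l. \<Sum>\<alpha>\<in>simple_roots n. of_int (root_coeff n i j (?idx \<alpha>)) * \<alpha> l)"
  proof
    fix l
    have "(\<Sum>\<alpha>\<in>simple_roots n. of_int (root_coeff n i j (?idx \<alpha>)) * \<alpha> l) =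
        (\<Sum>m = 1..n. of_int (root_coeff n i j (?idx (simple_root n m))) * simple_root n m l)"
      unfolding simple_roots_def by (subst sum.reindex[OF simple_root_inj]) simp
    also have "\<dots> = (\<Sum>m = 1..n. of_int (root_coeff n i j m) * simple_root n m l)"
      using idx by (intro sum.cong) auto
    finally show "?\<beta> l = (\<Sum>\<alpha>\<in>simple_roots n. of_int (root_coeff n i j (?idx \<alpha>)) * \<alpha> l)"
      using index_weight_diff_expansion[OF n ij(1,2)] by simp
  qed
  from root_coeff_sign[OF ij(1,2)] show ?thesis
  proof
    assume pos: "\<forall>m\<le>n. 0 \<le> root_coeff n i j m"
    have "?\<beta> = (\<lambda>l. \<Sum>\<alpha>\<in>simple_roots n. of_nat (nat (root_coeff n i j (?idx \<alpha>))) * \<alpha> l)"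
      unfolding exp
    proof (intro ext sum.cong refl)
      fix l \<alpha> assume "\<alpha> \<in> simple_roots n"
      then obtain m where m: "m \<in> {1..n}" "\<alpha> = simple_root n m" by (auto simp: simple_roots_def)
      then have "0 \<le> root_coeff n i j (?idx \<alpha>)" using pos idx[OF m(1)] by simp
      then show "of_int (root_coeff n i j (?idx \<alpha>)) * \<alpha> l = of_nat (nat (root_coeff n i j (?idx \<alpha>))) * \<alpha> l"
        by simp
    qed
    then have "?\<beta> \<in> positive_roots n"
      unfolding positive_roots_def using root
      by (intro CollectI conjI exI[of _ "\<lambda>\<alpha>. nat (root_coeff n i j (?idx \<alpha>))"])
    then show ?thesis by (rule UnI1)
  next
    assume neg: "\<forall>m\<le>n. root_coeff n i j m \<le> 0"
    let ?\<delta> = "\<lambda>t. prefix_sign n (break t) i - prefix_sign n (break t) j"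
    have ps: "?\<delta> t =
        (if break t < n then 1 else 2) * root_coeff n i j (break t)" if t: "t \<in> {1..<length ns}" for t
      using break_bounds[of t] t ij(1,2) by (auto simp: root_coeff_def prefix_sign_def)
    have "0 \<le> (\<Sum>t = 1..<length ns. ?\<delta> t)"
      using le by (simp add: type_grade_def sum_subtractf)
    then have "(\<Sum>t = 1..<length ns. - ?\<delta> t) \<le> 0"
      unfolding sum_negf by simp
    moreover have nn: "0 \<le> - ?\<delta> t" if t: "t \<in> {1..<length ns}" for t
    proof -
      have "root_coeff n i j (break t) \<le> 0" using neg break_bounds[of t] t by auto
      then show ?thesis unfolding ps[OF t] by (cases "break t < n") auto
    qed
    ultimately have "(\<Sum>t = 1..<length ns. - ?\<delta> t) = 0"
      by (intro antisym sum_nonneg) auto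
    then have "\<forall>t\<in>{1..<length ns}. - ?\<delta> t = 0"
      using nn by (subst (asm) sum_nonneg_eq_0_iff) auto
    then have zero: "root_coeff n i j (break t) = 0" if "t \<in> {1..<length ns}" for t
      using ps[OF that] that by (auto split: if_splits)
    have "?\<beta> = (\<lambda>l. \<Sum>\<alpha>\<in>I. of_int (root_coeff n i j (?idx \<alpha>)) * \<alpha> l)"
      unfolding exp
    proof
      fix l
      have "root_coeff n i j (?idx \<alpha>) = 0" if al: "\<alpha> \<in> simple_roots n - I" for \<alpha>
      proof -
        have eq: "simple_roots n - I = {simple_root n (break t) | t. 1 \<le> t \<and> t < length ns}"
          using type unfolding parabolic_type_def by (elim conjE)
        obtain t where t: "\<alpha> = simple_root n (break t)" "1 \<le> t" "t < length ns"
          using al unfolding eq by blast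
        then show ?thesis using zero[of t] idx[of "break t"] break_bounds[of t] by simp
      qed
      then show "(\<Sum>\<alpha>\<in>simple_roots n. of_int (root_coeff n i j (?idx \<alpha>)) * \<alpha> l) =
          (\<Sum>\<alpha>\<in>I. of_int (root_coeff n i j (?idx \<alpha>)) * \<alpha> l)"
        by (intro sum.mono_neutral_right finite_simple_roots I) auto
    qed
    then have "?\<beta> \<in> generated_roots n I"
      unfolding generated_roots_def using root
      by (intro CollectI conjI exI[of _ "\<lambda>\<alpha>. root_coeff n i j (?idx \<alpha>)"])
    then show ?thesis by (rule UnI2)
  qed
qed

text \<open>An element of nonnegative degree is a combination of its root vectors, all of which belong to
  the Cartan subalgebra or to roots of the parabolic.\<close>
lemma standard_parabolic_graded: "standard_parabolic n I = graded 0"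
proof
  show "standard_parabolic n I \<subseteq> graded 0"
    unfolding standard_parabolic_def
  proof (intro hull_minimal Un_least is_subspace_graded)
    show "cartan n \<subseteq> graded 0"
    proof
      fix H assume H: "H \<in> cartan n"
      then have "H \<in> carrier_mat (2 * n) (2 * n)" using sp_carrier by (simp add: cartan_def)
      then have "H $$ (i, j) = 0" if "i < 2 * n" "j < 2 * n" "i \<noteq> j" for i j
        using H that unfolding cartan_def diagonal_mat_def by auto
      then show "H \<in> graded 0" using H by (intro gradedI) (auto simp: cartan_def)
    qed
    show "(\<Union>\<beta>\<in>positive_roots n \<union> generated_roots n I. root_space n \<beta>) \<subseteq> graded 0"
      using root_space_subset_graded by blast
  qed
next
  show "graded 0 \<subseteq> standard_parabolic n I"
  proof
    fix X assume X: "X \<in> graded 0"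
    let ?gens = "cartan n \<union> (\<Union>\<beta>\<in>positive_roots n \<union> generated_roots n I. root_space n \<beta>)"
    note Xsp = gradedD(1)[OF X]
    have "X \<in> V" if V: "is_subspace n V" "?gens \<subseteq> V" for V
    proof (rule sp_root_vector_decomposition[OF Xsp V(1)])
      fix i j assume ij: "i < 2 * n" "j < 2 * n"
      let ?M = "root_vector n X i j" and ?\<beta> = "\<lambda>l. index_weight n i l - index_weight n j l"
      have Mrs: "?M \<in> root_space n ?\<beta>" by (rule root_vector_root_space[OF Xsp ij])
      consider "?M = 0\<^sub>m (2 * n) (2 * n)" | "i = j" | "?M \<noteq> 0\<^sub>m (2 * n) (2 * n)" "i \<noteq> j" by blast
      then show "?M \<in> V"
      proof cases
        case 1
        then show ?thesis using is_subspaceD(2)[OF V(1)] by simp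
      next
        case 2
        have "?M \<in> cartan n"
          unfolding cartan_def using 2 root_vector_sp[OF Xsp ij]
          by (auto simp: diagonal_mat_def root_vector_def)
        then show ?thesis using V(2) by blast
      next
        case 3
        have ne: "X $$ (i, j) \<noteq> 0"
        proof
          assume X0: "X $$ (i, j) = 0"
          then have X0': "X $$ (dual n j, dual n i) = 0"
            unfolding sp_dual_entry[OF Xsp ij] by simp
          have "?M = 0\<^sub>m (2 * n) (2 * n)"
          proof (rule eq_matI)
            fix a b assume "a < dim_row (0\<^sub>m (2 * n) (2 * n) :: complex mat)"
              "b < dim_col (0\<^sub>m (2 * n) (2 * n) :: complex mat)"
            then have ab: "a < 2 * n" "b < 2 * n" by auto
            have z1: "(if a = i \<and> b = j then X $$ (a, b) else 0) = 0" by (metis X0)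
            have z2: "(if a = dual n j \<and> b = dual n i then X $$ (a, b) else 0) = 0"
              by (metis X0')
            show "?M $$ (a, b) = 0\<^sub>m (2 * n) (2 * n) $$ (a, b)"
              by (simp only: root_vector_def index_mat(1)[OF ab] prod.case z1 z2 add_0 index_zero_mat(1)[OF ab])
          qed (simp_all add: root_vector_def)
          then show False using 3 by simp
        qed
        then have le: "type_grade n ns j \<le> type_grade n ns i"
          using gradedD(3)[OF X ij] by force
        have "?\<beta> \<noteq> (\<lambda>_. 0)"
        proof
          assume "?\<beta> = (\<lambda>_. 0)"
          then have "index_weight n i = index_weight n j" by (metis eq_iff_diff_eq_0 ext)
          then show False using index_weight_inj[OF ij] 3 by blast
        qed
        moreover have "?\<beta> l = 0" if "l \<notin> {1..n}" for l
          using index_weight_outside[OF _ that] ij by simp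
        moreover have "root_space n ?\<beta> \<noteq> {0\<^sub>m (2 * n) (2 * n)}" using Mrs 3(1) by blast
        ultimately have "?\<beta> \<in> roots n" unfolding roots_def by blast
        then have "?\<beta> \<in> positive_roots n \<union> generated_roots n I"
          using index_weight_diff_root[OF ij 3(2) le] by blast
        then show ?thesis using V(2) Mrs by blast
      qed
    qed
    then show "X \<in> standard_parabolic n I" unfolding standard_parabolic_def hull_def by blast
  qed
qed

lemma nilradical_standard_parabolic:
  "nilradical n (standard_parabolic n I) = graded 1"
  unfolding standard_parabolic_graded by (rule nilradical_graded)

end

section \<open>Level sizes of the grading and the Z-diagram\<close>

text \<open>In this locale \<open>start b\<close> is the first index of block \<open>b\<close>, blocks being counted from 0; the last block,
  which may be empty, has degree 0.\<close>
locale block_type =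
  fixes n :: nat and ns :: "nat list"
  assumes ns_nonempty: "ns \<noteq> []" and ns_sum: "sum_list ns = n"
begin

sublocale symplectic_grading n "type_grade n ns"
  by (rule symplectic_grading_type)

abbreviation "g \<equiv> type_grade n ns"
abbreviation "start b \<equiv> sum_list (take b ns)"
abbreviation "top_level \<equiv> int (length ns) - 1"

lemma start_mono: "b \<le> c \<Longrightarrow> start b \<le> start c"
proof -
  assume "b \<le> c"
  then have "take c ns = take b ns @ take (c - b) (drop b ns)" by (metis le_add_diff_inverse take_add)
  then show ?thesis by simp
qed

lemma start_Suc: "b < length ns \<Longrightarrow> start (Suc b) = start b + ns ! b"
  by (simp add: take_Suc_conv_app_nth)

lemma start_le: "start b \<le> n"
  using start_mono[of b "max b (length ns)"] ns_sum by simp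

lemma ex_block:
  assumes "i < n"
  shows "\<exists>b<length ns. start b \<le> i \<and> i < start b + ns ! b"
proof -
  let ?m = "LEAST m. i < start m"
  have ex: "i < start (length ns)" using assms ns_sum by simp
  then have m: "i < start ?m" by (rule LeastI)
  have le: "?m \<le> length ns" using ex by (rule Least_le)
  have "?m \<noteq> 0"
  proof
    assume "?m = 0"
    then show False using m by simp
  qed
  then obtain b where b: "?m = Suc b" by (cases ?m) auto
  have "\<not> i < start b" by (rule not_less_Least) (simp add: b)
  then show ?thesis using m le start_Suc[of b] unfolding b by (intro exI[of _ b]) auto
qed

lemma grade_block:
  assumes b: "b < length ns" "start b \<le> i" "i < start b + ns ! b"
  shows "i < n" "g i = top_level - int b"
proof -
  have S: "start b + ns ! b = start (Suc b)" using start_Suc[OF b(1)] by simp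
  show i: "i < n" using b(3) start_le[of "Suc b"] S by linarith
  have "g i = (\<Sum>t = 1..<length ns. of_bool (i < start t))"
    unfolding type_grade_def using i by (simp add: prefix_sign_def)
  also have "\<dots> = (\<Sum>t = 1..<length ns. if t \<in> {Suc b..<length ns} then 1 else 0)"
  proof (rule sum.cong)
    fix t assume t: "t \<in> {1..<length ns}"
    show "of_bool (i < start t) = (if t \<in> {Suc b..<length ns} then 1 else 0 :: int)"
      using t b(2,3) S start_mono[of t b] start_mono[of "Suc b" t] by (cases "t \<le> b") auto
  qed simp
  also have "\<dots> = int (card ({1..<length ns} \<inter> {Suc b..<length ns}))"
    by (simp only: sum.inter_restrict[OF finite_atLeastLessThan, symmetric]) simp
  also have "{1..<length ns} \<inter> {Suc b..<length ns} = {Suc b..<length ns}" by auto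
  finally show "g i = top_level - int b" using b(1) by simp
qed

definition block :: "nat \<Rightarrow> nat" where
  "block i = nat (top_level - g i)"

lemma block_spec:
  assumes "i < n"
  shows "block i < length ns" "start (block i) \<le> i" "i < start (block i) + ns ! block i"
    "g i = top_level - int (block i)"
proof -
  obtain b where b: "b < length ns" "start b \<le> i" "i < start b + ns ! b" using ex_block[OF assms] by auto
  have "block i = b" unfolding block_def grade_block(2)[OF b] by simp
  then show "block i < length ns" "start (block i) \<le> i" "i < start (block i) + ns ! block i"
    "g i = top_level - int (block i)" using b grade_block(2)[OF b] by auto
qed

lemma grade_nonneg: "i < n \<Longrightarrow> 0 \<le> g i"
  using block_spec[of i] by linarith

lemma grade_nonpos: "n \<le> i \<Longrightarrow> i < 2 * n \<Longrightarrow> g i \<le> 0"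
  using grade_nonneg[of "dual n i"] g_dual[of i] by (auto simp: dual_def)

text \<open>The position of an index inside its block; dual indices have the same offset. An index of
  nonzero degree thus labels a box of the Z-diagram: the degree is the column, the offset the row.\<close>
definition offset :: "nat \<Rightarrow> nat" where
  "offset i = (let j = if i < n then i else i - n in j - start (block j))"

lemma offset_dual: "i < 2 * n \<Longrightarrow> offset (dual n i) = offset i"
  by (auto simp: offset_def dual_def)

lemma eq_if_same_level_offset:
  assumes ij: "i < 2 * n" "j < 2 * n" and "i < n \<longleftrightarrow> j < n" "g i = g j" "offset i = offset j"
  shows "i = j"
proof -
  have main: "i = j" if "i < n" "j < n" "g i = g j" "offset i = offset j" for i j
  proof -
    have "block i = block j" using that(3) by (simp add: block_def)
    then show ?thesis using that(1,2,4) block_spec(2)[of i] block_spec(2)[of j] by (simp add: offset_def)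
  qed
  show ?thesis
  proof (cases "i < n")
    case True
    then show ?thesis using main assms by blast
  next
    case False
    then have nj: "\<not> j < n" using assms(3) by simp
    have "dual n i = dual n j"
    proof (rule main)
      show "dual n i < n" "dual n j < n"
        using False nj ij by (simp_all add: dual_less_iff)
      show "g (dual n i) = g (dual n j)" by (simp only: g_dual ij assms(4))
      show "offset (dual n i) = offset (dual n j)" by (simp only: offset_dual ij assms(5))
    qed
    then show ?thesis using dual_inj[OF ij] by simp
  qed
qed

definition level_size :: "int \<Rightarrow> nat" where
  "level_size \<gamma> = card {i. i < 2 * n \<and> g i = \<gamma>}"

lemma level_size_uminus: "level_size (- \<gamma>) = level_size \<gamma>"
proof -
  have "bij_betw (dual n) {i. i < 2 * n \<and> g i = \<gamma>} {i. i < 2 * n \<and> g i = - \<gamma>}"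
    by (rule bij_betw_byWitness[where f' = "dual n"]) (auto simp: g_dual)
  from bij_betw_same_card[OF this] show ?thesis unfolding level_size_def by (rule sym)
qed

lemma lower_half_level:
  assumes "b < length ns"
  shows "{i. i < n \<and> g i = top_level - int b} = {start b..<start b + ns ! b}"
proof (intro equalityI subsetI)
  fix i assume "i \<in> {i. i < n \<and> g i = top_level - int b}"
  then have i: "i < n" "g i = top_level - int b" by auto
  then have "block i = b" using block_spec(4)[of i] by simp
  then show "i \<in> {start b..<start b + ns ! b}" using block_spec[OF i(1)] by auto
qed (use grade_block[OF assms] in auto)

lemma level_size_block:
  assumes "b < length ns - 1"
  shows "level_size (top_level - int b) = ns ! b"
proof -
  have "{i. i < 2 * n \<and> g i = top_level - int b} = {i. i < n \<and> g i = top_level - int b}"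
  proof (rule Collect_cong)
    fix i
    show "i < 2 * n \<and> g i = top_level - int b \<longleftrightarrow> i < n \<and> g i = top_level - int b"
    proof (cases "g i = top_level - int b")
      case True
      then have "0 < g i" using assms by linarith
      then show ?thesis using grade_nonpos[of i] by (cases "i < n") auto
    qed simp
  qed
  then show ?thesis unfolding level_size_def using lower_half_level[of b] assms by simp
qed

lemma level_size_0: "level_size 0 = 2 * last ns"
proof -
  let ?b = "length ns - 1"
  have b: "?b < length ns" "last ns = ns ! ?b" using ns_nonempty by (auto simp: last_conv_nth)
  have A: "{i. i < n \<and> g i = 0} = {start ?b..<start ?b + ns ! ?b}"
  proof -
    have "top_level - int ?b = 0" using b(1) by linarith
    then show ?thesis using lower_half_level[OF b(1)] by (simp only:)
  qed
  have "{i. i < 2 * n \<and> g i = 0} = {i. i < n \<and> g i = 0} \<union> dual n ` {i. i < n \<and> g i = 0}"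
  proof (intro equalityI subsetI)
    fix i assume "i \<in> {i. i < 2 * n \<and> g i = 0}"
    then have i: "i < 2 * n" "g i = 0" by auto
    show "i \<in> {i. i < n \<and> g i = 0} \<union> dual n ` {i. i < n \<and> g i = 0}"
    proof (cases "i < n")
      case False
      then have "i = dual n (dual n i)" "dual n i < n" "g (dual n i) = 0"
        using i by (auto simp: dual_less_iff g_dual)
      then show ?thesis by blast
    qed (use i in auto)
  qed (auto simp: g_dual)
  moreover have "{i. i < n \<and> g i = 0} \<inter> dual n ` {i. i < n \<and> g i = 0} = {}"
    by (auto simp: dual_def)
  moreover have "inj_on (dual n) {i. i < n \<and> g i = 0}"
    by (auto simp: inj_on_def dual_def)
  ultimately have "level_size 0 = 2 * card {i. i < n \<and> g i = 0}"
    unfolding level_size_def by (simp add: card_Un_disjoint card_image)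
  then show ?thesis using A b by simp
qed

definition levels :: "int set" where
  "levels = {- top_level..top_level}"

lemma finite_levels [simp]: "finite levels"
  by (simp add: levels_def)

lemma grade_in_levels: "i < 2 * n \<Longrightarrow> g i \<in> levels"
proof -
  have low: "g i \<in> levels" if "i < n" for i
    using block_spec[OF that] unfolding levels_def by auto
  assume i: "i < 2 * n"
  show ?thesis
  proof (cases "i < n")
    case False
    then have "g (dual n i) \<in> levels" using i by (intro low) (simp add: dual_less_iff)
    then show ?thesis unfolding g_dual[OF i] levels_def by auto
  qed (rule low)
qed

text \<open>Columns of opposite degrees have equal length, and the column of degree 0 is its own opposite.\<close>
lemma card_levels_larger:
  "card {\<gamma> \<in> levels. r < level_size \<gamma>} =
     of_bool (r < 2 * last ns) + 2 * card {b. b < length ns - 1 \<and> r < ns ! b}"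
proof -
  let ?B = "{b. b < length ns - 1 \<and> r < ns ! b}"
  let ?Z = "{\<gamma> :: int. \<gamma> = 0 \<and> r < 2 * last ns}"
  let ?up = "\<lambda>b. top_level - int b" and ?down = "\<lambda>b. - (top_level - int b)"
  have fB: "finite ?B" by simp
  have "{\<gamma> \<in> levels. r < level_size \<gamma>} = ?Z \<union> (?up ` ?B \<union> ?down ` ?B)"
  proof (intro equalityI subsetI)
    fix \<gamma> assume \<gamma>: "\<gamma> \<in> {\<gamma> \<in> levels. r < level_size \<gamma>}"
    define b where "b = nat (top_level - \<bar>\<gamma>\<bar>)"
    show "\<gamma> \<in> ?Z \<union> (?up ` ?B \<union> ?down ` ?B)"
    proof (cases "\<gamma> = 0")
      case False
      then have b: "b < length ns - 1" "\<bar>\<gamma>\<bar> = top_level - int b"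
        using \<gamma> by (auto simp: b_def levels_def)
      have "level_size \<bar>\<gamma>\<bar> = level_size \<gamma>" by (cases "0 \<le> \<gamma>") (auto simp: level_size_uminus)
      then have "b \<in> ?B" using b \<gamma> level_size_block[OF b(1)] by auto
      moreover have "\<gamma> = ?up b \<or> \<gamma> = ?down b" using b(2) by linarith
      ultimately show ?thesis by blast
    qed (use \<gamma> level_size_0 in auto)
  next
    fix \<gamma> assume "\<gamma> \<in> ?Z \<union> (?up ` ?B \<union> ?down ` ?B)"
    then consider "\<gamma> \<in> ?Z" | b where "b \<in> ?B" "\<gamma> = ?up b \<or> \<gamma> = ?down b" by blast
    then show "\<gamma> \<in> {\<gamma> \<in> levels. r < level_size \<gamma>}"
    proof cases
      case 1
      moreover have "0 \<in> levels" using ns_nonempty by (cases "length ns") (auto simp: levels_def)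
      ultimately show ?thesis using level_size_0 by auto
    next
      case 2
      then have "level_size (top_level - int b) = ns ! b" using level_size_block[of b] by simp
      then have "level_size \<gamma> = ns ! b" using 2(2) level_size_uminus by metis
      then show ?thesis using 2 by (auto simp: levels_def)
    qed
  qed
  moreover have "card (?Z \<union> (?up ` ?B \<union> ?down ` ?B)) = card ?Z + (card (?up ` ?B) + card (?down ` ?B))"
  proof (subst card_Un_disjoint)
    show "finite ?Z" by (rule finite_subset[of _ "{0}"]) auto
    show "?Z \<inter> (?up ` ?B \<union> ?down ` ?B) = {}" by auto
    show "card ?Z + card (?up ` ?B \<union> ?down ` ?B) = card ?Z + (card (?up ` ?B) + card (?down ` ?B))"
      by (subst card_Un_disjoint) auto
  qed (use fB in auto)
  moreover have "card (?up ` ?B) = card ?B" "card (?down ` ?B) = card ?B"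
    by (intro card_image inj_onI; simp)+
  moreover have "card ?Z = of_bool (r < 2 * last ns)"
    by (cases "r < 2 * last ns") auto
  ultimately show ?thesis by simp
qed

definition shape :: "nat list" where
  "shape = Z_diagram (last ns) (butlast ns)"

abbreviation "a \<equiv> last ns"

lemma nth_shape:
  assumes "r < length shape"
  shows "shape ! r = card {\<gamma> \<in> levels. r < level_size \<gamma>}"
proof -
  have "shape ! r = length (filter (\<lambda>c. r < c) (2 * a # butlast ns @ butlast ns))"
    using assms unfolding shape_def Z_diagram_def by (rule nth_transpose_partition)
  also have "\<dots> = of_bool (r < 2 * a) + 2 * length (filter (\<lambda>c. r < c) (butlast ns))" by simp
  also have "length (filter (\<lambda>c. r < c) (butlast ns)) = card {b. b < length ns - 1 \<and> r < ns ! b}"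
    unfolding length_filter_conv_card by (rule arg_cong[of _ _ card]) (auto simp: nth_butlast)
  finally show ?thesis using card_levels_larger by simp
qed

lemma length_shape_ge: "2 * a \<le> length shape" "b < length ns - 1 \<Longrightarrow> ns ! b \<le> length shape"
proof -
  show "2 * a \<le> length shape" unfolding shape_def Z_diagram_def
    by (rule le_length_transpose_partition) simp
  assume b: "b < length ns - 1"
  then have "ns ! b \<in> set (butlast ns)" by (metis length_butlast nth_butlast nth_mem)
  then show "ns ! b \<le> length shape" unfolding shape_def Z_diagram_def
    by (intro le_length_transpose_partition) simp
qed

lemma shape_sorted: "sorted_wrt (\<ge>) shape" and shape_pos: "0 \<notin> set shape"
  unfolding shape_def Z_diagram_def
  by (rule transpose_partition_sorted, rule transpose_partition_pos)

lemma sum_shape: "sum_list shape = 2 * n"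
proof -
  have "sum_list (butlast ns) + last ns = n"
    using ns_sum ns_nonempty by (metis append_butlast_last_id sum_list.Nil sum_list.Cons sum_list_append add.right_neutral)
  then show ?thesis unfolding shape_def Z_diagram_def by (simp add: sum_list_transpose_partition)
qed

lemma odd_shape: "r < 2 * a \<Longrightarrow> odd (shape ! r)"
  using length_shape_ge(1) by (simp add: nth_shape card_levels_larger)

lemma even_shape: "2 * a \<le> r \<Longrightarrow> r < length shape \<Longrightarrow> even (shape ! r)"
  by (simp add: nth_shape card_levels_larger)

lemma trunc_size_shape: "trunc_size k shape = (\<Sum>r<length shape. min k (card {\<gamma> \<in> levels. r < level_size \<gamma>}))"
proof -
  have "map (min k) shape = map (\<lambda>r. min k (card {\<gamma> \<in> levels. r < level_size \<gamma>})) [0..<length shape]"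
    by (rule nth_equalityI) (auto simp: nth_shape)
  then show ?thesis
    unfolding trunc_size_def by (simp only: interv_sum_list_conv_sum_set_nat set_upt atLeast0LessThan)
qed

section \<open>The Z-diagram bounds the Jordan types in the nilradical\<close>

text \<open>Dropping the \<open>k\<close> largest degree pieces bounds the rank by the number of boxes outside the
  first \<open>k\<close> columns.\<close>
lemma graded_rank_bound:
  assumes X: "X \<in> graded 1" and fr: "has_rank (2 * n) (X ^\<^sub>m k) r"
  shows "r + trunc_size k shape \<le> 2 * n"
proof -
  obtain T where T: "T \<subseteq> levels" "card T \<le> k"
      "trunc_size k shape \<le> (\<Sum>\<gamma>\<in>T. level_size \<gamma>)"
    using ex_levels_truncated_sum[OF finite_levels, where c = level_size and m = "length shape" and k = k]
    unfolding trunc_size_shape by blast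
  have fT: "finite T" by (rule finite_subset[OF T(1) finite_levels])
  have "r \<le> card {i. i < 2 * n \<and> g i \<notin> T}"
    by (rule strictly_graded_rank_bound[OF gradedD(2)[OF X] _ fT T(2) fr])
      (use gradedD(3)[OF X] in auto)
  moreover have "card {i. i < 2 * n \<and> g i \<in> T} = (\<Sum>\<gamma>\<in>T. level_size \<gamma>)"
  proof -
    have "{i. i < 2 * n \<and> g i \<in> T} = (\<Union>\<gamma>\<in>T. {i. i < 2 * n \<and> g i = \<gamma>})" by auto
    then show ?thesis unfolding level_size_def
      using fT by (simp only:) (rule card_UN_disjoint, auto)
  qed
  moreover have "card {i. i < 2 * n \<and> g i \<in> T} + card {i. i < 2 * n \<and> g i \<notin> T} = 2 * n"
  proof -
    have "card ({i. i < 2 * n \<and> g i \<in> T} \<union> {i. i < 2 * n \<and> g i \<notin> T}) =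
        card {i. i < 2 * n \<and> g i \<in> T} + card {i. i < 2 * n \<and> g i \<notin> T}"
      by (rule card_Un_disjoint) auto
    moreover have "{i. i < 2 * n \<and> g i \<in> T} \<union> {i. i < 2 * n \<and> g i \<notin> T} = {..<2 * n}" by auto
    ultimately show ?thesis by simp
  qed
  ultimately show ?thesis using T(3) by linarith
qed

section \<open>Chains realising the collapse\<close>

definition partner :: "nat \<Rightarrow> nat" where
  "partner r = (if even r then r + 1 else r - 1)"

lemma partner_partner [simp]: "partner (partner r) = r"
  by (auto simp: partner_def)

lemma partner_div [simp]: "partner r div 2 = r div 2"
  unfolding partner_def by presburger

lemma partner_less_iff [simp]: "partner r < 2 * m \<longleftrightarrow> r < 2 * m"
  unfolding partner_def by presburger

text \<open>Rows are numbered from 0. Among the odd rows, \<open>2j\<close> and \<open>2j + 1\<close> are partners. Each basis vector of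
  degree 0 is a box of such a row, but the degree 0 box of row \<open>2j\<close> is dual to that of row \<open>2j + 1\<close>. For a
  given exponent \<open>k\<close> a pair of partners is treated in one of two ways.

  If \<open>k\<close> is at most the shorter row, the pair is linked: two chains are formed, each running through
  one half of either row and through one degree 0 box. The chains are dual to each other and both have
  length at least \<open>k\<close>.

  If \<open>k\<close> exceeds the shorter row, each row without its degree 0 box is a self-dual chain, and the two
  degree 0 boxes are chains of length 1.

  In both cases the number of vectors with fewer than \<open>k\<close> others above them in their chain is at most
  that for the two rows of the collapse. Even rows are self-dual chains.\<close>
definition linked :: "nat \<Rightarrow> nat \<Rightarrow> bool" where
  "linked k r \<longleftrightarrow> r < 2 * a \<and> k \<le> shape ! (2 * (r div 2) + 1)"

lemma linked_partner [simp]: "linked k (partner r) = linked k r"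
  by (simp add: linked_def)

text \<open>The chain of a basis vector: named after the row of its vectors of negative degree, with a flag for
  the chains of length 1 in degree 0.\<close>
definition chain_label :: "nat \<Rightarrow> nat \<Rightarrow> nat \<times> bool" where
  "chain_label k i =
     (if g i = 0 then (if i < n then 2 * offset i else 2 * offset i + 1,
                       \<not> linked k (2 * offset i))
      else (if i < n \<and> linked k (offset i) then partner (offset i) else offset i, False))"

text \<open>The chain formed by the dual basis vectors.\<close>
definition dual_label :: "nat \<Rightarrow> nat \<times> bool \<Rightarrow> nat \<times> bool" where
  "dual_label k c = (if snd c \<or> linked k (fst c) then (partner (fst c), snd c) else c)"

lemma linked_odd: "linked k (2 * r + 1) = linked k (2 * r)"
  using linked_partner[of k "2 * r"] by (simp add: partner_def)

lemma chain_label_dual: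
  assumes "i < 2 * n"
  shows "chain_label k (dual n i) = dual_label k (chain_label k i)"
proof (cases "g i = 0")
  case True
  then show ?thesis
    using assms linked_odd[of k "offset i"]
    by (auto simp: chain_label_def dual_label_def g_dual dual_less_iff offset_dual partner_def)
next
  case False
  then show ?thesis
    using assms
    by (auto simp: chain_label_def dual_label_def g_dual dual_less_iff offset_dual)
qed

lemma chain_label_inj:
  assumes ij: "i < 2 * n" "j < 2 * n" and eq: "chain_label k i = chain_label k j" "g i = g j"
  shows "i = j"
proof (cases "g i = 0")
  case True
  then have e: "(if i < n then 2 * offset i else 2 * offset i + 1) = (if j < n then 2 * offset j else 2 * offset j + 1)"
    using eq by (simp add: chain_label_def)
  have "(i < n \<longleftrightarrow> j < n) \<and> offset i = offset j"
    using e by (cases "i < n"; cases "j < n"; simp; presburger)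
  then show ?thesis using eq_if_same_level_offset ij eq by blast
next
  case False
  have half: "i < n \<longleftrightarrow> j < n"
    using False eq(2) grade_nonneg grade_nonpos ij by (metis antisym not_le)
  have "(if i < n \<and> linked k (offset i) then partner (offset i) else offset i) =
      (if i < n \<and> linked k (offset j) then partner (offset j) else offset j)"
    using eq False half by (simp add: chain_label_def)
  then have "offset i = offset j" by (metis linked_partner partner_partner)
  then show ?thesis using eq_if_same_level_offset ij eq half by blast
qed

lemma chain_structure_label: "chain_structure (2 * n) (chain_label k) g"
  by unfold_locales (rule chain_label_inj)

text \<open>A matrix of \<open>sp n\<close> with blocks \<open>A\<close>, \<open>B\<close>, \<open>C\<close>, \<open>D\<close> has symmetric \<open>B\<close>, \<open>C\<close> and \<open>D = - A\<^sup>T\<close>.\<close>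
definition chain_sign :: "nat \<Rightarrow> nat \<Rightarrow> complex" where
  "chain_sign i j = (if n \<le> i \<and> n \<le> j then - 1 else 1)"

text \<open>Duality reverses degrees and permutes the chains, so it preserves the covering relation. The block \<open>C\<close>
  of the matrix vanishes, since the first half of the basis has nonnegative degrees and the second half
  nonpositive ones.\<close>
lemma chain_mat_in_graded_1: "chain_structure.chain_mat (2 * n) (chain_label k) g chain_sign \<in> graded 1"
proof -
  interpret chain_structure "2 * n" "chain_label k" g by (rule chain_structure_label)
  let ?d = "dual n"
  have same_row: "chain_label k (?d i) = chain_label k (?d j) \<longleftrightarrow> chain_label k i = chain_label k j"
    if "i < 2 * n" "j < 2 * n" for i j
    using that by (metis chain_label_dual dual_dual dual_less)
  have cov: "covers (?d j) (?d i)" if "covers i j" for i j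
  proof -
    from that have c: "i < 2 * n" "j < 2 * n" "chain_label k i = chain_label k j" "g j < g i"
      "\<And>l. l < 2 * n \<Longrightarrow> chain_label k l = chain_label k i \<Longrightarrow> \<not> (g j < g l \<and> g l < g i)"
      by (auto simp: covers_def)
    show ?thesis
      unfolding covers_def
    proof (intro conjI allI impI)
      fix l assume l: "l < 2 * n" "chain_label k l = chain_label k (?d j)"
      have "chain_label k (?d l) = chain_label k i"
        using same_row[of l "?d j"] l c by simp
      then show "\<not> (g (?d i) < g l \<and> g l < g (?d j))"
        using c(5)[of "?d l"] l(1) c(1,2) g_dual by (metis dual_less neg_less_iff_less minus_less_iff)
    qed (use c same_row g_dual in auto)
  qed
  have cov_iff: "covers (?d j) (?d i) \<longleftrightarrow> covers i j" if "i < 2 * n" "j < 2 * n" for i j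
    using cov[of i j] cov[of "?d j" "?d i"] that by auto
  have half: "\<not> (j < n \<and> n \<le> i)" if "covers i j" for i j
    using that grade_nonneg[of j] grade_nonpos[of i] unfolding covers_def by force
  show ?thesis
  proof (rule gradedI)
    show "chain_mat chain_sign \<in> sp n"
      unfolding sp_iff
    proof (intro conjI allI impI)
      fix i j assume ij: "i < 2 * n" "j < 2 * n"
      show "chain_mat chain_sign $$ (?d j, ?d i) = - form_sign n i * form_sign n j * chain_mat chain_sign $$ (i, j)"
      proof (cases "covers i j")
        case True
        have "chain_sign (?d j) (?d i) = - form_sign n i * form_sign n j * chain_sign i j"
          using half[OF True] ij dual_less_iff[OF ij(1)] dual_less_iff[OF ij(2)]
          by (auto simp: chain_sign_def form_sign_def not_less)
        then show ?thesis using True cov_iff[OF ij] ij by (simp add: chain_mat_def)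
      next
        case False
        then show ?thesis using cov_iff[OF ij] ij by (simp add: chain_mat_def)
      qed
    qed simp
    fix i j assume "i < 2 * n" "j < 2 * n" "g i < g j + 1"
    then show "chain_mat chain_sign $$ (i, j) = 0" by (auto simp: chain_mat_def covers_def)
  qed
qed

lemma offset_less_level:
  assumes i: "i < 2 * n" and g: "g i \<noteq> 0"
  shows "offset i < level_size (g i)" "offset i < length shape"
proof -
  have low: "offset i < level_size (g i) \<and> offset i < length shape" if "i < n" "g i \<noteq> 0" for i
  proof -
    note b = block_spec[OF that(1)]
    then have b': "block i < length ns - 1" using that(2) by linarith
    have "offset i < ns ! block i" using b that(1) by (simp add: offset_def)
    then show ?thesis using level_size_block[OF b'] length_shape_ge(2)[OF b'] b(4) by simp
  qed
  have "offset i < level_size (g i) \<and> offset i < length shape"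
  proof (cases "i < n")
    case False
    then have "dual n i < n" using i by (simp add: dual_less_iff)
    then show ?thesis using low[of "dual n i"] g i by (simp add: g_dual offset_dual level_size_uminus)
  qed (use low g in blast)
  then show "offset i < level_size (g i)" "offset i < length shape" by auto
qed

lemma offset_less_middle:
  assumes i: "i < 2 * n" and g: "g i = 0"
  shows "offset i < a"
proof -
  have low: "offset i < a" if "i < n" "g i = 0" for i
  proof -
    note b = block_spec[OF that(1)]
    then have "block i = length ns - 1" using that(2) by linarith
    then have "ns ! block i = a" using ns_nonempty by (simp add: last_conv_nth)
    then show ?thesis using b that(1) by (simp add: offset_def)
  qed
  show ?thesis
  proof (cases "i < n")
    case False
    then have "dual n i < n" using i by (simp add: dual_less_iff)
    then show ?thesis using low[of "dual n i"] g i by (simp add: g_dual offset_dual)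
  qed (use low g in blast)
qed

lemma chain_label_range:
  assumes i: "i < 2 * n"
  shows "chain_label k i \<in> (\<lambda>r. (r, False)) ` {..<length shape} \<union> (\<lambda>r. (r, True)) ` {..<2 * a}"
proof (cases "g i = 0")
  case True
  then have "fst (chain_label k i) < 2 * a"
    using offset_less_middle[OF i True] by (simp add: chain_label_def)
  then show ?thesis using length_shape_ge(1)
    by (cases "chain_label k i"; cases "snd (chain_label k i)") auto
next
  case False
  have "fst (chain_label k i) < length shape"
  proof (cases "i < n \<and> linked k (offset i)")
    case True
    then have "partner (offset i) < 2 * a" by (simp add: linked_def)
    moreover have "fst (chain_label k i) = partner (offset i)"
      using True False by (simp add: chain_label_def)
    ultimately show ?thesis using length_shape_ge(1) by linarith
  next
    case F: False
    then show ?thesis using False offset_less_level(2)[OF i False] by (auto simp: chain_label_def)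
  qed
  moreover have "\<not> snd (chain_label k i)" using False by (simp add: chain_label_def)
  ultimately show ?thesis by (cases "chain_label k i") auto
qed

abbreviation "chain_row k c \<equiv> {i. i < 2 * n \<and> chain_label k i = c}"

lemma inj_on_chain_row: "inj_on g (chain_row k c)"
  by (rule inj_onI) (metis (mono_tags, lifting) chain_label_inj mem_Collect_eq)

lemma chain_label_middle: "g i = 0 \<Longrightarrow> snd (chain_label k i) \<longleftrightarrow> \<not> linked k (fst (chain_label k i))"
  using linked_odd[of k "offset i"] by (simp add: chain_label_def)

lemma card_chain_row_True: "card (chain_row k (r, True)) \<le> of_bool (\<not> linked k r)"
proof -
  have z: "g i = 0 \<and> \<not> linked k r" if "i \<in> chain_row k (r, True)" for i
    using that chain_label_middle[of i k] by (cases "g i = 0") (auto simp: chain_label_def)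
  show ?thesis
  proof (cases "linked k r")
    case True
    then have "chain_row k (r, True) = {}" using z by blast
    then show ?thesis by (simp only: card.empty)
  next
    case False
    have "card (chain_row k (r, True)) \<le> card {0 :: int}"
      by (rule card_inj_on_le[OF inj_on_chain_row]) (use z in auto)
    then show ?thesis using False by simp
  qed
qed

text \<open>Such a chain takes at most one vector from every nonzero degree whose piece reaches row \<open>r\<close>.\<close>
lemma card_chain_row_False:
  assumes "\<not> linked k r" "r < length shape"
  shows "card (chain_row k (r, False)) + of_bool (r < 2 * a) \<le> shape ! r"
proof -
  let ?L = "{\<gamma> \<in> levels - {0}. r < level_size \<gamma>}"
  have "card (chain_row k (r, False)) \<le> card ?L"
  proof (rule card_inj_on_le[OF inj_on_chain_row])
    show "g ` chain_row k (r, False) \<subseteq> ?L"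
    proof
      fix \<gamma> assume "\<gamma> \<in> g ` chain_row k (r, False)"
      then obtain i where i: "i < 2 * n" "chain_label k i = (r, False)" "\<gamma> = g i" by auto
      have nz: "g i \<noteq> 0" using chain_label_middle[of i k] i assms(1) by auto
      then have r: "r = (if i < n \<and> linked k (offset i) then partner (offset i) else offset i)"
        using i(2) by (simp add: chain_label_def)
      then have "r = offset i" using assms(1) by (auto split: if_splits)
      then show "\<gamma> \<in> ?L"
        using offset_less_level(1)[OF i(1) nz] grade_in_levels[OF i(1)] nz i(3) by simp
    qed
  qed simp
  moreover have "{\<gamma> \<in> levels. r < level_size \<gamma>} = ?L \<union> (if r < 2 * a then {0} else {})"
  proof -
    have "0 \<in> levels" using ns_nonempty by (cases "length ns") (auto simp: levels_def)
    then show ?thesis using level_size_0 by auto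
  qed
  then have "shape ! r = card (?L \<union> (if r < 2 * a then {0} else {}))"
    by (simp only: nth_shape[OF assms(2)])
  moreover have "card (?L \<union> (if r < 2 * a then {0} else {})) = card ?L + of_bool (r < 2 * a)"
    by (subst card_Un_disjoint) auto
  ultimately show ?thesis by simp
qed

lemma C_collapse_shape: "C_collapse shape = map (paired_collapse shape a) [0..<length shape]"
  by (rule C_collapse_paired[OF shape_sorted shape_pos length_shape_ge(1) odd_shape even_shape])

text \<open>In the linked case the right side is \<open>2k\<close>. Otherwise rows of lengths \<open>p\<close> and \<open>q < k\<close> contribute at
  most \<open>min k (p - 1)\<close> and \<open>q - 1\<close>, and the two chains of length 1 at most 2; the collapse has rows
  \<open>p - 1\<close> and \<open>q + 1\<close> instead if \<open>q < p\<close>.\<close>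
lemma chain_rows_pair_le:
  assumes j: "j < a"
  shows "(min k (card (chain_row k (2 * j, False))) + min k (card (chain_row k (2 * j + 1, False)))) +
      (min k (card (chain_row k (2 * j, True))) + min k (card (chain_row k (2 * j + 1, True))))
    \<le> min k (paired_collapse shape a (2 * j)) + min k (paired_collapse shape a (2 * j + 1))"
proof -
  let ?p = "shape ! (2 * j)" and ?q = "shape ! (2 * j + 1)"
  have len: "2 * j + 1 < length shape" using length_shape_ge(1) j by linarith
  have pq: "odd ?p" "odd ?q" "?q \<le> ?p"
    using odd_shape[of "2 * j"] odd_shape[of "2 * j + 1"] j shape_sorted len
    by (auto simp: sorted_wrt_iff_nth_less)
  have f: "paired_collapse shape a (2 * j) = (if ?q < ?p then ?p - 1 else ?p)"
      "paired_collapse shape a (2 * j + 1) = (if ?q < ?p then ?q + 1 else ?q)"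
    using j by (auto simp: paired_collapse_def)
  have lk: "linked k (2 * j) \<longleftrightarrow> k \<le> ?q" "linked k (2 * j + 1) \<longleftrightarrow> k \<le> ?q"
    using j by (auto simp: linked_def)
  have T: "card (chain_row k (2 * j, True)) \<le> of_bool (\<not> k \<le> ?q)"
      "card (chain_row k (2 * j + 1, True)) \<le> of_bool (\<not> k \<le> ?q)"
    using card_chain_row_True[of k "2 * j"] card_chain_row_True[of k "2 * j + 1"] unfolding lk by auto
  have F: "card (chain_row k (2 * j, False)) + 1 \<le> ?p" "card (chain_row k (2 * j + 1, False)) + 1 \<le> ?q"
    if "\<not> k \<le> ?q"
    using that card_chain_row_False[of k "2 * j"] card_chain_row_False[of k "2 * j + 1"] lk len j by auto
  have arith: "min k A + min k B + (min k C + min k D) \<le>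
      min k (if q < p then p - 1 else p) + min k (if q < p then q + 1 else q)"
    if "q \<le> p" "C \<le> of_bool (\<not> k \<le> q)" "D \<le> of_bool (\<not> k \<le> q)"
      "\<not> k \<le> q \<Longrightarrow> A + 1 \<le> p" "\<not> k \<le> q \<Longrightarrow> B + 1 \<le> q" for A B C D p q :: nat
    using that by (cases "k \<le> q"; cases "q < p") (auto simp: min_def)
  show ?thesis unfolding f by (rule arith[OF pq(3) T F])
qed

lemma card_chain_bottom_le:
  "card {j. j < 2 * n \<and> card (chain_structure.above (2 * n) (chain_label k) g j) < k} \<le>
     trunc_size k (C_collapse shape)"
proof -
  interpret chain_structure "2 * n" "chain_label k" g by (rule chain_structure_label)
  let ?F = "\<lambda>r. min k (card (chain_row k (r, False)))" and ?T = "\<lambda>r. min k (card (chain_row k (r, True)))"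
  let ?c = "\<lambda>r. min k (paired_collapse shape a r)"
  let ?m = "length shape"
  let ?R = "(\<lambda>r. (r, False)) ` {..<?m} \<union> (\<lambda>r. (r, True)) ` {..<2 * a}"
  have split: "(\<Sum>r<?m. h r) = (\<Sum>r<2 * a. h r) + (\<Sum>r = 2 * a..<?m. h r)" for h :: "nat \<Rightarrow> nat"
    using sum.atLeastLessThan_concat[of 0 "2 * a" ?m h] length_shape_ge(1) by (simp add: atLeast0LessThan)
  have "card {j. j < 2 * n \<and> card (above j) < k} \<le> (\<Sum>c\<in>?R. min k (card (chain_row k c)))"
    by (rule card_few_above_le) (simp, rule chain_label_range)
  also have "\<dots> = (\<Sum>r<?m. ?F r) + (\<Sum>r<2 * a. ?T r)"
    by (subst sum.union_disjoint) (auto simp: sum.reindex inj_on_def)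
  also have "\<dots> = (\<Sum>r<2 * a. ?F r) + (\<Sum>r<2 * a. ?T r) + (\<Sum>r = 2 * a..<?m. ?F r)"
    unfolding split[of ?F] by simp
  also have "(\<Sum>r<2 * a. ?F r) + (\<Sum>r<2 * a. ?T r) \<le> (\<Sum>r<2 * a. ?c r)"
    unfolding sum_lessThan_pairs sum.distrib[symmetric]
    by (rule sum_mono) (rule chain_rows_pair_le, simp)
  also have "(\<Sum>r = 2 * a..<?m. ?F r) \<le> (\<Sum>r = 2 * a..<?m. ?c r)"
  proof (rule sum_mono)
    fix r assume r: "r \<in> {2 * a..<?m}"
    then have "card (chain_row k (r, False)) \<le> shape ! r"
      using card_chain_row_False[of k r] by (simp add: linked_def)
    moreover have "paired_collapse shape a r = shape ! r" using r by (simp add: paired_collapse_def)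
    ultimately show "?F r \<le> ?c r" by simp
  qed
  also have "(\<Sum>r<2 * a. ?c r) + (\<Sum>r = 2 * a..<?m. ?c r) = trunc_size k (C_collapse shape)"
    unfolding split[symmetric] C_collapse_shape trunc_size_def
    by (simp add: o_def interv_sum_list_conv_sum_set_nat atLeast0LessThan)
  finally show ?thesis by simp
qed

section \<open>The Richardson orbit\<close>

text \<open>All elements of the orbit have the same Jordan type \<open>d\<close>, so the bounds for different \<open>k\<close> may
  be taken from different elements of the nilradical.\<close>
lemma richardson_partition:
  assumes orbit: "is_nilpotent_orbit n \<O>"
    and dense: "subtopology (mat_topology (2 * n) (2 * n)) (graded 1) closure_of (\<O> \<inter> graded 1) = graded 1"
  shows "orbit_has_partition \<O> (C_collapse shape)"
proof -
  obtain X\<^sub>0 m where X0: "X\<^sub>0 \<in> sp n" "X\<^sub>0 ^\<^sub>m m = 0\<^sub>m (2 * n) (2 * n)" "\<O> = adjoint_orbit n X\<^sub>0"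
    using orbit unfolding is_nilpotent_orbit_def by blast
  obtain d where d: "is_partition (2 * n) d" "jordan_nf X\<^sub>0 (map (\<lambda>r. (r, 0)) d)"
    using nilpotent_jordan_type_exists[OF sp_carrier[OF X0(1)] X0(2)] by blast
  have jnf: "jordan_nf X (map (\<lambda>r. (r, 0)) d)" if "X \<in> \<O>" for X
  proof -
    have "similar_mat X X\<^sub>0" using that unfolding X0(3) adjoint_orbit_def similar_mat_def by blast
    then show ?thesis using d(2) similar_mat_trans unfolding jordan_nf_def by blast
  qed
  have rank: "has_rank (2 * n) (X ^\<^sub>m k) (\<Sum>x\<leftarrow>d. x - k)"
    if "X \<in> \<O>" "X \<in> carrier_mat (2 * n) (2 * n)" for X k
    using has_rank_jordan_nf(2)[OF that(2) jnf[OF that(1)]] .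
  have excess: "trunc_size k d + (\<Sum>x\<leftarrow>d. x - k) = 2 * n" for k
    using trunc_size_add_excess[of k d] d(1) by (simp add: is_partition_def)
  have dC: "is_C_partition (2 * n) d" by (rule sp_jordan_type_C_partition[OF X0(1) d])
  have sub: "graded 1 \<subseteq> carrier_mat (2 * n) (2 * n)" using gradedD(2) by blast
  have upper: "trunc_size k d \<le> trunc_size k (C_collapse shape)"
    and lower: "trunc_size k shape \<le> trunc_size k d" for k
  proof -
    interpret chain_structure "2 * n" "chain_label k" g by (rule chain_structure_label)
    have s: "chain_sign i j * chain_sign i j = 1" for i j by (simp add: chain_sign_def)
    obtain X where X: "X \<in> \<O> \<inter> graded 1"
        "\<And>r. X \<in> carrier_mat (2 * n) (2 * n) \<Longrightarrow> has_rank (2 * n) (X ^\<^sub>m k) r \<Longrightarrow>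
          2 * n \<le> r + card {j. j < 2 * n \<and> card (above j) < k}"
      using dense_contains_large_rank[OF sub dense s chain_mat_in_graded_1[of k], of k] by blast
    have Xc: "X \<in> carrier_mat (2 * n) (2 * n)" using X(1) sub by blast
    have fr: "has_rank (2 * n) (X ^\<^sub>m k) (\<Sum>x\<leftarrow>d. x - k)" using rank X(1) Xc by blast
    have "2 * n \<le> (\<Sum>x\<leftarrow>d. x - k) + trunc_size k (C_collapse shape)"
      using X(2)[OF Xc fr] card_chain_bottom_le[of k] by linarith
    then show "trunc_size k d \<le> trunc_size k (C_collapse shape)" using excess[of k] by linarith
    show "trunc_size k shape \<le> trunc_size k d"
      using graded_rank_bound[OF _ fr] X(1) excess[of k] by simp
  qed
  have sum_d: "sum_list d = 2 * n" "sorted_wrt (\<ge>) d" using d(1) by (auto simp: is_partition_def)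
  have dom: "dominates shape d"
    using lower sum_d sum_shape by (intro dominates_if_trunc_size_le shape_sorted) auto
  have C: "is_C_partition (2 * n) (C_collapse shape)"
    using paired_collapse_C_partition[OF shape_sorted shape_pos length_shape_ge(1) odd_shape even_shape]
    unfolding C_collapse_shape sum_shape .
  have "dominates (C_collapse shape) d"
    unfolding C_collapse_shape
    by (rule paired_collapse_greatest[OF shape_sorted shape_pos length_shape_ge(1) odd_shape even_shape])
      (use dC dom sum_shape in auto)
  moreover have "dominates d (C_collapse shape)"
    using upper C sum_d by (intro dominates_if_trunc_size_le) (auto simp: is_C_partition_def is_partition_def)
  ultimately have "d = C_collapse shape"
    using d(1) C by (intro dominates_antisym) (auto simp: is_C_partition_def)
  then show ?thesis using jnf unfolding orbit_has_partition_def by blast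
qed

end

theorem theorem6p6:
  fixes n :: nat and ns :: "nat list" and I :: "weight set" and \<O> :: "complex mat set"
  assumes "n \<ge> 1"
    and "I \<subseteq> simple_roots n"
    and "parabolic_type n I ns"
    and "is_richardson_orbit n (standard_parabolic n I) \<O>"
  shows "let p = Z_diagram (last ns) (butlast ns) in
    (\<exists>ms s. mset ms = mset ns \<and> s < length ms \<and> ms ! s = last ns \<and>
       sorted_wrt (\<ge>) (Z_columns ms s) \<and>
       transpose_partition p = filter (\<lambda>m. 0 < m) (Z_columns ms s)) \<and>
    orbit_has_partition \<O> (C_collapse p)"
proof -
  have ns: "ns \<noteq> []" "sum_list ns = n" using assms(3) by (auto simp: parabolic_type_def)
  interpret block_type n ns by unfold_locales (rule ns)+
  have nil: "nilradical n (standard_parabolic n I) = graded 1"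
    by (rule nilradical_standard_parabolic[OF assms(1-3)])
  have "orbit_has_partition \<O> (C_collapse shape)"
    using assms(4) unfolding is_richardson_orbit_def nil Let_def by (intro richardson_partition) auto
  then show ?thesis
    using Z_diagram_columns[OF ns(1)] unfolding shape_def Let_def by blast
qed

end
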